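(* Let $k\ge 2$ and let $f$ be a nonnegative, nondegenerate real-valued $k$-regular sequence with minimal nondegenerate linear representation $(\mathbf u,\mathcal A,\mathbf v)$. Suppose that the matrices in $\widehat{\mathcal A}$ are nonnegative, do not share a nontrivial invariant subspace, and that $\rho^*:=\rho^*(\widehat{\mathcal A})<\rho:=\rho(\widehat{\mathbf A})$. Then: (i) $\rho/k<\rho^*$ if and only if all ghost measures of $f$ are singular continuous (with respect to Lebesgue measure); (ii) $\rho/k=\rho^*$ if and only if all ghost measures of $f$ are absolutely continuous (with respect to Lebesgue measure).
   Context: Regular sequences. Fix an integer $k\ge2$. For $n\ge1$ let $(n)_k=i_s\cdots i_0$ be the base-$k$ expansion ($i_s\ne0$), and for $d\times d$ matrices $\mathbf A_0,\dots,\mathbf A_{k-1}$ put $\mathbf A_{(n)_k}=\mathbf A_{i_s}\cdots\mathbf A_{i_0}$, with $\mathbf A_{(0)_k}$ the identity. A real sequence $f=(f(n))_{n\ge0}$ is $k$-regular if its $k$-kernel $\{(f(k^\ell n+r))_{n\ge 0}:\ell\ge0,\ 0\le r<k^\ell\}$ spans a finite-dimensional real vector space $V_k(f)$. A linear representation of $f$ of degree $d$ is a tuple $(\mathbf u,\mathcal A,\mathbf v)$ with $\mathbf u,\mathbf v\in\mathbb R^{d}$, $\mathcal A=\{\mathbf A_0,\dots,\mathbf A_{k-1}\}\subset\mathbb R^{d\times d}$ and $f(n)=\mathbf u^T\mathbf A_{(n)_k}\mathbf v$ for all $n\ge 0$; it is minimal if $d=\dim V_k(f)$. Put $\mathbf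 A=\sum_{j=0}^{k-1}\mathbf A_j$. Ghost measures. For nonnegative $f$ put $\Sigma_f(N)=\sum_{m=k^N}^{k^{N+1}-1}f(m)$ and, when $\Sigma_f(N)\neq0$, $\mu_N=\frac1{\Sigma_f(N)}\sum_{m=0}^{k^{N+1}-k^N-1}f(k^N+m)\,\delta_{m/(k^N(k-1))}$, a probability measure on $\mathbb T=[0,1)$ with addition mod $1$. Ghost measures of $f$ are the weak accumulation points of $(\mu_N)_N$. Group and nondegeneracy. Let $V\subset\mathbb R^d$ be the subspace with $V^T=\mathrm{span}\{\mathbf u^T\mathbf A_{(n)_k}:n\ge1\}$, $\mathbf P_V$ the orthogonal projection onto $V$, $\widetilde{\mathbf A}_i=\mathbf P_V\mathbf A_i\mathbf P_V$, $\widetilde{\mathbf A}=\mathbf P_V\mathbf A\mathbf P_V$, $\tilde\rho=\rho(\widetilde{\mathbf A})$ the spectral radius, $\{g_1\tilde\rho,\dots,g_s\tilde\rho\}$ ($|g_i|=1$) the eigenvalues of $\widetilde{\mathbf A}$ of modulus $\tilde\rho$, $g=(g_1,\dots,g_s)$ and $G=\overline{\{g^n:n\in\mathbb N\}}$ (closure in the $s$-fold product of the complex unit circle). For $h\in G$ let $\mathbf R_h$ be multiplication by $h_m$ on the generalised eigenspace in $V$ (complexified) of $\widetilde{\mathbf A}$ for $g_m\tilde\rho$, and the identity on the other generalised eigenspaces in $V$ and on $V^\perp$; $\mathbf R=\mathbf R_{g^{-1}}$. Let $r$ be the maximal size of a Jordan block of $\widetilde{\mathbf A}$ for an eigenvalue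 of modulus $\tilde\rho$, $c_n=\frac{(r-1)!}{n^{r-1}\tilde\rho^{\,n-r+1}}$, $\mathbf P=\lim_{n\to\infty}c_n\mathbf R^n\widetilde{\mathbf A}^n$ (the limit exists). The representation is nondegenerate if $\tilde\rho>0$ and $\mathbf u^T(\mathbf A-\mathbf A_0)\mathbf R_h\mathbf P\mathbf v>0$ for all $h\in G$; $f$ is nondegenerate if it has a minimal nondegenerate linear representation. Reduced subspace. $\widehat V=\mathrm{span}\{\widetilde{\mathbf A}_0^m\widetilde{\mathbf A}_{(n)_k}\mathbf R_h\mathbf P\mathbf v: m,n\ge0,\ h\in G\}\subset V$ (with $\widetilde{\mathbf A}_{(0)_k}$ the identity); it is invariant under each $\widetilde{\mathbf A}_i$. $\widehat{\mathbf A}_i=\mathbf P_{\widehat V}\widetilde{\mathbf A}_i\mathbf P_{\widehat V}$ is the restriction of $\widetilde{\mathbf A}_i$ to $\widehat V$ ($\mathbf P_{\widehat V}$ the orthogonal projection onto $\widehat V$), $\widehat{\mathcal A}=\{\widehat{\mathbf A}_0,\dots,\widehat{\mathbf A}_{k-1}\}$, $\widehat{\mathbf A}=\sum_i\widehat{\mathbf A}_i$; one has $\rho(\widehat{\mathbf A})=\tilde\rho$. The elements of $\widehat{\mathcal A}$ are regarded as operators on $\widehat V$, written as matrices in a fixed basis of $\widehat V$: "nonnegative" means entrywise nonnegative in this basis, and "do not share a nontrivial invariant subspace" means that no subspace of $\widehat V$ other than $\{0\}$ and $\widehat V$ is invariant under all of them. The joint spectral radius is $\rho^*(\widehat{\mathcal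 A})=\lim_{n\to\infty}\max_{i_1,\dots,i_n}\|\widehat{\mathbf A}_{i_1}\cdots\widehat{\mathbf A}_{i_n}\|^{1/n}$. *)

theory Defs
  imports
    "Jordan_Normal_Form.Spectral_Radius"
    "HOL-Library.Function_Algebras"
    "HOL-Library.Countable_Set"
    "HOL-Probability.Probability"
begin

no_notation Matrix.vec_index (infixl "$" 100)

section \<open>Regular sequences and linear representations\<close>

global_interpretation seqs: vector_space "\<lambda>(c::real) (s::nat \<Rightarrow> real) n. c * s n"
  by unfold_locales (auto simp: fun_eq_iff algebra_simps)

definition kernel_seqs :: "nat \<Rightarrow> (nat \<Rightarrow> real) \<Rightarrow> (nat \<Rightarrow> real) set" where
  "kernel_seqs k f = {(\<lambda>n. f (k ^ l * n + r)) | l r. r < k ^ l}"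

definition k_regular :: "nat \<Rightarrow> (nat \<Rightarrow> real) \<Rightarrow> bool" where
  "k_regular k f \<longleftrightarrow> (\<exists>S. finite S \<and> seqs.span (kernel_seqs k f) = seqs.span S)"

text \<open>
  If the base-\<open>k\<close> expansion of \<open>n\<close> is \<open>i\<^sub>s \<dots> i\<^sub>0\<close> (most significant digit first),
  then \<open>digits_prod k A n\<close> is \<open>A i\<^sub>s ** \<dots> ** A i\<^sub>0\<close>, and it is the identity for \<open>n = 0\<close>.
  The guard \<open>k < 2\<close> only serves termination.
\<close>

function digits_prod :: "nat \<Rightarrow> (nat \<Rightarrow> real^'d^'d) \<Rightarrow> nat \<Rightarrow> real^'d^'d" where
  "digits_prod k A n =
     (if n = 0 \<or> k < 2 then Finite_Cartesian_Product.mat 1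
      else digits_prod k A (n div k) ** A (n mod k))"
  by auto
termination by (relation "Wellfounded.measure (\<lambda>(k, A, n). n)") auto

declare digits_prod.simps [simp del]

definition linear_representation ::
  "nat \<Rightarrow> (nat \<Rightarrow> real) \<Rightarrow> real^'d \<Rightarrow> (nat \<Rightarrow> real^'d^'d) \<Rightarrow> real^'d \<Rightarrow> bool" where
  "linear_representation k f u A v \<longleftrightarrow> (\<forall>n. f n = inner u (digits_prod k A n *v v))"

definition minimal_representation ::
  "nat \<Rightarrow> (nat \<Rightarrow> real) \<Rightarrow> real^'d \<Rightarrow> (nat \<Rightarrow> real^'d^'d) \<Rightarrow> real^'d \<Rightarrow> bool" where
  "minimal_representation k f u A v \<longleftrightarrow>
     linear_representation k f u A v \<and>
     CARD('d) = seqs.dim (seqs.span (kernel_seqs k f))"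


section \<open>Ghost measures\<close>

text \<open>
  The torus is represented by \<open>[0,1)\<close> with its Borel sets (which agree with those of the
  quotient topology); continuous functions on it are the continuous \<open>1\<close>-periodic functions
  on the real line.
\<close>

definition torus_borel :: "real measure" where
  "torus_borel = restrict_space borel {0..<1}"

definition torus_lebesgue :: "real measure" where
  "torus_lebesgue = restrict_space lborel {0..<1}"

definition torus_weak_conv :: "(nat \<Rightarrow> real measure) \<Rightarrow> real measure \<Rightarrow> bool" where
  "torus_weak_conv \<mu> \<nu> \<longleftrightarrow>
     (\<forall>\<phi>::real \<Rightarrow> real. continuous_on UNIV \<phi> \<and> (\<forall>x. \<phi> (x + 1) = \<phi> x) \<longrightarrow>
        (\<lambda>n. integral\<^sup>L (\<mu> n) \<phi>) \<longlonglongrightarrow> integral\<^sup>L \<nu> \<phi>)"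

definition block_sum :: "nat \<Rightarrow> (nat \<Rightarrow> real) \<Rightarrow> nat \<Rightarrow> real" where
  "block_sum k f N = (\<Sum>m = k ^ N..<k ^ (N + 1). f m)"

definition block_measure :: "nat \<Rightarrow> (nat \<Rightarrow> real) \<Rightarrow> nat \<Rightarrow> real measure" where
  "block_measure k f N =
     distr (point_measure {..<k ^ (N + 1) - k ^ N} (\<lambda>m. ennreal (f (k ^ N + m) / block_sum k f N)))
       torus_borel (\<lambda>m. real m / real (k ^ N * (k - 1)))"

text \<open>
  The weak topology on probability measures on the torus is metrizable, so accumulation points
  are limits of subsequences. Indices with \<open>block_sum k f N = 0\<close> are excluded, as there the
  normalised measure is undefined.
\<close>

definition ghost_measure :: "nat \<Rightarrow> (nat \<Rightarrow> real) \<Rightarrow> real measure \<Rightarrow> bool" where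
  "ghost_measure k f \<nu> \<longleftrightarrow>
     prob_space \<nu> \<and> sets \<nu> = sets torus_borel \<and>
     (\<exists>s::nat \<Rightarrow> nat. strict_mono s \<and> (\<forall>n. block_sum k f (s n) \<noteq> 0) \<and>
        torus_weak_conv (\<lambda>n. block_measure k f (s n)) \<nu>)"

definition singular_continuous :: "real measure \<Rightarrow> bool" where
  "singular_continuous \<nu> \<longleftrightarrow>
     (\<forall>x\<in>{0..<1}. emeasure \<nu> {x} = 0) \<and>
     (\<exists>S\<in>null_sets torus_lebesgue. space \<nu> - S \<in> null_sets \<nu>)"


section \<open>Linear algebra\<close>

text \<open>\<open>M ^ n\<close> on \<open>'a^'d^'d\<close> is the componentwise power, hence a separate matrix power.\<close>

definition matpow :: "'a::semiring_1^'d^'d \<Rightarrow> nat \<Rightarrow> 'a^'d^'d" where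
  "matpow M n = (((**) M) ^^ n) (Finite_Cartesian_Product.mat 1)"

definition orth_proj :: "(real^'d) set \<Rightarrow> real^'d^'d" where
  "orth_proj S = (THE P. \<forall>x. P *v x \<in> S \<and> (\<forall>y\<in>S. orthogonal (x - P *v x) y))"

text \<open>
  Translation into the dimension-free matrices of the \<open>Jordan_Normal_Form\<close> entry. The
  enumeration of the index type is immaterial for the similarity invariants used below.
\<close>

definition to_complex_mat :: "real^'d^'d \<Rightarrow> complex Matrix.mat" where
  "to_complex_mat M =
     Matrix.mat CARD('d) CARD('d)
       (\<lambda>(i, j). complex_of_real
          (M $ from_nat_into (UNIV :: 'd set) i $ from_nat_into (UNIV :: 'd set) j))"

definition spec_rad :: "real^'d^'d \<Rightarrow> real" where
  "spec_rad M = spectral_radius (to_complex_mat M)"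

definition peripheral_spectrum :: "real^'d^'d \<Rightarrow> complex set" where
  "peripheral_spectrum M = {z \<in> spectrum (to_complex_mat M). cmod z = spec_rad M}"

definition peripheral_jordan_size :: "real^'d^'d \<Rightarrow> nat" where
  "peripheral_jordan_size M =
     Max {s. \<exists>bs z. jordan_nf (to_complex_mat M) bs \<and> (s, z) \<in> set bs \<and> cmod z = spec_rad M}"

definition complexified :: "(real^'d) set \<Rightarrow> (complex^'d) set" where
  "complexified S = {x. (\<chi> i. Re (x $ i)) \<in> S \<and> (\<chi> i. Im (x $ i)) \<in> S}"

definition gen_eigenspace :: "(real^'d) set \<Rightarrow> real^'d^'d \<Rightarrow> complex \<Rightarrow> (complex^'d) set" where
  "gen_eigenspace S M z =
     {x \<in> complexified S.
        \<exists>n. matpow (map_matrix complex_of_real M - Finite_Cartesian_Product.mat z) n *v x = 0}"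

definition joint_spectral_radius :: "nat \<Rightarrow> (nat \<Rightarrow> real^'d^'d) \<Rightarrow> real" where
  "joint_spectral_radius k A =
     lim (\<lambda>n. Max {root n (onorm ((*v) (foldr (\<lambda>i M. A i ** M) w (Finite_Cartesian_Product.mat 1)))) | w.
                  length w = n \<and> set w \<subseteq> {..<k}})"


section \<open>Nondegeneracy\<close>

definition rep_space :: "nat \<Rightarrow> real^'d \<Rightarrow> (nat \<Rightarrow> real^'d^'d) \<Rightarrow> (real^'d) set" where
  "rep_space k u A = Real_Vector_Spaces.span {u v* digits_prod k A n | n. n \<ge> 1}"

definition tilde :: "nat \<Rightarrow> real^'d \<Rightarrow> (nat \<Rightarrow> real^'d^'d) \<Rightarrow> nat \<Rightarrow> real^'d^'d" where
  "tilde k u A i = orth_proj (rep_space k u A) ** A i ** orth_proj (rep_space k u A)"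

definition tilde_sum :: "nat \<Rightarrow> real^'d \<Rightarrow> (nat \<Rightarrow> real^'d^'d) \<Rightarrow> real^'d^'d" where
  "tilde_sum k u A =
     orth_proj (rep_space k u A) ** (\<Sum>j<k. A j) ** orth_proj (rep_space k u A)"

text \<open>
  The tuple \<open>(g\<^sub>1, \<dots>, g\<^sub>s)\<close> is indexed by the peripheral eigenvalues
  \<open>g\<^sub>1 \<rho>, \<dots>, g\<^sub>s \<rho>\<close> themselves and padded with \<open>1\<close> elsewhere. The closure below is the
  one in the product topology; as all elements are \<open>1\<close> outside the finitely many peripheral
  eigenvalues, it is the closure in the finite product of unit circles.
\<close>

definition phases :: "nat \<Rightarrow> real^'d \<Rightarrow> (nat \<Rightarrow> real^'d^'d) \<Rightarrow> complex \<Rightarrow> complex" where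
  "phases k u A z =
     (if z \<in> peripheral_spectrum (tilde_sum k u A)
      then z / complex_of_real (spec_rad (tilde_sum k u A)) else 1)"

definition phase_group ::
  "nat \<Rightarrow> real^'d \<Rightarrow> (nat \<Rightarrow> real^'d^'d) \<Rightarrow> (complex \<Rightarrow> complex) set" where
  "phase_group k u A = closure {(\<lambda>z. phases k u A z ^ n) | n::nat. True}"

text \<open>
  The peripheral spectrum is closed under conjugation and \<open>h (cnj z) = cnj (h z)\<close> for all \<open>h\<close>
  in \<open>phase_group\<close>, so the operator acting by \<open>h z\<close> on the generalised eigenspace of
  \<open>z\<close> is given by a real matrix; it is unique, since these spaces and the orthogonal
  complement span everything.
\<close>

definition phase_mult ::
  "nat \<Rightarrow> real^'d \<Rightarrow> (nat \<Rightarrow> real^'d^'d) \<Rightarrow> (complex \<Rightarrow> complex) \<Rightarrow> real^'d^'d" where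
  "phase_mult k u A h =
     (THE R.
        (\<forall>z. \<forall>x\<in>gen_eigenspace (rep_space k u A) (tilde_sum k u A) z.
           map_matrix complex_of_real R *v x =
             (if z \<in> peripheral_spectrum (tilde_sum k u A) then h z else 1) *s x) \<and>
        (\<forall>x\<in>orthogonal_comp (rep_space k u A). R *v x = x))"

definition limit_matrix :: "nat \<Rightarrow> real^'d \<Rightarrow> (nat \<Rightarrow> real^'d^'d) \<Rightarrow> real^'d^'d" where
  "limit_matrix k u A =
     (let \<rho> = spec_rad (tilde_sum k u A);
          r = peripheral_jordan_size (tilde_sum k u A);
          R = phase_mult k u A (\<lambda>z. inverse (phases k u A z))
      in lim (\<lambda>n. (fact (r - 1) / (real n ^ (r - 1) * \<rho> powi (int n - int r + 1))) *\<^sub>R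
                  (matpow R n ** matpow (tilde_sum k u A) n)))"

definition nondegenerate_representation ::
  "nat \<Rightarrow> real^'d \<Rightarrow> (nat \<Rightarrow> real^'d^'d) \<Rightarrow> real^'d \<Rightarrow> bool" where
  "nondegenerate_representation k u A v \<longleftrightarrow>
     spec_rad (tilde_sum k u A) > 0 \<and>
     (\<forall>h\<in>phase_group k u A.
        inner u (((\<Sum>j<k. A j) - A 0) *v (phase_mult k u A h *v (limit_matrix k u A *v v))) > 0)"


section \<open>The reduced subspace\<close>

definition hat_space ::
  "nat \<Rightarrow> real^'d \<Rightarrow> (nat \<Rightarrow> real^'d^'d) \<Rightarrow> real^'d \<Rightarrow> (real^'d) set" where
  "hat_space k u A v =
     Real_Vector_Spaces.span
       {matpow (tilde k u A 0) m *v
          (digits_prod k (tilde k u A) n *v (phase_mult k u A h *v (limit_matrix k u A *v v)))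
        | m n h. h \<in> phase_group k u A}"

definition hat ::
  "nat \<Rightarrow> real^'d \<Rightarrow> (nat \<Rightarrow> real^'d^'d) \<Rightarrow> real^'d \<Rightarrow> nat \<Rightarrow> real^'d^'d" where
  "hat k u A v i =
     orth_proj (hat_space k u A v) ** tilde k u A i ** orth_proj (hat_space k u A v)"

text \<open>
  \<open>T\<close> is regarded as an operator on the span of the basis \<open>B\<close>; the coordinate of \<open>T *v b\<close>
  along \<open>c\<close> is the entry in row \<open>c\<close> and column \<open>b\<close>.
\<close>

definition nonneg_in_basis :: "(real^'d) set \<Rightarrow> real^'d^'d \<Rightarrow> bool" where
  "nonneg_in_basis B T \<longleftrightarrow>
     (\<forall>b\<in>B. \<forall>c\<in>B. Real_Vector_Spaces.representation B (T *v b) c \<ge> 0)"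

definition no_common_invariant_subspace ::
  "nat \<Rightarrow> (real^'d) set \<Rightarrow> (nat \<Rightarrow> real^'d^'d) \<Rightarrow> bool" where
  "no_common_invariant_subspace k S T \<longleftrightarrow>
     (\<forall>W. Real_Vector_Spaces.subspace W \<and> W \<subseteq> S \<and> (\<forall>i<k. \<forall>x\<in>W. T i *v x \<in> W) \<longrightarrow>
        W = {0} \<or> W = S)"

end

(*
The operators R_h and the limit P are linear combinations of the spectral projections of A~, which
are read off a Jordan normal form.

For h in the phase group put w_h = R_h P v. Along a subsequence N_j with g^N_j -> h, a ghost measure
gives the cylinder of a number m with L + 1 digits a mass proportional to
rho^-L u^T A_m w_(h g^-L), and w_(h g^-L) lies in the reduced space. Coordinatewise it is bounded by
a multiple of a positive vector y with A^ y = c y, c <= rho, obtained from Brouwer's theorem. So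
the mass is at most a constant times rho^-L e(A^_i1 ... A^_iL y), where e sums the coordinates.
This decays uniformly since rho* < rho, so there are no atoms.

If rho / k = rho*, irreducibility gives |A^_i1 ... A^_iL| <= C rho*^L, so a cylinder has mass at
most C k^-L and the measure is bounded by a multiple of Lebesgue measure.

If rho / k < rho*, consider the Hellinger affinity of the measure with Lebesgue measure,
sum_I sqrt(nu(I) lambda(I)) over the cylinders of level L. It is controlled by a quantity decreasing
in L by Cauchy-Schwarz. If it did not contract, compactness would give a row z >= 0 with
z A^_W y = (rho / k)^|W| z y for all words W, hence, by irreducibility, products bounded by
C (rho / k)^|W|, contradicting rho / k < rho*. So the affinity tends to 0, which means singularity.

Since rho / k <= rho* always, ghost measures exist, and no probability measure is both singular and
absolutely continuous, both equivalences follow.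
*)
theory Submission
  imports Defs
begin

section \<open>Spectral projections of a real matrix\<close>

text \<open>The definitions of R_h, P and the joint spectral radius go through \<open>THE\<close>
  and \<open>lim\<close>, which say nothing until existence is shown; hence explicit spectral
  projections and a Fekete argument precede any measure. The three properties of ghost measures (no
  atoms, absolute continuity, singularity) are all drawn from upper bounds on cylinder masses, and
  upper bounds survive the passage to a weak limit. The vectors w_h may have coordinates of either
  sign, so positivity arguments are run with y, which dominates them coordinatewise because it is
  strictly positive. The leading digit is special: it is nonzero and acts on u, which may lie
  outside V. So u^T A_m is compared with a multiple of e times the product over the remaining
  digits. From the leading digit on, rows stay in V and columns in the reduced space, and there the
  matrices compressed by orthogonal projections act like the original ones. Atoms are excluded
  first, because test functions supported in a cylinder only control its interior, and the endpoint
  must then be negligible.\<close>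

fun jordan_proj :: "(nat \<times> 'a::comm_ring_1) list \<Rightarrow> 'a \<Rightarrow> 'a Matrix.mat" where
  "jordan_proj [] z = 1\<^sub>m 0"
| "jordan_proj ((n, a) # bs) z =
     four_block_mat (if a = z then 1\<^sub>m n else 0\<^sub>m n n) (0\<^sub>m n (sum_list (map fst bs)))
       (0\<^sub>m (sum_list (map fst bs)) n) (jordan_proj bs z)"

lemma jordan_proj_carrier:
  "jordan_proj bs z \<in> carrier_mat (sum_list (map fst bs)) (sum_list (map fst bs))"
  by (induction bs z rule: jordan_proj.induct) auto

lemma mult_block_diag:
  fixes A :: "'a::comm_ring_1 Matrix.mat"
  assumes "A \<in> carrier_mat n n" "A' \<in> carrier_mat n n" "B \<in> carrier_mat m m" "B' \<in> carrier_mat m m"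
  shows "four_block_mat A (0\<^sub>m n m) (0\<^sub>m m n) B * four_block_mat A' (0\<^sub>m n m) (0\<^sub>m m n) B' =
    four_block_mat (A * A') (0\<^sub>m n m) (0\<^sub>m m n) (B * B')"
  using assms by (subst mult_four_block_mat[of _ n n _ m _ m]) auto

text \<open>\<open>jordan_proj bs z\<close> is the projection onto the generalised eigenspace of
  \<open>z\<close> in Jordan coordinates: identity on the blocks for \<open>z\<close>, zero on the
  others. Blockwise the claim is commutation with 0 or 1.\<close>

lemma jordan_proj_commute:
  "jordan_matrix bs * jordan_proj bs z = jordan_proj bs z * jordan_matrix bs"
proof (induction bs)
  case Nil
  then show ?case by (auto simp: jordan_matrix_def)
next
  case (Cons b bs)
  obtain n a where b: "b = (n, a)" by force
  show ?case
    using Cons unfolding b jordan_matrix_Cons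
    by (simp add: mult_block_diag[OF _ _ jordan_proj_carrier]
        mult_block_diag[OF _ _ _ jordan_proj_carrier])
qed

text \<open>Each diagonal position lies in exactly one Jordan block, so exactly one \<open>z\<close>
  in \<open>Z\<close> contributes there.\<close>

lemma jordan_proj_sum:
  assumes "finite Z" "snd ` set bs \<subseteq> Z" "i < sum_list (map fst bs)" "j < sum_list (map fst bs)"
  shows "(\<Sum>z\<in>Z. jordan_proj bs z $$ (i, j)) = (if i = j then 1 else 0)"
  using assms(2-)
proof (induction bs arbitrary: i j)
  case Nil
  then show ?case by auto
next
  case (Cons b bs)
  obtain n a where b: "b = (n, a)" by force
  let ?N = "sum_list (map fst bs)"
  have dim: "dim_row (jordan_proj bs z) = ?N" "dim_col (jordan_proj bs z) = ?N" for z
    using jordan_proj_carrier[of bs z] by auto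
  have a: "a \<in> Z" using Cons b by auto
  show ?case
  proof (cases "i < n \<and> j < n")
    case True
    then have "(\<Sum>z\<in>Z. jordan_proj (b # bs) z $$ (i, j)) =
        (\<Sum>z\<in>Z. if a = z then if i = j then 1 else 0 else 0)"
      by (intro sum.cong) (auto simp: b dim)
    then show ?thesis using a assms(1) by simp
  next
    case False
    show ?thesis
    proof (cases "\<not> i < n \<and> \<not> j < n")
      case True
      have "(\<Sum>z\<in>Z. jordan_proj (b # bs) z $$ (i, j)) = (\<Sum>z\<in>Z. jordan_proj bs z $$ (i - n, j - n))"
        using True Cons.prems by (intro sum.cong) (auto simp: b dim)
      also have "\<dots> = (if i - n = j - n then 1 else 0)"
        using True Cons.prems by (intro Cons.IH) (auto simp: b)
      also have "\<dots> = (if i = j then 1 else 0)" using True by auto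
      finally show ?thesis .
    next
      case not_both: False
      have "(\<Sum>z\<in>Z. jordan_proj (b # bs) z $$ (i, j)) = (\<Sum>z\<in>Z. 0)"
        using False not_both Cons.prems by (intro sum.cong) (auto simp: b dim)
      then show ?thesis using False not_both by auto
    qed
  qed
qed

lemma jordan_block_shift_pow_eq_0:
  fixes z :: "'a::comm_ring_1"
  assumes "n \<le> s"
  shows "(jordan_block n z - z \<cdot>\<^sub>m 1\<^sub>m n) ^\<^sub>m s = 0\<^sub>m n n"
proof -
  have "jordan_block n z - z \<cdot>\<^sub>m 1\<^sub>m n = jordan_block n 0"
    by (intro eq_matI) auto
  \<comment> \<open>Entries of powers of a Jordan block carry the factor a^(s + i - j); for a = 0 it
    vanishes because j < n <= s makes the truncated exponent positive.\<close>
  moreover have "(0::'a) ^ (s + i - j) = 0" if "j < n" for i j :: nat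
    using that assms by (simp add: power_0_left)
  ultimately show ?thesis
    by (auto intro!: eq_matI simp: jordan_block_pow)
qed

text \<open>Blocks of other eigenvalues are erased by the projection; a block for \<open>z\<close>
  becomes a nilpotent shift, killed by every power not below its size.\<close>

lemma jordan_proj_nilpotent:
  assumes "\<And>n. (n, z) \<in> set bs \<Longrightarrow> n \<le> s"
  shows "(jordan_matrix bs - z \<cdot>\<^sub>m 1\<^sub>m (sum_list (map fst bs))) ^\<^sub>m s * jordan_proj bs z =
    0\<^sub>m (sum_list (map fst bs)) (sum_list (map fst bs))"
  using assms
proof (induction bs)
  case Nil
  then show ?case by (auto intro!: eq_matI)
next
  case (Cons b bs)
  obtain n a where b: "b = (n, a)" by force
  let ?N = "sum_list (map fst bs)"
  have eq: "jordan_matrix (b # bs) - z \<cdot>\<^sub>m 1\<^sub>m (sum_list (map fst (b # bs))) =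
    four_block_mat (jordan_block n a - z \<cdot>\<^sub>m 1\<^sub>m n) (0\<^sub>m n ?N) (0\<^sub>m ?N n)
      (jordan_matrix bs - z \<cdot>\<^sub>m 1\<^sub>m ?N)"
    unfolding b jordan_matrix_Cons by (intro eq_matI) auto
  have car: "jordan_matrix bs - z \<cdot>\<^sub>m 1\<^sub>m ?N \<in> carrier_mat ?N ?N"
    "jordan_block n a - z \<cdot>\<^sub>m 1\<^sub>m n \<in> carrier_mat n n" by auto
  have IH: "(jordan_matrix bs - z \<cdot>\<^sub>m 1\<^sub>m ?N) ^\<^sub>m s * jordan_proj bs z = 0\<^sub>m ?N ?N"
    using Cons by auto
  have "(jordan_block n a - z \<cdot>\<^sub>m 1\<^sub>m n) ^\<^sub>m s * (if a = z then 1\<^sub>m n else 0\<^sub>m n n) = 0\<^sub>m n n"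
    using Cons.prems[of n] jordan_block_shift_pow_eq_0[of n s z] by (auto simp: b)
  then show ?case
    unfolding eq pow_four_block_mat[OF car(2,1)] using IH car
    by (simp add: b mult_block_diag[OF _ _ _ jordan_proj_carrier])
qed

section \<open>Transfer between dimension-free and typed matrices\<close>

abbreviation cmat :: "real^'n^'n \<Rightarrow> complex^'n^'n" where
  "cmat \<equiv> map_matrix complex_of_real"

abbreviation idx :: "'d::finite \<Rightarrow> nat" where
  "idx \<equiv> to_nat_on (UNIV :: 'd set)"

text \<open>Undoes \<open>to_complex_mat\<close>: \<open>idx\<close> inverts the enumeration
  \<open>from_nat_into\<close> used there. Through it a Jordan normal form becomes a statement about
  typed matrices.\<close>

definition from_mat :: "complex Matrix.mat \<Rightarrow> complex^'d^'d" where
  "from_mat X = (\<chi> a b. X $$ (idx a, idx b))"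

lemma idx_less: "idx (a::'d::finite) < CARD('d)"
  using bij_betwE[OF to_nat_on_finite[of "UNIV :: 'd set"]] by auto

lemma idx_inj: "idx (a::'d::finite) = idx b \<longleftrightarrow> a = b"
  using bij_betw_imp_inj_on[OF to_nat_on_finite[of "UNIV :: 'd set"]] by (auto simp: inj_on_def)

lemma sum_idx: "(\<Sum>i<CARD('d::finite). g i) = (\<Sum>a\<in>(UNIV::'d set). g (idx a))"
  by (rule sum.reindex_bij_betw[symmetric]) (use to_nat_on_finite[of "UNIV :: 'd set"] in auto)

lemma from_mat_mult:
  assumes "X \<in> carrier_mat CARD('d) CARD('d)" "Y \<in> carrier_mat CARD('d) CARD('d)"
  shows "(from_mat (X * Y) :: complex^'d^'d) = from_mat X ** from_mat Y"
  using assms idx_less[where 'd='d]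
  by (auto simp: vec_eq_iff from_mat_def matrix_matrix_mult_def scalar_prod_def atLeast0LessThan
      sum_idx[where 'd='d])

lemma from_mat_one: "from_mat (1\<^sub>m CARD('d)) = (Finite_Cartesian_Product.mat 1 :: complex^'d^'d)"
  by (auto simp: vec_eq_iff from_mat_def Finite_Cartesian_Product.mat_def idx_less idx_inj)

lemma from_mat_zero: "from_mat (0\<^sub>m CARD('d) CARD('d)) = (0 :: complex^'d^'d)"
  by (auto simp: vec_eq_iff from_mat_def idx_less)

lemma from_mat_to_complex_mat: "from_mat (to_complex_mat M) = cmat M"
  by (simp add: vec_eq_iff from_mat_def to_complex_mat_def idx_less)

lemma from_mat_shift:
  assumes "X \<in> carrier_mat CARD('d) CARD('d)"
  shows "(from_mat (X - z \<cdot>\<^sub>m 1\<^sub>m CARD('d)) :: complex^'d^'d) = from_mat X - Finite_Cartesian_Product.mat z"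
  using assms by (auto simp: vec_eq_iff from_mat_def Finite_Cartesian_Product.mat_def idx_less idx_inj)

lemma matpow_0 [simp]: "matpow M 0 = Finite_Cartesian_Product.mat 1"
  and matpow_Suc: "matpow M (Suc n) = M ** matpow M n"
  by (auto simp: matpow_def)

lemma matpow_commute:
  assumes "M ** X = X ** M"
  shows "matpow M n ** X = X ** matpow M n"
proof (induction n)
  case (Suc n)
  have "matpow M (Suc n) ** X = M ** (matpow M n ** X)" by (simp only: matpow_Suc matrix_mul_assoc)
  also have "\<dots> = X ** matpow M (Suc n)" by (simp only: Suc matrix_mul_assoc assms matpow_Suc)
  finally show ?case .
qed simp

lemma matpow_Suc2: "matpow M (Suc n) = matpow M n ** M"
  using matpow_commute[of M M n] by (simp add: matpow_Suc)

lemma matpow_add: "matpow M (m + n) = matpow M m ** matpow M n"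
  by (induction m) (auto simp: matpow_Suc matrix_mul_assoc)

lemma from_mat_pow:
  assumes "X \<in> carrier_mat CARD('d) CARD('d)"
  shows "(from_mat (X ^\<^sub>m n) :: complex^'d^'d) = matpow (from_mat X) n"
proof (induction n)
  case (Suc n)
  then show ?case
    using assms by (simp add: from_mat_mult matpow_Suc2)
qed (use assms in \<open>simp add: from_mat_one\<close>)

lemma to_complex_mat_carrier: "to_complex_mat (M :: real^'d^'d) \<in> carrier_mat CARD('d) CARD('d)"
  by (simp add: to_complex_mat_def)

lemma to_complex_mat_dim: "dim_row (to_complex_mat (M :: real^'d^'d)) = CARD('d)"
  by (simp add: to_complex_mat_def)

lemma finite_spectrum: "finite (spectrum (to_complex_mat M))"
  by (rule card_finite_spectrum[OF to_complex_mat_carrier])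

lemma cmod_le_spec_rad: "z \<in> spectrum (to_complex_mat M) \<Longrightarrow> cmod z \<le> spec_rad M"
  unfolding spec_rad_def by (rule spectral_radius_mem_max[OF to_complex_mat_carrier]) auto

lemma spec_rad_attained: "\<exists>z\<in>spectrum (to_complex_mat M). cmod z = spec_rad M"
  using spectral_radius_mem_max(1)[OF to_complex_mat_carrier[of M]] by (auto simp: spec_rad_def)

text \<open>Typed eigenvectors are needed later, to conjugate them and to place them in complexified
  real subspaces; coordinates are carried over the enumeration in both directions.\<close>

lemma spectrum_iff:
  "z \<in> spectrum (to_complex_mat (M :: real^'d^'d)) \<longleftrightarrow> (\<exists>x. x \<noteq> 0 \<and> cmat M *v x = z *s x)"
proof
  assume "z \<in> spectrum (to_complex_mat M)"
  then obtain v where v: "v \<in> carrier_vec CARD('d)" "v \<noteq> 0\<^sub>v CARD('d)"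
    "to_complex_mat M *\<^sub>v v = z \<cdot>\<^sub>v v"
    unfolding spectrum_def eigenvalue_def eigenvector_def mem_Collect_eq to_complex_mat_dim by blast
  define x :: "complex^'d" where "x = (\<chi> a. Matrix.vec_index v (idx a))"
  have "x \<noteq> 0"
  proof
    assume "x = 0"
    then have x0: "Matrix.vec_index v (idx a) = 0" for a :: 'd
      by (simp add: x_def vec_eq_iff)
    have "Matrix.vec_index v i = 0" if "i < CARD('d)" for i
    proof -
      from that obtain a :: 'd where "i = idx a"
        using bij_betw_imp_surj_on[OF to_nat_on_finite[of "UNIV :: 'd set"]] by (auto simp: set_eq_iff image_iff)
      then show ?thesis using x0 by simp
    qed
    then have "v = 0\<^sub>v CARD('d)" using v by (intro eq_vecI) auto
    with v show False by simp
  qed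
  moreover have "cmat M *v x = z *s x"
  proof (simp add: vec_eq_iff, safe)
    fix a :: 'd
    have "Matrix.vec_index (to_complex_mat M *\<^sub>v v) (idx a) = z * Matrix.vec_index v (idx a)"
      unfolding v(3) using v(1) idx_less[of a] by simp
    then show "(cmat M *v x) $ a = z * x $ a"
      using v idx_less[where 'd='d]
      by (simp add: x_def matrix_vector_mult_def to_complex_mat_def scalar_prod_def
          atLeast0LessThan sum_idx[where 'd='d])
  qed
  ultimately show "\<exists>x. x \<noteq> 0 \<and> cmat M *v x = z *s x" by (intro exI conjI)
next
  assume "\<exists>x. x \<noteq> 0 \<and> cmat M *v x = z *s x"
  then obtain x :: "complex^'d" where x: "x \<noteq> 0" "cmat M *v x = z *s x" by (elim exE conjE) (rule that)
  define v where "v = Matrix.vec CARD('d) (\<lambda>i. x $ from_nat_into UNIV i)"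
  have v: "v \<in> carrier_vec CARD('d)" by (simp add: v_def)
  from x(1) obtain a where "x $ a \<noteq> 0" by (auto simp: vec_eq_iff)
  then have "Matrix.vec_index v (idx a) \<noteq> 0" by (simp add: v_def idx_less)
  then have "v \<noteq> 0\<^sub>v CARD('d)" using idx_less[of a] by auto
  moreover have "to_complex_mat M *\<^sub>v v = z \<cdot>\<^sub>v v"
  proof (intro eq_vecI)
    fix i assume i: "i < dim_vec (z \<cdot>\<^sub>v v)"
    have "(cmat M *v x) $ from_nat_into UNIV i = z * x $ from_nat_into UNIV i"
      using x(2) by simp
    then show "Matrix.vec_index (to_complex_mat M *\<^sub>v v) i = Matrix.vec_index (z \<cdot>\<^sub>v v) i"
      using i idx_less[where 'd='d]
      by (simp add: v_def matrix_vector_mult_def to_complex_mat_def scalar_prod_def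
          atLeast0LessThan sum_idx[where 'd='d])
  qed (simp add: v_def to_complex_mat_def)
  ultimately show "z \<in> spectrum (to_complex_mat M)"
    using v unfolding spectrum_def eigenvalue_def eigenvector_def mem_Collect_eq to_complex_mat_dim by blast
qed

text \<open>The \<open>Max\<close> ranges over the blocks of all Jordan normal forms and is
  meaningful only if that set is finite: a block size is at most the order of its root in the
  characteristic polynomial, hence at most the degree.\<close>

lemma peripheral_jordan_size_upper:
  assumes "jordan_nf (to_complex_mat M) bs" "(s, z) \<in> set bs" "cmod z = spec_rad M"
  shows "s \<le> peripheral_jordan_size M"
proof -
  let ?S = "{s. \<exists>bs z. jordan_nf (to_complex_mat M) bs \<and> (s, z) \<in> set bs \<and> cmod z = spec_rad M}"
  let ?p = "char_poly (to_complex_mat M)"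
  have "?p \<noteq> 0" using degree_monic_char_poly[OF to_complex_mat_carrier[of M]] by auto
  then have "s \<le> degree ?p" if "s \<in> ?S" for s
    using that jordan_nf_block_size_order_bound order_degree order.trans by blast
  then have "finite ?S" by (meson finite_nat_set_iff_bounded_le)
  then show ?thesis using assms unfolding peripheral_jordan_size_def by (intro Max_ge) auto
qed

lemma matpow_similar:
  assumes "q ** p = Finite_Cartesian_Product.mat 1" "p ** q = Finite_Cartesian_Product.mat 1"
  shows "matpow (p ** X ** q) n = p ** matpow X n ** q"
proof (induction n)
  case (Suc n)
  have "matpow (p ** X ** q) (Suc n) = p ** X ** (q ** p) ** matpow X n ** q"
    by (simp only: matpow_Suc Suc matrix_mul_assoc)
  then show ?case by (simp add: assms matpow_Suc matrix_mul_assoc)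
qed (simp add: assms)

lemma mat_mult_scalar: "Finite_Cartesian_Product.mat z ** X = (\<chi> i j. z * X $ i $ j)"
  by (simp add: vec_eq_iff matrix_matrix_mult_def Finite_Cartesian_Product.mat_def if_distrib[where f = "\<lambda>x. x * y" for y] cong: if_cong)

lemma mult_mat_scalar:
  fixes X :: "'a::comm_semiring_1^'n^'m"
  shows "X ** Finite_Cartesian_Product.mat z = (\<chi> i j. z * X $ i $ j)"
  by (simp add: vec_eq_iff matrix_matrix_mult_def Finite_Cartesian_Product.mat_def
      if_distrib[where f = "\<lambda>x. y * x" for y] mult.commute cong: if_cong)

lemma matrix_mult_diff_distrib:
  fixes A :: "'a::comm_ring_1^'n^'m"
  shows "A ** (B - C) = A ** B - A ** C"
  by (simp add: vec_eq_iff matrix_matrix_mult_def sum_subtractf algebra_simps)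

lemma matrix_diff_mult_distrib:
  fixes A :: "'a::comm_ring_1^'n^'m"
  shows "(A - B) ** C = A ** C - B ** C"
  by (simp add: vec_eq_iff matrix_matrix_mult_def sum_subtractf algebra_simps)

lemma matrix_sum_mult_distrib:
  fixes f :: "'i \<Rightarrow> 'a::comm_ring_1^'n^'m"
  shows "(\<Sum>i\<in>I. f i) ** C = (\<Sum>i\<in>I. f i ** C)"
  by (induction I rule: infinite_finite_induct)
    (auto simp: vec_eq_iff matrix_matrix_mult_def sum.distrib algebra_simps)

lemma matrix_mult_sum_distrib:
  fixes f :: "'i \<Rightarrow> 'a::comm_ring_1^'n^'m"
  shows "C ** (\<Sum>i\<in>I. f i) = (\<Sum>i\<in>I. C ** f i)"
  by (induction I rule: infinite_finite_induct)
    (auto simp: vec_eq_iff matrix_matrix_mult_def sum.distrib algebra_simps)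

lemma matrix_sum_vector_mult:
  fixes f :: "'i \<Rightarrow> 'a::comm_ring_1^'n^'m"
  shows "(\<Sum>i\<in>I. f i) *v x = (\<Sum>i\<in>I. f i *v x)"
  by (induction I rule: infinite_finite_induct)
    (auto simp: vec_eq_iff matrix_vector_mult_def sum.distrib algebra_simps)

text \<open>The block projections of a Jordan normal form, conjugated by the similarity. For
  peripheral \<open>z\<close> the sharp exponent matters, since it fixes the power of n in the
  growth of the matrix powers; elsewhere the dimension suffices, as those parts decay geometrically
  after normalisation.\<close>

theorem spectral_decomposition:
  fixes M :: "real^'d^'d"
  obtains Z :: "complex set" and Pr :: "complex \<Rightarrow> complex^'d^'d" where
    "Z \<subseteq> spectrum (to_complex_mat M)"
    "(\<Sum>z\<in>Z. Pr z) = Finite_Cartesian_Product.mat 1"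
    "\<And>z. cmat M ** Pr z = Pr z ** cmat M"
    "\<And>z. matpow (cmat M - Finite_Cartesian_Product.mat z)
       (if cmod z = spec_rad M then peripheral_jordan_size M else CARD('d)) ** Pr z = 0"
proof -
  let ?d = "CARD('d)" and ?A = "to_complex_mat M" and ?I = "Finite_Cartesian_Product.mat 1 :: complex^'d^'d"
  have "\<exists>as. char_poly ?A = (\<Prod>a\<leftarrow>as. [:- a, 1:])"
    using char_poly_factorized[OF to_complex_mat_carrier[of M]] by blast
  then obtain bs where bs: "jordan_nf ?A bs"
    using jordan_nf_exists[OF to_complex_mat_carrier[of M]] by blast
  then obtain P Q where PQ: "similar_mat_wit ?A (jordan_matrix bs) P Q" and pos: "0 \<notin> fst ` set bs"
    by (auto simp: jordan_nf_def similar_mat_def)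
  note w = similar_mat_witD2[OF to_complex_mat_carrier PQ]
  have N: "sum_list (map fst bs) = ?d" using w(5) by (metis carrier_matD(1) jordan_matrix_dim(1))
  note E_car = jordan_proj_carrier[of bs, unfolded N]
  define p q j :: "complex^'d^'d" where "p = from_mat P" and "q = from_mat Q" and "j = from_mat (jordan_matrix bs)"
  have pq: "p ** q = ?I" "q ** p = ?I"
    using w by (simp_all add: p_def q_def from_mat_mult[symmetric] from_mat_one)
  have M: "cmat M = p ** j ** q"
    using w(3,5-7) by (simp add: p_def q_def j_def from_mat_mult[symmetric] from_mat_to_complex_mat[symmetric])
  define e :: "complex \<Rightarrow> complex^'d^'d" where "e z = from_mat (jordan_proj bs z)" for z
  define Pr where "Pr z = p ** e z ** q" for z
  have conj_mult: "(p ** X ** q) ** (p ** Y ** q) = p ** (X ** Y) ** q" for X Y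
  proof -
    have "(p ** X ** q) ** (p ** Y ** q) = p ** X ** (q ** p) ** Y ** q"
      by (simp only: matrix_mul_assoc)
    then show ?thesis by (simp add: pq matrix_mul_assoc)
  qed
  show thesis
  proof (rule that[of "snd ` set bs" Pr])
    show "snd ` set bs \<subseteq> spectrum ?A"
    proof
      fix z assume "z \<in> snd ` set bs"
      then obtain n where n: "(n, z) \<in> set bs" by auto
      then have "n \<noteq> 0" using pos by force
      have "poly (char_poly ?A) z = (\<Prod>(n, a)\<leftarrow>bs. poly ([:- a, 1:] ^ n) z)"
        unfolding jordan_nf_char_poly[OF bs] poly_prod_list map_map
        by (intro arg_cong[where f=prod_list] map_cong) auto
      also have "\<dots> = 0"
        unfolding prod_list_zero_iff using n \<open>n \<noteq> 0\<close> by (force simp: image_iff)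
      finally show "z \<in> spectrum ?A" by (simp add: spectrum_root_char_poly[OF to_complex_mat_carrier])
    qed
    have "(\<Sum>z\<in>snd ` set bs. e z) = ?I"
      by (simp add: vec_eq_iff e_def from_mat_def jordan_proj_sum idx_less N idx_inj
          Finite_Cartesian_Product.mat_def)
    then show "(\<Sum>z\<in>snd ` set bs. Pr z) = ?I"
      unfolding Pr_def matrix_sum_mult_distrib[symmetric] matrix_mult_sum_distrib[symmetric]
      by (simp add: pq)
    show "cmat M ** Pr z = Pr z ** cmat M" for z
    proof -
      have "j ** e z = e z ** j"
        unfolding e_def j_def from_mat_mult[OF w(5) E_car, symmetric]
          from_mat_mult[OF E_car w(5), symmetric] jordan_proj_commute by simp
      then show ?thesis unfolding Pr_def M conj_mult by simp
    qed
    show "matpow (cmat M - Finite_Cartesian_Product.mat z)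
       (if cmod z = spec_rad M then peripheral_jordan_size M else ?d) ** Pr z = 0" for z
    proof -
      let ?s = "if cmod z = spec_rad M then peripheral_jordan_size M else ?d"
      have "n \<le> ?s" if "(n, z) \<in> set bs" for n
      proof -
        have "n \<le> sum_list (map fst bs)"
          using that by (intro member_le_sum_list) force+
        then show ?thesis using peripheral_jordan_size_upper[OF bs that] N by auto
      qed
      from jordan_proj_nilpotent[of z bs, OF this]
      have "(jordan_matrix bs - z \<cdot>\<^sub>m 1\<^sub>m ?d) ^\<^sub>m ?s * jordan_proj bs z = 0\<^sub>m ?d ?d"
        by (simp add: N)
      moreover have "jordan_matrix bs - z \<cdot>\<^sub>m 1\<^sub>m ?d \<in> carrier_mat ?d ?d" using w(5) by auto
      ultimately have "matpow (j - Finite_Cartesian_Product.mat z) ?s ** e z = 0"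
        using w(5) E_car
        by (simp add: e_def j_def from_mat_shift[symmetric] from_mat_pow[symmetric]
            from_mat_mult[symmetric] from_mat_zero)
      moreover have "cmat M - Finite_Cartesian_Product.mat z = p ** (j - Finite_Cartesian_Product.mat z) ** q"
      proof -
        have "p ** Finite_Cartesian_Product.mat z ** q = Finite_Cartesian_Product.mat z ** (p ** q)"
          by (simp add: mult_mat_scalar mat_mult_scalar[symmetric] matrix_mul_assoc)
        then show ?thesis by (simp add: M matrix_mult_diff_distrib matrix_diff_mult_distrib pq)
      qed
      ultimately show ?thesis
        unfolding Pr_def by (simp add: matpow_similar pq conj_mult)
    qed
  qed
qed

section \<open>Asymptotics of powers on generalised eigenvectors\<close>

lemma tendsto_vector_smult:
  fixes x :: "'a::real_normed_algebra^'n"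
  assumes "(c \<longlongrightarrow> l) F" "(x' \<longlongrightarrow> x) F"
  shows "((\<lambda>n. c n *s x' n) \<longlongrightarrow> l *s x) F"
  by (intro vec_tendstoI) (auto intro!: tendsto_intros assms)

lemma binomial_over_power_tendsto:
  "(\<lambda>n. real (n choose j) / real n ^ j) \<longlonglongrightarrow> 1 / fact j"
proof -
  have lim1: "(\<lambda>n. (real n - real i) / real n) \<longlonglongrightarrow> 1" for i
  proof -
    have "(\<lambda>n. 1 - real i * (1 / real n)) \<longlonglongrightarrow> 1 - real i * 0"
      by (intro tendsto_intros lim_1_over_n)
    moreover have "\<forall>\<^sub>F n in sequentially. 1 - real i * (1 / real n) = (real n - real i) / real n"
      using eventually_gt_at_top[of 0] by eventually_elim (simp add: field_simps)
    ultimately show ?thesis by (auto intro: Lim_transform_eventually)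
  qed
  have "(\<lambda>n. (\<Prod>i<j. (real n - real i) / real n) / fact j) \<longlonglongrightarrow> (\<Prod>i<j. 1) / fact j"
    by (intro tendsto_intros lim1) auto
  moreover have "real (n choose j) / real n ^ j = (\<Prod>i<j. (real n - real i) / real n) / fact j" for n
    by (simp add: binomial_gbinomial gbinomial_prod_rev prod_dividef atLeast0LessThan)
  ultimately show ?thesis by simp
qed

lemma power_times_geometric_tendsto_0:
  fixes q :: real
  assumes "0 \<le> q" "q < 1"
  shows "(\<lambda>n. real n ^ j * q ^ n) \<longlonglongrightarrow> 0"
proof (cases "j = 0")
  case True
  then show ?thesis using assms by (simp add: LIMSEQ_realpow_zero)
next
  case False
  \<comment> \<open>Taking j-th roots reduces the claim to n t^n tending to 0.\<close>
  define t where "t = root j q"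
  have t: "0 \<le> t" "t < 1" "t ^ j = q" using assms False by (auto simp: t_def real_root_pow_pos2)
  have "(\<lambda>n. (real n * t ^ n) ^ j) \<longlonglongrightarrow> 0 ^ j"
    by (intro tendsto_power powser_times_n_limit_0) (use t in auto)
  moreover have "(real n * t ^ n) ^ j = real n ^ j * q ^ n" for n
    by (metis power_mult_distrib power_mult mult.commute t(3))
  ultimately show ?thesis using False by (simp add: power_0_left)
qed

text \<open>The binomial expansion of (z + N)^n with N = M - z, cut off where N^j x
  vanishes.\<close>

lemma matpow_gen_eigenvector:
  fixes M :: "complex^'n^'n"
  assumes "matpow (M - Finite_Cartesian_Product.mat z) s *v x = 0"
  shows "matpow M n *v x =
    (\<Sum>j<s. (of_nat (n choose j) * z ^ (n - j)) *s (matpow (M - Finite_Cartesian_Product.mat z) j *v x))"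
proof -
  define y where "y j = matpow (M - Finite_Cartesian_Product.mat z) j *v x" for j
  have mat_z: "Finite_Cartesian_Product.mat z *v w = z *s w" for w :: "complex^'n"
    by (simp add: vec_eq_iff matrix_vector_mult_def Finite_Cartesian_Product.mat_def
      if_distrib[where f = "\<lambda>x. x * y" for y] cong: if_cong)
  have M_y: "M *v y j = z *s y j + y (Suc j)" for j
  proof -
    have "y (Suc j) = (M - Finite_Cartesian_Product.mat z) *v y j"
      by (simp add: y_def matpow_Suc matrix_vector_mul_assoc)
    then show ?thesis by (simp add: matrix_vector_mult_diff_rdistrib mat_z)
  qed
  have y_0: "y j = 0" if "j \<ge> s" for j
  proof -
    have "y j = matpow (M - Finite_Cartesian_Product.mat z) (j - s) *v y s"
      using that by (simp add: y_def matrix_vector_mul_assoc matpow_add[symmetric])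
    then show ?thesis using assms by (simp add: y_def)
  qed
  have M_sum: "M *v (\<Sum>j\<in>J. a j *s y j) = (\<Sum>j\<in>J. (a j * z) *s y j) + (\<Sum>j\<in>J. a j *s y (Suc j))"
    if "finite J" for J a
    using that
  proof induction
    case (insert i J)
    have "M *v (a i *s y i) = a i *s (z *s y i + y (Suc i))"
      by (simp add: vector_scalar_commute M_y)
    then show ?case using insert by (simp add: matrix_vector_right_distrib vector_add_ldistrib vector_smult_assoc)
  qed simp
  have "matpow M n *v x = (\<Sum>j\<le>n. (of_nat (n choose j) * z ^ (n - j)) *s y j)"
  proof (induction n)
    case 0
    then show ?case by (simp add: y_def)
  next
    case (Suc n)
    have "matpow M (Suc n) *v x = M *v (\<Sum>j\<le>n. (of_nat (n choose j) * z ^ (n - j)) *s y j)"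
      by (simp add: matpow_Suc matrix_vector_mul_assoc[symmetric] Suc)
    also have "\<dots> = (\<Sum>j\<le>n. (of_nat (n choose j) * z ^ (n - j) * z) *s y j) +
      (\<Sum>j\<le>n. (of_nat (n choose j) * z ^ (n - j)) *s y (Suc j))"
      by (subst M_sum) auto
    also have "(\<Sum>j\<le>n. (of_nat (n choose j) * z ^ (n - j) * z) *s y j) =
      (\<Sum>j\<le>Suc n. (of_nat (n choose j) * z ^ (Suc n - j)) *s y j)"
      by (auto simp: Suc_diff_le mult_ac intro!: sum.cong)
    also have "\<dots> = z ^ Suc n *s y 0 +
      (\<Sum>j\<le>n. (of_nat (n choose Suc j) * z ^ (n - j)) *s y (Suc j))"
      by (subst sum.atMost_Suc_shift) simp
    also have "\<dots> + (\<Sum>j\<le>n. (of_nat (n choose j) * z ^ (n - j)) *s y (Suc j)) =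
      z ^ Suc n *s y 0 + (\<Sum>j\<le>n. (of_nat (n choose Suc j) * z ^ (n - j)) *s y (Suc j) +
        (of_nat (n choose j) * z ^ (n - j)) *s y (Suc j))"
      by (simp only: sum.distrib add.assoc)
    also have "\<dots> = z ^ Suc n *s y 0 + (\<Sum>j\<le>n. (of_nat (Suc n choose Suc j) * z ^ (n - j)) *s y (Suc j))"
      by (simp only: vector_sadd_rdistrib[symmetric] distrib_right[symmetric] of_nat_add[symmetric]
          binomial_Suc_Suc add.commute)
    also have "\<dots> = (\<Sum>j\<le>Suc n. (of_nat (Suc n choose j) * z ^ (Suc n - j)) *s y j)"
      by (subst sum.atMost_Suc_shift) simp
    finally show ?case .
  qed
  \<comment> \<open>The range changes from \<open>j \<le> n\<close> to \<open>j < s\<close>: terms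
    with \<open>j \<ge> s\<close> vanish by nilpotency, those with \<open>j > n\<close> through the
    binomial coefficient.\<close>
  also have "\<dots> = (\<Sum>j\<in>{..n} \<inter> {..<s}. (of_nat (n choose j) * z ^ (n - j)) *s y j)"
    by (rule sum.mono_neutral_right) (auto simp: y_0)
  also have "\<dots> = (\<Sum>j<s. (of_nat (n choose j) * z ^ (n - j)) *s y j)"
    by (rule sum.mono_neutral_left) auto
  finally show ?thesis by (simp add: y_def)
qed

lemma binomial_power_decay:
  fixes z :: complex
  assumes "cmod z < \<rho>"
  shows "(\<lambda>n. complex_of_real (1 / \<rho> ^ n) * (of_nat (n choose j) * z ^ (n - j))) \<longlonglongrightarrow> 0"
proof (cases "z = 0")
  case True
  have "\<forall>\<^sub>F n in sequentially. complex_of_real (1 / \<rho> ^ n) * (of_nat (n choose j) * z ^ (n - j)) = 0"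
    using eventually_gt_at_top[of j] by eventually_elim (use True in \<open>simp add: power_0_left\<close>)
  then show ?thesis by (rule tendsto_eventually)
next
  case False
  have \<rho>: "\<rho> > 0" using assms norm_ge_zero[of z] by linarith
  let ?q = "cmod z / \<rho>"
  have "(\<lambda>n. (1 / cmod z ^ j) * ((real (n choose j) / real n ^ j) * (real n ^ j * ?q ^ n))) \<longlonglongrightarrow> (1 / cmod z ^ j) * (1 / fact j * 0)"
    by (intro tendsto_intros binomial_over_power_tendsto power_times_geometric_tendsto_0)
      (use assms \<rho> in auto)
  moreover have "\<forall>\<^sub>F n in sequentially. (1 / cmod z ^ j) * ((real (n choose j) / real n ^ j) * (real n ^ j * ?q ^ n)) =
      cmod (complex_of_real (1 / \<rho> ^ n) * (of_nat (n choose j) * z ^ (n - j)))"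
    using eventually_gt_at_top[of 0] eventually_ge_at_top[of j]
  proof eventually_elim
    case (elim n)
    have "cmod z ^ n = cmod z ^ j * cmod z ^ (n - j)" using elim by (simp flip: power_add)
    then show ?case
      using elim \<rho> False by (simp add: norm_mult norm_power norm_divide power_divide field_simps)
  qed
  ultimately show ?thesis
    by (intro tendsto_norm_zero_cancel[where 'b=complex]) (simp add: tendsto_cong)
qed

text \<open>The factor (\<rho>/z)^n removes the rotation of z^n, leaving (n choose j) / n^(r-1) up
  to the constant z^-j. The limit is nonzero exactly for j = r - 1, which is the origin of the
  normalisation.\<close>

lemma binomial_power_peripheral:
  fixes z :: complex
  assumes "z \<noteq> 0" "cmod z = \<rho>" "j < r"
  shows "convergent (\<lambda>n. complex_of_real (1 / (real n ^ (r - 1) * \<rho> ^ n)) * (complex_of_real \<rho> / z) ^ n *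
    (of_nat (n choose j) * z ^ (n - j)))"
proof -
  have \<rho>: "\<rho> > 0" using assms by auto
  have "(\<lambda>n. of_real ((1 / real n) ^ (r - 1 - j) * (real (n choose j) / real n ^ j)) / z ^ j)
     \<longlonglongrightarrow> of_real (0 ^ (r - 1 - j) * (1 / fact j)) / z ^ j"
    by (intro tendsto_intros lim_1_over_n binomial_over_power_tendsto) (use assms in auto)
  moreover have "\<forall>\<^sub>F n in sequentially. of_real ((1 / real n) ^ (r - 1 - j) * (real (n choose j) / real n ^ j)) / z ^ j =
     complex_of_real (1 / (real n ^ (r - 1) * \<rho> ^ n)) * (complex_of_real \<rho> / z) ^ n *
    (of_nat (n choose j) * z ^ (n - j))"
    using eventually_gt_at_top[of 0] eventually_ge_at_top[of j]
  proof eventually_elim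
    case (elim n)
    have 1: "z ^ n = z ^ j * z ^ (n - j)" using elim by (simp flip: power_add)
    have 2: "complex_of_nat n ^ (r - 1) = of_nat n ^ (r - 1 - j) * of_nat n ^ j"
      using assms(3) by (simp flip: power_add)
    have 3: "complex_of_real (1 / (real n ^ (r - 1) * \<rho> ^ n)) * (complex_of_real \<rho> / z) ^ n =
      1 / (of_nat n ^ (r - 1) * z ^ n)"
      using \<rho> elim by (simp add: power_divide)
    have "of_real ((1 / real n) ^ (r - 1 - j) * (real (n choose j) / real n ^ j)) / z ^ j =
      1 / (of_nat n ^ (r - 1 - j) * of_nat n ^ j * (z ^ j * z ^ (n - j))) * (of_nat (n choose j) * z ^ (n - j))"
      using elim assms(1) by (simp add: power_divide divide_simps)
    then show ?case by (simp only: 1 2 3)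
  qed
  ultimately show ?thesis by (intro convergentI) (rule Lim_transform_eventually)
qed

lemma gen_eigenvector_decay:
  fixes M :: "complex^'n^'n"
  assumes "matpow (M - Finite_Cartesian_Product.mat z) s *v x = 0" "cmod z < \<rho>"
  shows "(\<lambda>n. complex_of_real (1 / \<rho> ^ n) *s (matpow M n *v x)) \<longlonglongrightarrow> 0"
proof -
  let ?y = "\<lambda>j. matpow (M - Finite_Cartesian_Product.mat z) j *v x"
  have "(\<lambda>n. \<Sum>j<s. (complex_of_real (1 / \<rho> ^ n) * (of_nat (n choose j) * z ^ (n - j))) *s ?y j)
    \<longlonglongrightarrow> (\<Sum>j<s. 0 *s ?y j)"
    by (intro tendsto_sum tendsto_vector_smult binomial_power_decay assms(2) tendsto_const)
  then show ?thesis
    by (simp add: matpow_gen_eigenvector[OF assms(1)] scale_sum_right vec.scale_sum_right vector_smult_assoc)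
qed

lemma gen_eigenvector_peripheral:
  fixes M :: "complex^'n^'n"
  assumes "matpow (M - Finite_Cartesian_Product.mat z) r *v x = 0" "z \<noteq> 0" "cmod z = \<rho>"
  shows "convergent (\<lambda>n. (complex_of_real (1 / (real n ^ (r - 1) * \<rho> ^ n)) * (complex_of_real \<rho> / z) ^ n) *s (matpow M n *v x))"
proof -
  let ?y = "\<lambda>j. matpow (M - Finite_Cartesian_Product.mat z) j *v x"
  let ?a = "\<lambda>n j. complex_of_real (1 / (real n ^ (r - 1) * \<rho> ^ n)) * (complex_of_real \<rho> / z) ^ n *
    (of_nat (n choose j) * z ^ (n - j))"
  have "(\<lambda>n. \<Sum>j<r. ?a n j *s ?y j) \<longlonglongrightarrow> (\<Sum>j<r. lim (\<lambda>n. ?a n j) *s ?y j)"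
    using binomial_power_peripheral[OF assms(2,3)]
    by (intro tendsto_sum tendsto_vector_smult tendsto_const) (auto simp: convergent_LIMSEQ_iff)
  then show ?thesis
    by (auto simp: convergent_def matpow_gen_eigenvector[OF assms(1)] vec.scale_sum_right vector_smult_assoc mult_ac)
qed

lemma cmat_mult: "cmat (X ** Y) = cmat X ** cmat Y"
  by (simp add: vec_eq_iff matrix_matrix_mult_def)

lemma cmat_one: "cmat (Finite_Cartesian_Product.mat 1) = Finite_Cartesian_Product.mat 1"
  by (simp add: vec_eq_iff Finite_Cartesian_Product.mat_def)

lemma cmat_matpow: "cmat (matpow X n) = matpow (cmat X) n"
  by (induction n) (auto simp: cmat_one matpow_Suc cmat_mult)

abbreviation cvec :: "real^'n \<Rightarrow> complex^'n" where
  "cvec x \<equiv> (\<chi> i. complex_of_real (x $ i))"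

lemma cmat_cvec: "cmat X *v cvec x = cvec (X *v x)"
  by (simp add: vec_eq_iff matrix_vector_mult_def)

text \<open>Each spectral component decays separately. This is used to show that the spectral radius
  of the reduced sum does not drop below \<rho>.\<close>

lemma matpow_decay:
  fixes M :: "real^'d^'d"
  assumes "spec_rad M < \<rho>"
  shows "(\<lambda>n. (1 / \<rho> ^ n) *\<^sub>R (matpow M n *v x)) \<longlonglongrightarrow> 0"
proof -
  obtain Z and Pr :: "complex \<Rightarrow> complex^'d^'d" where Z: "Z \<subseteq> spectrum (to_complex_mat M)"
    and sum: "(\<Sum>z\<in>Z. Pr z) = Finite_Cartesian_Product.mat 1"
    and nil: "\<And>z. matpow (cmat M - Finite_Cartesian_Product.mat z)
       (if cmod z = spec_rad M then peripheral_jordan_size M else CARD('d)) ** Pr z = 0"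
    using spectral_decomposition[of M] by metis
  have "(\<lambda>n. \<Sum>z\<in>Z. complex_of_real (1 / \<rho> ^ n) *s (matpow (cmat M) n *v (Pr z *v cvec x))) \<longlonglongrightarrow> (\<Sum>z\<in>Z. 0)"
  proof (intro tendsto_sum gen_eigenvector_decay)
    fix z assume "z \<in> Z"
    then show "cmod z < \<rho>" using Z cmod_le_spec_rad assms by (metis order.strict_trans1 subsetD)
    show "matpow (cmat M - Finite_Cartesian_Product.mat z)
      (if cmod z = spec_rad M then peripheral_jordan_size M else CARD('d)) *v (Pr z *v cvec x) = 0"
      by (simp only: matrix_vector_mul_assoc nil matrix_vector_mult_0)
  qed
  also have "(\<lambda>n. \<Sum>z\<in>Z. complex_of_real (1 / \<rho> ^ n) *s (matpow (cmat M) n *v (Pr z *v cvec x))) =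
    (\<lambda>n. cvec ((1 / \<rho> ^ n) *\<^sub>R (matpow M n *v x)))"
  proof
    fix n
    have "(\<Sum>z\<in>Z. complex_of_real (1 / \<rho> ^ n) *s (matpow (cmat M) n *v (Pr z *v cvec x))) =
      complex_of_real (1 / \<rho> ^ n) *s (matpow (cmat M) n *v ((\<Sum>z\<in>Z. Pr z) *v cvec x))"
      by (simp add: matrix_sum_vector_mult vec.scale_sum_right linear_sum[OF matrix_vector_mul_linear] o_def)
    also have "\<dots> = cvec ((1 / \<rho> ^ n) *\<^sub>R (matpow M n *v x))"
      unfolding sum cmat_matpow[symmetric] cmat_cvec matrix_vector_mul_lid by (simp add: vec_eq_iff)
    finally show "(\<Sum>z\<in>Z. complex_of_real (1 / \<rho> ^ n) *s (matpow (cmat M) n *v (Pr z *v cvec x))) =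
      cvec ((1 / \<rho> ^ n) *\<^sub>R (matpow M n *v x))" .
  qed
  finally have "(\<lambda>n. Re (cvec ((1 / \<rho> ^ n) *\<^sub>R (matpow M n *v x)) $ i)) \<longlonglongrightarrow> Re ((0::complex^'d) $ i)" for i
    by (intro tendsto_Re tendsto_vec_nth) simp
  then show ?thesis by (intro vec_tendstoI) simp
qed

section \<open>Orthogonal projections and complexified subspaces\<close>

lemma orth_decomp_unique:
  assumes "Real_Vector_Spaces.subspace S" "y \<in> S" "y' \<in> S"
    "\<And>w. w \<in> S \<Longrightarrow> orthogonal (x - y) w" "\<And>w. w \<in> S \<Longrightarrow> orthogonal (x - y') w"
  shows "y = y'"
proof -
  have "y' - y \<in> S" using assms by (simp add: subspace_diff)
  then have "inner ((x - y) - (x - y')) (y' - y) = 0"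
    using assms(4,5) by (simp add: orthogonal_def inner_diff_left)
  then show ?thesis by simp
qed

text \<open>The \<open>THE\<close> in \<open>orth_proj\<close> asks for a matrix. A pointwise choice
  of nearest vectors is linear because orthogonal decompositions are unique, and its matrix is the
  required one.\<close>

lemma orth_proj_props:
  fixes S :: "(real^'d) set"
  assumes S: "Real_Vector_Spaces.subspace S"
  shows "orth_proj S *v x \<in> S" "y \<in> S \<Longrightarrow> orthogonal (x - orth_proj S *v x) y"
proof -
  have span: "Real_Vector_Spaces.span S = S" using S by (simp add: span_eq_iff)
  have "\<exists>y\<in>S. \<forall>w\<in>S. orthogonal (x - y) w" for x
  proof -
    obtain y z where "y \<in> S" "\<And>w. w \<in> S \<Longrightarrow> orthogonal z w" "x = y + z"
      using orthogonal_subspace_decomp_exists[of S x] unfolding span by metis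
    then show ?thesis by (intro bexI[of _ y]) auto
  qed
  then obtain p where p: "\<And>x. p x \<in> S" "\<And>x w. w \<in> S \<Longrightarrow> orthogonal (x - p x) w" by metis
  have "linear p"
  proof (rule linearI)
    show "p (x + y) = p x + p y" for x y
    proof (rule orth_decomp_unique[OF S])
      show "p x + p y \<in> S" using p S by (simp add: subspace_add)
      show "orthogonal (x + y - (p x + p y)) w" if "w \<in> S" for w
        using p(2)[OF that, of x] p(2)[OF that, of y] by (simp add: orthogonal_def inner_diff_left inner_add_left)
    qed (use p in auto)
    show "p (c *\<^sub>R x) = c *\<^sub>R p x" for c x
    proof (rule orth_decomp_unique[OF S])
      show "c *\<^sub>R p x \<in> S" using p S by (simp add: subspace_scale)
      show "orthogonal (c *\<^sub>R x - c *\<^sub>R p x) w" if "w \<in> S" for w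
        using p(2)[OF that, of x] by (simp add: orthogonal_def inner_diff_left)
    qed (use p in auto)
  qed
  then have mp: "matrix p *v x = p x" for x by (simp add: matrix_works)
  have "\<exists>!P :: real^'d^'d. \<forall>x. P *v x \<in> S \<and> (\<forall>y\<in>S. orthogonal (x - P *v x) y)"
  proof (rule ex1I[of _ "matrix p"])
    show "\<forall>x. matrix p *v x \<in> S \<and> (\<forall>y\<in>S. orthogonal (x - matrix p *v x) y)"
      using p by (simp add: mp)
    show "P = matrix p" if "\<forall>x. P *v x \<in> S \<and> (\<forall>y\<in>S. orthogonal (x - P *v x) y)" for P :: "real^'d^'d"
    proof (subst matrix_eq, intro allI)
      fix x
      show "P *v x = matrix p *v x"
        by (rule orth_decomp_unique[OF S]) (use that p mp in auto)
    qed
  qed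
  from theI'[OF this] show "orth_proj S *v x \<in> S" "y \<in> S \<Longrightarrow> orthogonal (x - orth_proj S *v x) y"
    by (auto simp: orth_proj_def)
qed

lemma orth_proj_ident:
  assumes "Real_Vector_Spaces.subspace S" "x \<in> S"
  shows "orth_proj S *v x = x"
  by (rule orth_decomp_unique[OF assms(1), of _ _ x])
    (use assms orth_proj_props[OF assms(1)] in \<open>auto simp: orthogonal_def\<close>)

lemma orth_proj_orthogonal_comp:
  assumes "Real_Vector_Spaces.subspace S" "x \<in> orthogonal_comp S"
  shows "orth_proj S *v x = 0"
  by (rule orth_decomp_unique[OF assms(1), of _ _ x])
    (use assms orth_proj_props[OF assms(1)] in \<open>auto simp: orthogonal_comp_def orthogonal_commute subspace_0\<close>)

lemma orth_proj_residual:
  assumes "Real_Vector_Spaces.subspace S"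
  shows "x - orth_proj S *v x \<in> orthogonal_comp S"
  using orth_proj_props(2)[OF assms] by (auto simp: orthogonal_comp_def orthogonal_commute)

lemma orth_proj_self_adjoint:
  assumes "Real_Vector_Spaces.subspace S"
  shows "inner (orth_proj S *v x) y = inner x (orth_proj S *v y)"
proof -
  have "inner (x - orth_proj S *v x) (orth_proj S *v y) = 0"
    "inner (y - orth_proj S *v y) (orth_proj S *v x) = 0"
    using orth_proj_props[OF assms] unfolding orthogonal_def by blast+
  then show ?thesis by (simp only: inner_diff_left) (simp add: inner_commute)
qed

lemma complexified_diff:
  assumes "Real_Vector_Spaces.subspace V" "x \<in> complexified V" "y \<in> complexified V"
  shows "x - y \<in> complexified V"
proof -
  have "(\<chi> i. Re ((x - y) $ i)) = (\<chi> i. Re (x $ i)) - (\<chi> i. Re (y $ i))"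
    "(\<chi> i. Im ((x - y) $ i)) = (\<chi> i. Im (x $ i)) - (\<chi> i. Im (y $ i))"
    by (simp_all add: vec_eq_iff)
  then show ?thesis using assms unfolding complexified_def by (simp add: subspace_diff)
qed

lemma complexified_smult:
  assumes "Real_Vector_Spaces.subspace V" "x \<in> complexified V"
  shows "c *s x \<in> complexified V"
proof -
  let ?r = "\<chi> i. Re (x $ i)" and ?i = "\<chi> i. Im (x $ i)"
  have "(\<chi> i. Re ((c *s x) $ i)) = Re c *\<^sub>R ?r - Im c *\<^sub>R ?i"
    "(\<chi> i. Im ((c *s x) $ i)) = Re c *\<^sub>R ?i + Im c *\<^sub>R ?r"
    by (simp_all add: vec_eq_iff)
  then show ?thesis using assms unfolding complexified_def
    by (simp add: subspace_diff subspace_scale subspace_add)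
qed

lemma Re_cmat_mult: "(\<chi> i. Re ((cmat X *v x) $ i)) = X *v (\<chi> i. Re (x $ i))"
  and Im_cmat_mult: "(\<chi> i. Im ((cmat X *v x) $ i)) = X *v (\<chi> i. Im (x $ i))"
  by (simp_all add: vec_eq_iff matrix_vector_mult_def)

lemma complexified_cmat:
  assumes "\<And>x. X *v x \<in> V"
  shows "cmat X *v x \<in> complexified V"
  using assms by (simp add: complexified_def Re_cmat_mult Im_cmat_mult)

lemma mat_mult_vector: "Finite_Cartesian_Product.mat z *v w = z *s (w :: 'a::comm_semiring_1^'n)"
  by (simp add: vec_eq_iff matrix_vector_mult_def Finite_Cartesian_Product.mat_def
    if_distrib[where f = "\<lambda>x. x * y" for y] cong: if_cong)

lemma complex_vector_decomp: "(x :: complex^'n) = cvec (\<chi> i. Re (x $ i)) + \<i> *s cvec (\<chi> i. Im (x $ i))"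
  by (simp add: vec_eq_iff complex_eq)

lemma shift_vector_mult: "(M - Finite_Cartesian_Product.mat z) *v x = M *v x - z *s (x :: 'a::comm_ring_1^'n)"
  by (simp add: matrix_vector_mult_diff_rdistrib mat_mult_vector)

lemma matpow_vector_Suc: "matpow M (Suc n) *v x = M *v (matpow M n *v x)"
  and matpow_vector_Suc2: "matpow M (Suc n) *v x = matpow M n *v (M *v x)"
  by (simp_all add: matpow_Suc matrix_vector_mul_assoc) (simp add: matpow_Suc[symmetric] matpow_Suc2)

lemma shift_commute:
  fixes M X :: "complex^'n^'n"
  assumes "M ** X = X ** M"
  shows "(M - Finite_Cartesian_Product.mat z) ** X = X ** (M - Finite_Cartesian_Product.mat z)"
  by (simp add: matrix_mult_diff_distrib matrix_diff_mult_distrib assms mat_mult_scalar mult_mat_scalar)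

text \<open>By induction \<open>(M - z) x = 0\<close>, so x is an eigenvector for z; then M - w acts
  on it as the nonzero scalar z - w and cannot be nilpotent unless x = 0.\<close>

lemma gen_eigenspaces_disjoint:
  fixes M :: "complex^'n^'n"
  assumes "matpow (M - Finite_Cartesian_Product.mat z) n *v x = 0"
    "matpow (M - Finite_Cartesian_Product.mat w) s *v x = 0" "z \<noteq> w"
  shows "x = 0"
  using assms(1,2)
proof (induction n arbitrary: x)
  case (Suc n)
  let ?y = "(M - Finite_Cartesian_Product.mat z) *v x"
  have "matpow (M - Finite_Cartesian_Product.mat w) s *v ?y =
      (M - Finite_Cartesian_Product.mat z) *v (matpow (M - Finite_Cartesian_Product.mat w) s *v x)"
  proof -
    have "(M - Finite_Cartesian_Product.mat w) ** (M - Finite_Cartesian_Product.mat z) =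
      (M - Finite_Cartesian_Product.mat z) ** (M - Finite_Cartesian_Product.mat w)"
      by (rule shift_commute) (rule shift_commute[OF refl, symmetric])
    from matpow_commute[OF this, of s] show ?thesis by (simp only: matrix_vector_mul_assoc)
  qed
  then have 1: "matpow (M - Finite_Cartesian_Product.mat w) s *v ?y = 0"
    by (simp only: Suc.prems(2) matrix_vector_mult_0_right)
  have 2: "matpow (M - Finite_Cartesian_Product.mat z) n *v ?y = 0"
    using Suc.prems(1) by (simp only: matpow_vector_Suc2)
  have "?y = 0" by (rule Suc.IH[OF 2 1])
  then have x: "M *v x = z *s x" by (simp add: shift_vector_mult)
  have "matpow (M - Finite_Cartesian_Product.mat w) m *v x = (z - w) ^ m *s x" for m
  proof (induction m)
    case (Suc m)
    have "matpow (M - Finite_Cartesian_Product.mat w) (Suc m) *v x =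
      (z - w) ^ m *s (z *s x) - w *s ((z - w) ^ m *s x)"
      by (simp only: matpow_vector_Suc Suc shift_vector_mult vector_scalar_commute x)
        (simp add: vec_eq_iff algebra_simps)
    also have "\<dots> = (z - w) ^ Suc m *s x" by (simp add: vec_eq_iff algebra_simps)
    finally show ?case .
  qed simp
  then have "(z - w) ^ s *s x = 0" using Suc.prems(2) by (simp only:)
  then show ?case using assms(3) by (simp add: vec_eq_iff)
qed simp

text \<open>
  The spaces \<open>range (Pr z)\<close> are the generalised eigenspaces, so the operators acting by scalars on
  the generalised eigenspaces are the linear combinations of the \<open>Pr z\<close>.
\<close>

locale spectral_projections =
  fixes M :: "real^'d^'d" and Z :: "complex set" and Pr :: "complex \<Rightarrow> complex^'d^'d"
  assumes Z_spectrum: "Z \<subseteq> spectrum (to_complex_mat M)"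
    and sum_Pr: "(\<Sum>z\<in>Z. Pr z) = Finite_Cartesian_Product.mat 1"
    and Pr_commute: "\<And>z. cmat M ** Pr z = Pr z ** cmat M"
    and Pr_nilpotent: "\<And>z. matpow (cmat M - Finite_Cartesian_Product.mat z)
       (if cmod z = spec_rad M then peripheral_jordan_size M else CARD('d)) ** Pr z = 0"
begin

definition spectral_mult :: "(complex \<Rightarrow> complex) \<Rightarrow> complex^'d^'d" where
  "spectral_mult d = (\<Sum>z\<in>Z. Finite_Cartesian_Product.mat (d z) ** Pr z)"

lemma spectral_mult_vector: "spectral_mult d *v x = (\<Sum>z\<in>Z. d z *s (Pr z *v x))"
  by (simp add: spectral_mult_def matrix_sum_vector_mult matrix_vector_mul_assoc[symmetric] mat_mult_vector)

lemma sum_Pr_vector: "(\<Sum>z\<in>Z. Pr z *v x) = x"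
  by (simp add: matrix_sum_vector_mult[symmetric] sum_Pr)

lemma Pr_gen_eigen:
  "\<exists>s. matpow (cmat M - Finite_Cartesian_Product.mat z) s *v (Pr z *v x) = 0"
  using Pr_nilpotent[of z] by (metis matrix_vector_mul_assoc matrix_vector_mult_0)

text \<open>\<open>Pr w\<close> commutes with M, so it keeps x in the generalised eigenspace of
  \<open>z\<close> while mapping it into that of \<open>w\<close>; these meet only in 0.\<close>

lemma Pr_other:
  assumes "matpow (cmat M - Finite_Cartesian_Product.mat z) n *v x = 0" "w \<noteq> z"
  shows "Pr w *v x = 0"
proof -
  have "matpow (cmat M - Finite_Cartesian_Product.mat z) n *v (Pr w *v x) =
    Pr w *v (matpow (cmat M - Finite_Cartesian_Product.mat z) n *v x)"
    by (simp only: matrix_vector_mul_assoc matpow_commute[OF shift_commute[OF Pr_commute]])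
  then have "matpow (cmat M - Finite_Cartesian_Product.mat z) n *v (Pr w *v x) = 0"
    using assms by simp
  then show ?thesis using gen_eigenspaces_disjoint Pr_gen_eigen assms(2) by metis
qed

lemma spectral_mult_gen_eigen:
  assumes "matpow (cmat M - Finite_Cartesian_Product.mat z) n *v x = 0"
  shows "spectral_mult d *v x = d z *s x"
proof -
  have "d w *s (Pr w *v x) = d z *s (Pr w *v x)" for w
    using Pr_other[OF assms, of w] by (cases "w = z") auto
  then have "spectral_mult d *v x = (\<Sum>w\<in>Z. d z *s (Pr w *v x))"
    unfolding spectral_mult_vector by (intro sum.cong refl)
  also have "\<dots> = d z *s x" by (simp only: vec.scale_sum_right[symmetric] sum_Pr_vector)
  finally show ?thesis .
qed

lemma spectral_mult_mult: "spectral_mult d ** spectral_mult e = spectral_mult (\<lambda>z. d z * e z)"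
proof -
  have "spectral_mult d *v (spectral_mult e *v x) = spectral_mult (\<lambda>z. d z * e z) *v x" for x
  proof -
    have "spectral_mult d *v (Pr z *v x) = d z *s (Pr z *v x)" for z
      using Pr_gen_eigen spectral_mult_gen_eigen by metis
    then show ?thesis
      unfolding spectral_mult_vector[of e] spectral_mult_vector[of "\<lambda>z. d z * e z"]
      by (simp add: linear_sum[OF matrix_vector_mul_linear] vector_scalar_commute vector_smult_assoc mult.commute)
  qed
  then show ?thesis by (simp add: matrix_eq matrix_vector_mul_assoc)
qed

lemma spectral_mult_one: "spectral_mult (\<lambda>_. 1) = Finite_Cartesian_Product.mat 1"
  by (simp add: spectral_mult_def sum_Pr)

lemma spectral_mult_pow: "matpow (spectral_mult d) n = spectral_mult (\<lambda>z. d z ^ n)"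
  by (induction n) (auto simp: spectral_mult_one matpow_Suc spectral_mult_mult)

lemma spectral_mult_cong: "(\<And>z. z \<in> Z \<Longrightarrow> d z = e z) \<Longrightarrow> spectral_mult d = spectral_mult e"
  by (simp add: spectral_mult_def)

context
  fixes V :: "(real^'d) set"
  assumes V: "Real_Vector_Spaces.subspace V" and range_M: "\<And>x. M *v x \<in> V"
    and M_proj: "M ** orth_proj V = M"
begin

text \<open>Since M maps into V, the identity z x = M x - (M - z) x puts x in the complexification
  as soon as (M - z) x is there. For z = 0 this breaks down, which is why 0 needs separate
  care.\<close>

lemma gen_eigen_in_complexified:
  assumes "matpow (cmat M - Finite_Cartesian_Product.mat z) n *v x \<in> complexified V" "z \<noteq> 0"
  shows "x \<in> complexified V"
  using assms(1)
proof (induction n arbitrary: x)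
  case (Suc n)
  have "(cmat M - Finite_Cartesian_Product.mat z) *v x \<in> complexified V"
    by (rule Suc.IH) (use Suc.prems in \<open>simp only: matpow_vector_Suc2\<close>)
  then have "cmat M *v x - (cmat M - Finite_Cartesian_Product.mat z) *v x \<in> complexified V"
    by (intro complexified_diff[OF V] complexified_cmat range_M)
  then have "z *s x \<in> complexified V" by (simp add: shift_vector_mult)
  then have "inverse z *s (z *s x) \<in> complexified V" by (rule complexified_smult[OF V])
  then show ?case using assms(2) by (simp add: vector_smult_assoc)
qed simp

text \<open>The generalised eigenspace of 0 in the whole space contains the part inside V as well as
  the orthogonal complement of V. The condition \<open>d 0 = 1\<close> makes the prescriptions on
  both parts agree.\<close>

lemma spectral_mult_unique:
  assumes "\<And>z x. x \<in> gen_eigenspace V M z \<Longrightarrow> X *v x = d z *s x"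
    "\<And>x. x \<in> orthogonal_comp V \<Longrightarrow> X *v cvec x = cvec x" and d: "d 0 = 1"
  shows "X = spectral_mult d"
proof -
  have eq: "X *v (Pr z *v y) = d z *s (Pr z *v y)" for z y
  proof -
    obtain s where s: "matpow (cmat M - Finite_Cartesian_Product.mat z) s *v (Pr z *v y) = 0"
      using Pr_gen_eigen by blast
    show ?thesis
    proof (cases "z = 0")
      case False
      have "0 \<in> complexified V" using V by (simp add: complexified_def zero_vec_def[symmetric] subspace_0)
      then have "Pr z *v y \<in> gen_eigenspace V M z"
        using s False gen_eigen_in_complexified[of z s] by (auto simp: gen_eigenspace_def)
      then show ?thesis by (rule assms(1))
    next
      case True
      \<comment> \<open>At eigenvalue 0, x may leave V; it is split into its projection p and a
        remainder from the orthogonal complement, and X fixes both.\<close>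
      define x where "x = Pr z *v y"
      define p where "p = cmat (orth_proj V) *v x"
      have M_p: "cmat M *v p = cmat M *v x"
        by (simp add: p_def matrix_vector_mul_assoc cmat_mult[symmetric] M_proj)
      have "matpow (cmat M) s *v x = 0" using s True by (simp add: x_def)
      \<comment> \<open>One extra power: p and x only agree after M has been applied once.\<close>
      then have "matpow (cmat M) (Suc s) *v p = 0"
        unfolding matpow_vector_Suc2 M_p by (simp add: matpow_vector_Suc2[symmetric] matpow_vector_Suc)
      moreover have "p \<in> complexified V"
        unfolding p_def by (intro complexified_cmat orth_proj_props V)
      ultimately have "p \<in> gen_eigenspace V M 0"
        unfolding gen_eigenspace_def mem_Collect_eq Finite_Cartesian_Product.mat_0 diff_0_right by blast
      then have Xp: "X *v p = p" using assms(1) d by fastforce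
      define r where "r = (\<lambda>w::real^'d. w - orth_proj V *v w)"
      have "X *v cvec (r w) = cvec (r w)" for w
        unfolding r_def by (intro assms(2) orth_proj_residual V)
      moreover have "x - p = cvec (r (\<chi> i. Re (x $ i))) + \<i> *s cvec (r (\<chi> i. Im (x $ i)))"
      proof -
        have "p = cvec (orth_proj V *v (\<chi> i. Re (x $ i))) + \<i> *s cvec (orth_proj V *v (\<chi> i. Im (x $ i)))"
          unfolding p_def by (subst complex_vector_decomp[of "cmat _ *v _"]) (simp only: Re_cmat_mult Im_cmat_mult)
        then show ?thesis
          by (simp add: vec_eq_iff r_def) (simp add: complex_eq_iff)
      qed
      ultimately have "X *v (x - p) = x - p"
        by (simp add: matrix_vector_right_distrib vector_scalar_commute)
      with Xp have "X *v x = x" by (simp add: matrix_vector_mult_diff_distrib)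
      then show ?thesis using True d by (simp add: x_def)
    qed
  qed
  show ?thesis
  proof (subst matrix_eq, intro allI)
    fix y
    have "X *v y = X *v (\<Sum>z\<in>Z. Pr z *v y)" by (simp only: sum_Pr_vector)
    also have "\<dots> = spectral_mult d *v y"
      by (simp add: linear_sum[OF matrix_vector_mul_linear] eq spectral_mult_vector)
    finally show "X *v y = spectral_mult d *v y" .
  qed
qed

lemma spectral_mult_orthogonal_comp:
  assumes "x \<in> orthogonal_comp V" "d 0 = 1"
  shows "spectral_mult d *v cvec x = cvec x"
proof -
  have "M *v x = 0"
    using orth_proj_orthogonal_comp[OF V assms(1)] M_proj by (metis matrix_vector_mul_assoc matrix_vector_mult_0_right)
  then have "cmat M *v cvec x = 0" by (simp add: cmat_cvec vec_eq_iff)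
  then have "matpow (cmat M - Finite_Cartesian_Product.mat 0) 1 *v cvec x = 0"
    by (simp add: matpow_Suc)
  from spectral_mult_gen_eigen[OF this, of d] show ?thesis using assms(2) by simp
qed

text \<open>Existence of a real matrix: conjugating the complex operator entrywise gives one with
  the same prescribed action, because d commutes with conjugation, and uniqueness forces the two to
  be equal.\<close>

theorem real_spectral_mult:
  assumes d: "\<And>z. d (cnj z) = cnj (d z)" "d 0 = 1"
  defines "R \<equiv> THE R :: real^'d^'d. (\<forall>z. \<forall>x\<in>gen_eigenspace V M z. cmat R *v x = d z *s x) \<and>
    (\<forall>x\<in>orthogonal_comp V. R *v x = x)"
  shows "cmat R = spectral_mult d"
proof -
  let ?P = "\<lambda>R :: real^'d^'d. (\<forall>z. \<forall>x\<in>gen_eigenspace V M z. cmat R *v x = d z *s x) \<and>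
    (\<forall>x\<in>orthogonal_comp V. R *v x = x)"
  let ?c = "\<lambda>x::complex^'d. \<chi> i. cnj (x $ i)"
  let ?C = "map_matrix cnj (spectral_mult d)"
  have c_mult: "?c (X *v x) = map_matrix cnj X *v ?c x" for X x
    by (simp add: vec_eq_iff matrix_vector_mult_def)
  have c_inv: "?c (?c x) = x" for x by (simp add: vec_eq_iff)
  have c_M: "map_matrix cnj (cmat M - Finite_Cartesian_Product.mat z) = cmat M - Finite_Cartesian_Product.mat (cnj z)" for z
    by (auto simp: vec_eq_iff Finite_Cartesian_Product.mat_def)
  have c_pow: "?c (matpow (cmat M - Finite_Cartesian_Product.mat z) n *v x) =
    matpow (cmat M - Finite_Cartesian_Product.mat (cnj z)) n *v ?c x" for z n x
    by (induction n arbitrary: x) (simp_all add: matpow_vector_Suc c_mult c_M)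
  have "?C = spectral_mult d"
  proof (rule spectral_mult_unique)
    fix z x assume "x \<in> gen_eigenspace V M z"
    then obtain n where "matpow (cmat M - Finite_Cartesian_Product.mat z) n *v x = 0"
      by (auto simp: gen_eigenspace_def)
    then have "matpow (cmat M - Finite_Cartesian_Product.mat (cnj z)) n *v ?c x = 0"
      by (simp add: c_pow[symmetric] zero_vec_def)
    then have "spectral_mult d *v ?c x = d (cnj z) *s ?c x" by (rule spectral_mult_gen_eigen)
    then have "?c (spectral_mult d *v ?c x) = ?c (d (cnj z) *s ?c x)" by simp
    then show "?C *v x = d z *s x"
      by (simp add: c_mult c_inv d) (simp add: vec_eq_iff)
  next
    fix x assume "x \<in> orthogonal_comp V"
    then have "?c (spectral_mult d *v cvec x) = ?c (cvec x)"
      by (simp add: spectral_mult_orthogonal_comp d)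
    then show "?C *v cvec x = cvec x" by (simp add: c_mult)
  qed (rule d)
  then have real: "cmat (map_matrix Re (spectral_mult d)) = spectral_mult d"
    by (simp add: vec_eq_iff complex_eq_iff)
  have uniq: "cmat R = spectral_mult d" if "?P R" for R
    by (rule spectral_mult_unique) (use that d in \<open>auto simp: cmat_cvec\<close>)
  have "\<exists>!R. ?P R"
  proof (rule ex1I[of _ "map_matrix Re (spectral_mult d)"])
    show "?P (map_matrix Re (spectral_mult d))"
    proof (intro conjI allI ballI)
      fix z x assume "x \<in> gen_eigenspace V M z"
      then show "cmat (map_matrix Re (spectral_mult d)) *v x = d z *s x"
        unfolding real by (auto simp: gen_eigenspace_def intro: spectral_mult_gen_eigen)
    next
      fix x assume "x \<in> orthogonal_comp V"
      then have "cvec (map_matrix Re (spectral_mult d) *v x) = cvec x"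
        by (simp add: cmat_cvec[symmetric] real spectral_mult_orthogonal_comp d)
      then show "map_matrix Re (spectral_mult d) *v x = x" by (simp add: vec_eq_iff)
    qed
    show "R = map_matrix Re (spectral_mult d)" if "?P R" for R
      using uniq[OF that] by (simp add: vec_eq_iff) (metis Re_complex_of_real nth_map_matrix)
  qed
  from theI'[OF this] show ?thesis unfolding R_def by (rule uniq)
qed

end

end

lemma spectral_projections_exist: "\<exists>Z Pr. spectral_projections M Z Pr"
proof (rule spectral_decomposition[of M])
  fix Z and Pr :: "complex \<Rightarrow> complex^'a^'a"
  assume "Z \<subseteq> spectrum (to_complex_mat M)"
    "(\<Sum>z\<in>Z. Pr z) = Finite_Cartesian_Product.mat 1"
    "\<And>z. cmat M ** Pr z = Pr z ** cmat M"
    "\<And>z. matpow (cmat M - Finite_Cartesian_Product.mat z)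
       (if cmod z = spec_rad M then peripheral_jordan_size M else CARD('a)) ** Pr z = 0"
  then have "spectral_projections M Z Pr" by (rule spectral_projections.intro)
  then show ?thesis by (intro exI)
qed

section \<open>Phases and asymptotics of the powers\<close>

text \<open>Applied to powers of the phases: only the finitely many peripheral coordinates vary, so
  convergence there is convergence in the product topology.\<close>

lemma finite_family_convergent_subsequence:
  fixes f :: "'z \<Rightarrow> nat \<Rightarrow> 'a::heine_borel"
  assumes "finite Z" "\<And>z. z \<in> Z \<Longrightarrow> bounded (range (f z))"
  shows "\<exists>\<sigma>::nat \<Rightarrow> nat. strict_mono \<sigma> \<and> (\<forall>z\<in>Z. convergent (\<lambda>n. f z (\<sigma> n)))"
  using assms
proof (induction Z)
  case empty
  show ?case by (rule exI[of _ id]) (auto simp: strict_mono_def)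
next
  case (insert z Z)
  then obtain \<sigma> :: "nat \<Rightarrow> nat" where \<sigma>: "strict_mono \<sigma>" "\<And>w. w \<in> Z \<Longrightarrow> convergent (\<lambda>n. f w (\<sigma> n))"
    by auto
  have "bounded (range (\<lambda>n. f z (\<sigma> n)))"
    by (rule bounded_subset[of "range (f z)"]) (use insert.prems in auto)
  then obtain l r where r: "strict_mono r" "((\<lambda>n. f z (\<sigma> n)) \<circ> r) \<longlonglongrightarrow> l"
    using bounded_imp_convergent_subsequence by blast
  have "convergent (\<lambda>n. f w (\<sigma> (r n)))" if "w \<in> insert z Z" for w
  proof (cases "w = z")
    case True
    then show ?thesis using r(2) by (auto simp: convergent_def o_def)
  next
    case False
    then have "convergent ((\<lambda>n. f w (\<sigma> n)) \<circ> r)"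
      using \<sigma>(2) that r(1) by (intro convergent_subseq_convergent) auto
    then show ?thesis by (simp add: o_def)
  qed
  then show ?case using \<sigma>(1) r(1)
    by (intro exI[of _ "\<sigma> \<circ> r"]) (auto simp: strict_mono_def)
qed

lemma tendsto_fun:
  fixes f :: "nat \<Rightarrow> 'i \<Rightarrow> 'a::topological_space"
  assumes "\<And>i. (\<lambda>n. f n i) \<longlonglongrightarrow> l i"
  shows "f \<longlonglongrightarrow> l"
proof -
  have "limitin (product_topology (\<lambda>i. euclidean) UNIV) f l sequentially"
    unfolding limitin_componentwise using assms by (auto simp: extensional_def)
  then show ?thesis by (simp add: euclidean_product_topology)
qed

lemma norm_matrix_vector_le:
  fixes M :: "real^'n^'m"
  assumes "\<And>i j. \<bar>M $ i $ j\<bar> \<le> C"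
  shows "norm (M *v x) \<le> real CARD('m) * real CARD('n) * C * norm x"
proof -
  have "norm (M *v x) \<le> onorm ((*v) M) * norm x"
    by (intro onorm matrix_vector_mul_bounded_linear)
  also have "\<dots> \<le> real CARD('m) * real CARD('n) * C * norm x"
    using onorm_le_matrix_component[OF assms] by (intro mult_right_mono) auto
  finally show ?thesis .
qed

lemma tendsto_matrix_vector_mult:
  fixes X :: "nat \<Rightarrow> real^'n^'m"
  assumes "\<And>i j. (\<lambda>n. X n $ i $ j) \<longlonglongrightarrow> Y $ i $ j"
  shows "(\<lambda>n. X n *v x) \<longlonglongrightarrow> Y *v x"
  by (intro vec_tendstoI) (auto simp: matrix_vector_mult_def intro!: tendsto_intros assms)

lemma cnj_in_peripheral_spectrum:
  assumes "z \<in> peripheral_spectrum M"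
  shows "cnj z \<in> peripheral_spectrum M"
proof -
  from assms obtain x where x: "x \<noteq> 0" "cmat M *v x = z *s x"
    by (auto simp: peripheral_spectrum_def spectrum_iff)
  let ?c = "\<chi> i. cnj (x $ i)"
  have "?c \<noteq> 0" using x(1) by (auto simp: vec_eq_iff)
  moreover have "cmat M *v ?c = cnj z *s ?c"
  proof (simp add: vec_eq_iff, intro allI)
    fix i
    have "cnj ((cmat M *v x) $ i) = cnj ((z *s x) $ i)" using x(2) by simp
    then show "(cmat M *v ?c) $ i = cnj z * cnj (x $ i)" by (simp add: matrix_vector_mult_def)
  qed
  ultimately have "cnj z \<in> spectrum (to_complex_mat M)" unfolding spectrum_iff by (intro exI conjI)
  then show ?thesis using assms by (simp add: peripheral_spectrum_def)
qed

lemma cnj_in_peripheral_spectrum_iff [simp]: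
  "cnj z \<in> peripheral_spectrum M \<longleftrightarrow> z \<in> peripheral_spectrum M"
  using cnj_in_peripheral_spectrum[of z M] cnj_in_peripheral_spectrum[of "cnj z" M] by auto

lemma phases_cnj: "phases k u A (cnj z) = cnj (phases k u A z)"
  by (simp add: phases_def)

text \<open>A closed condition in the product topology that holds for all powers of the phases,
  hence on the closure.\<close>

lemma phase_group_cnj:
  assumes "h \<in> phase_group k u A"
  shows "h (cnj z) = cnj (h z)"
proof -
  have "closed {h :: complex \<Rightarrow> complex. h (cnj z) = cnj (h z)}"
    by (intro closed_Collect_eq continuous_intros continuous_on_product_coordinates)
  then have "phase_group k u A \<subseteq> {h. h (cnj z) = cnj (h z)}"
    unfolding phase_group_def by (intro closure_minimal) (auto simp: phases_cnj)
  then show ?thesis using assms by blast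
qed

lemma subspace_rep_space: "Real_Vector_Spaces.subspace (rep_space k u A)"
  by (simp add: rep_space_def)

lemma tilde_sum_in_rep_space: "tilde_sum k u A *v x \<in> rep_space k u A"
  unfolding tilde_sum_def matrix_vector_mul_assoc[symmetric]
  by (rule orth_proj_props[OF subspace_rep_space])

lemma orth_proj_idem:
  assumes "Real_Vector_Spaces.subspace S"
  shows "orth_proj S ** orth_proj S = orth_proj S"
  by (simp add: matrix_eq matrix_vector_mul_assoc[symmetric] orth_proj_ident[OF assms] orth_proj_props[OF assms])

lemma tilde_sum_proj: "tilde_sum k u A ** orth_proj (rep_space k u A) = tilde_sum k u A"
  by (simp add: tilde_sum_def matrix_mul_assoc[symmetric] orth_proj_idem[OF subspace_rep_space])

section \<open>Normalised powers in a nondegenerate representation\<close>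

locale nondegenerate_rep = spectral_projections "tilde_sum k u A" Z Pr
  for k and u :: "real^'d" and A Z Pr +
  fixes v :: "real^'d"
  assumes nondeg: "nondegenerate_representation k u A v"
begin

abbreviation "M \<equiv> tilde_sum k u A"
abbreviation "\<rho> \<equiv> spec_rad M"
abbreviation "r \<equiv> peripheral_jordan_size M"

definition phase_factor :: "(complex \<Rightarrow> complex) \<Rightarrow> complex \<Rightarrow> complex" where
  "phase_factor h z = (if z \<in> peripheral_spectrum M then h z else 1)"

lemma \<rho>_pos: "\<rho> > 0"
  using nondeg by (simp add: nondegenerate_representation_def)

text \<open>Here \<rho> > 0 enters: it keeps 0 out of the peripheral spectrum, so the factor at 0 is
  1 as the uniqueness argument requires.\<close>

lemma cmat_phase_mult:
  assumes "\<And>z. h (cnj z) = cnj (h z)"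
  shows "cmat (phase_mult k u A h) = spectral_mult (phase_factor h)"
  unfolding phase_mult_def phase_factor_def[symmetric]
  by (rule real_spectral_mult[OF subspace_rep_space tilde_sum_in_rep_space tilde_sum_proj])
    (use assms \<rho>_pos in \<open>auto simp: phase_factor_def, auto simp: peripheral_spectrum_def\<close>)

lemma cmat_phase_mult_group:
  "h \<in> phase_group k u A \<Longrightarrow> cmat (phase_mult k u A h) = spectral_mult (phase_factor h)"
  by (rule cmat_phase_mult) (rule phase_group_cnj)

lemma phases_nz: "phases k u A z \<noteq> 0"
  using \<rho>_pos by (auto simp: phases_def peripheral_spectrum_def)

lemma norm_phases: "cmod (phases k u A z) = 1"
  using \<rho>_pos by (auto simp: phases_def peripheral_spectrum_def norm_divide)

abbreviation "h_pow n \<equiv> (\<lambda>z. phases k u A z ^ n)"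
abbreviation "R_inv \<equiv> phase_mult k u A (\<lambda>z. inverse (phases k u A z))"

lemma h_pow_in_phase_group: "h_pow n \<in> phase_group k u A"
  unfolding phase_group_def by (intro subsetD[OF closure_subset]) auto

lemma cmat_R_inv: "cmat R_inv = spectral_mult (phase_factor (\<lambda>z. inverse (phases k u A z)))"
  by (rule cmat_phase_mult) (simp add: phases_cnj)

lemma cmat_inject: "cmat X = cmat Y \<longleftrightarrow> X = Y"
  by (simp add: vec_eq_iff)

text \<open>R_h for h = g^n inverts R^n, so that M^n v can be recovered from R^n M^n v, whose
  normalised limit is P v.\<close>

lemma phase_mult_h_pow: "phase_mult k u A (h_pow n) ** matpow R_inv n = Finite_Cartesian_Product.mat 1"
proof -
  have "cmat (phase_mult k u A (h_pow n) ** matpow R_inv n) =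
    spectral_mult (\<lambda>z. phase_factor (h_pow n) z * phase_factor (\<lambda>z. inverse (phases k u A z)) z ^ n)"
    by (simp add: cmat_mult cmat_matpow cmat_R_inv spectral_mult_pow spectral_mult_mult
        cmat_phase_mult_group[OF h_pow_in_phase_group])
  also have "\<dots> = spectral_mult (\<lambda>_. 1)"
    by (rule spectral_mult_cong) (auto simp: phase_factor_def phases_nz power_inverse)
  finally show ?thesis by (simp add: spectral_mult_one cmat_one[symmetric] cmat_inject)
qed

text \<open>The c_n of nondegeneracy. The exponent n - r + 1 may be negative, hence the integer
  power; at n = 0 the division may degenerate, so later statements start at n = 1.\<close>

definition scale :: "nat \<Rightarrow> real" where
  "scale n = fact (r - 1) / (real n ^ (r - 1) * \<rho> powi (int n - int r + 1))"

lemma scale_eq: "scale n = (fact (r - 1) / \<rho> powi (1 - int r)) * (1 / (real n ^ (r - 1) * \<rho> ^ n))"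
proof -
  have "\<rho> powi (int n - int r + 1) = \<rho> powi (int n + (1 - int r))" by (simp add: algebra_simps)
  also have "\<dots> = \<rho> ^ n * \<rho> powi (1 - int r)" using \<rho>_pos by (subst power_int_add) auto
  finally show ?thesis by (simp add: scale_def)
qed

lemma scale_pos: "n \<ge> 1 \<Longrightarrow> scale n > 0"
  using \<rho>_pos by (simp add: scale_eq)

lemma scale_ratio: "(\<lambda>n. scale (n + L) / scale n) \<longlonglongrightarrow> 1 / \<rho> ^ L"
proof -
  have "(\<lambda>n. (real n / real (n + L)) ^ (r - 1) * (1 / \<rho> ^ L)) \<longlonglongrightarrow> 1 ^ (r - 1) * (1 / \<rho> ^ L)"
  proof (intro tendsto_intros)
    have "(\<lambda>n. 1 - real L * (1 / real (n + L))) \<longlonglongrightarrow> 1 - real L * 0"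
      by (intro tendsto_intros LIMSEQ_ignore_initial_segment[OF lim_1_over_n])
    moreover have "\<forall>\<^sub>F n in sequentially. 1 - real L * (1 / real (n + L)) = real n / real (n + L)"
      using eventually_gt_at_top[of 0] by eventually_elim (simp add: field_simps)
    ultimately show "(\<lambda>n. real n / real (n + L)) \<longlonglongrightarrow> 1" by (auto intro: Lim_transform_eventually)
  qed
  moreover have "\<forall>\<^sub>F n in sequentially. (real n / real (n + L)) ^ (r - 1) * (1 / \<rho> ^ L) = scale (n + L) / scale n"
    using eventually_gt_at_top[of 0]
  proof eventually_elim
    case (elim n)
    have "\<rho> powi (1 - int r) > 0" using \<rho>_pos by (rule zero_less_power_int)
    then show ?case
      using elim \<rho>_pos by (simp add: scale_eq power_add power_divide field_simps)
  qed
  ultimately show ?thesis by (auto intro: Lim_transform_eventually)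
qed

text \<open>Split by spectral projections: on peripheral parts R^n cancels the rotation and the
  binomial asymptotics apply, on the others the geometric decay wins.\<close>

lemma convergent_complex:
  "convergent (\<lambda>n. complex_of_real (1 / (real n ^ (r - 1) * \<rho> ^ n)) *s
     (cmat (matpow R_inv n ** matpow M n) *v x))"
proof -
  let ?c = "\<lambda>n. complex_of_real (1 / (real n ^ (r - 1) * \<rho> ^ n))"
  let ?d = "phase_factor (\<lambda>z. inverse (phases k u A z))"
  let ?f = "\<lambda>z n. (?c n * ?d z ^ n) *s (matpow (cmat M) n *v (Pr z *v x))"
  have "?c n *s (cmat (matpow R_inv n ** matpow M n) *v x) = (\<Sum>z\<in>Z. ?f z n)" for n
  proof -
    have "Pr z *v (matpow (cmat M) n *v x) = matpow (cmat M) n *v (Pr z *v x)" for z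
      by (simp only: matrix_vector_mul_assoc matpow_commute[OF Pr_commute])
    then have "cmat (matpow R_inv n ** matpow M n) *v x = (\<Sum>z\<in>Z. ?d z ^ n *s (matpow (cmat M) n *v (Pr z *v x)))"
      by (simp add: cmat_mult cmat_matpow cmat_R_inv spectral_mult_pow matrix_vector_mul_assoc[symmetric]
          spectral_mult_vector)
    then show ?thesis by (simp only: vec.scale_sum_right vector_smult_assoc)
  qed
  moreover have "convergent (?f z)" if z: "z \<in> Z" for z
  proof (cases "cmod z = \<rho>")
    case True
    have "matpow (cmat M - Finite_Cartesian_Product.mat z) r ** Pr z = 0"
      using Pr_nilpotent[of z] True by simp
    then have "matpow (cmat M - Finite_Cartesian_Product.mat z) r *v (Pr z *v x) = 0"
      by (simp only: matrix_vector_mul_assoc matrix_vector_mult_0)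
    moreover have "z \<noteq> 0" using True \<rho>_pos by auto
    moreover have "?d z = complex_of_real \<rho> / z"
      using z Z_spectrum True by (auto simp: phase_factor_def phases_def peripheral_spectrum_def)
    ultimately show ?thesis using gen_eigenvector_peripheral True by simp
  next
    case False
    then have "cmod z < \<rho>" using z Z_spectrum cmod_le_spec_rad[of z M] by auto
    moreover obtain s where "matpow (cmat M - Finite_Cartesian_Product.mat z) s *v (Pr z *v x) = 0"
      using Pr_gen_eigen by blast
    ultimately have "(\<lambda>n. complex_of_real (1 / \<rho> ^ n) *s (matpow (cmat M) n *v (Pr z *v x))) \<longlonglongrightarrow> 0"
      by (intro gen_eigenvector_decay)
    \<comment> \<open>The limit \<open>0 ^ (r - 1)\<close> covers both r = 1 and larger r; either
      way the product with a null sequence tends to 0.\<close>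
    then have "(\<lambda>n. complex_of_real ((1 / real n) ^ (r - 1)) *s
        (complex_of_real (1 / \<rho> ^ n) *s (matpow (cmat M) n *v (Pr z *v x)))) \<longlonglongrightarrow> complex_of_real (0 ^ (r - 1)) *s 0"
      by (intro tendsto_vector_smult tendsto_intros lim_1_over_n)
    moreover have "?d z = 1" using False by (auto simp: phase_factor_def peripheral_spectrum_def)
    ultimately show ?thesis by (simp add: vector_smult_assoc power_divide convergentI)
  qed
  then have "convergent (\<lambda>n. \<Sum>z\<in>Z. ?f z n)" by (intro convergent_sum)
  ultimately show ?thesis by simp
qed

text \<open>Gives meaning to the \<open>lim\<close> in \<open>limit_matrix\<close>: entries are read
  off by applying the complex statement to unit vectors and taking real parts.\<close>

lemma limit_matrix_tendsto:
  "(\<lambda>n. scale n *\<^sub>R (matpow R_inv n ** matpow M n)) \<longlonglongrightarrow> limit_matrix k u A"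
proof -
  let ?X = "\<lambda>n. scale n *\<^sub>R (matpow R_inv n ** matpow M n)"
  let ?Y = "\<lambda>n. matpow R_inv n ** matpow M n"
  let ?c = "\<lambda>n. 1 / (real n ^ (r - 1) * \<rho> ^ n)"
  have "convergent (\<lambda>n. ?X n $ i $ j)" for i j
  proof -
    obtain l where "(\<lambda>n. complex_of_real (?c n) *s (cmat (?Y n) *v axis j 1)) \<longlonglongrightarrow> l"
      using convergent_complex[of "axis j 1"] by (auto simp: convergent_def)
    then have "(\<lambda>n. (fact (r - 1) / \<rho> powi (1 - int r)) * Re ((complex_of_real (?c n) *s (cmat (?Y n) *v axis j 1)) $ i))
        \<longlonglongrightarrow> (fact (r - 1) / \<rho> powi (1 - int r)) * Re (l $ i)"
      by (intro tendsto_mult tendsto_const tendsto_Re tendsto_vec_nth)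
    moreover have "(cmat (?Y n) *v axis j 1) $ i = complex_of_real (?Y n $ i $ j)" for n
      by (simp add: matrix_vector_mult_def axis_def if_distrib[where f = "\<lambda>x. y * x" for y] cong: if_cong)
    ultimately have "(\<lambda>n. ?X n $ i $ j) \<longlonglongrightarrow> (fact (r - 1) / \<rho> powi (1 - int r)) * Re (l $ i)"
      by (simp add: scale_eq mult.assoc)
    then show ?thesis by (auto simp: convergent_def)
  qed
  then have "?X \<longlonglongrightarrow> (\<chi> i j. lim (\<lambda>n. ?X n $ i $ j))"
    by (intro vec_tendstoI) (simp add: convergent_LIMSEQ_iff[symmetric])
  then have "convergent ?X" by (rule convergentI)
  then show ?thesis
    unfolding limit_matrix_def Let_def scale_def[symmetric] by (simp add: convergent_LIMSEQ_iff)
qed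

text \<open>The vector R_h P v for h = g^n, that is, the bounded quasiperiodic profile which the
  normalised powers of M on v follow.\<close>

definition asymp :: "nat \<Rightarrow> real^'d" where
  "asymp n = phase_mult k u A (h_pow n) *v (limit_matrix k u A *v v)"

lemma phase_mult_h_pow_bounded:
  "\<exists>C. \<forall>n x. norm (phase_mult k u A (h_pow n) *v x) \<le> C * norm x"
proof -
  define C where "C = 1 + (\<Sum>z\<in>Z. \<Sum>i\<in>UNIV. \<Sum>j\<in>UNIV. cmod (Pr z $ i $ j))"
  have bound: "\<bar>phase_mult k u A (h_pow n) $ i $ j\<bar> \<le> C" for n i j
  proof -
    have "\<bar>phase_mult k u A (h_pow n) $ i $ j\<bar> = cmod (cmat (phase_mult k u A (h_pow n)) $ i $ j)" by simp
    also have "\<dots> = cmod (\<Sum>z\<in>Z. phase_factor (h_pow n) z * Pr z $ i $ j)"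
      unfolding cmat_phase_mult_group[OF h_pow_in_phase_group] spectral_mult_def
      by (simp add: mat_mult_scalar)
    also have "\<dots> \<le> (\<Sum>z\<in>Z. cmod (phase_factor (h_pow n) z * Pr z $ i $ j))" by (rule norm_sum)
    also have "\<dots> = (\<Sum>z\<in>Z. cmod (Pr z $ i $ j))"
      by (intro sum.cong refl) (auto simp: phase_factor_def norm_mult norm_power norm_phases)
    also have "\<dots> \<le> (\<Sum>z\<in>Z. \<Sum>i\<in>UNIV. \<Sum>j\<in>UNIV. cmod (Pr z $ i $ j))"
    proof (intro sum_mono)
      fix z
      have "cmod (Pr z $ i $ j) \<le> (\<Sum>j\<in>UNIV. cmod (Pr z $ i $ j))"
        by (rule member_le_sum) auto
      also have "\<dots> \<le> (\<Sum>i\<in>UNIV. \<Sum>j\<in>UNIV. cmod (Pr z $ i $ j))"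
        by (rule member_le_sum[where f = "\<lambda>i. \<Sum>j\<in>UNIV. cmod (Pr z $ i $ j)"]) (auto intro: sum_nonneg)
      finally show "cmod (Pr z $ i $ j) \<le> (\<Sum>i\<in>UNIV. \<Sum>j\<in>UNIV. cmod (Pr z $ i $ j))" .
    qed
    finally show ?thesis by (simp add: C_def)
  qed
  show ?thesis
    using norm_matrix_vector_le[OF bound] by (intro exI allI)
qed

lemma asymp_bounded: "\<exists>C. \<forall>n. norm (asymp n) \<le> C"
  using phase_mult_h_pow_bounded unfolding asymp_def by metis

text \<open>The difference is R_h, h = g^n, applied to a null sequence, and these operators are
  uniformly bounded because all phases have modulus 1.\<close>

lemma scaled_power_asymp: "(\<lambda>n. scale n *\<^sub>R (matpow M n *v v) - asymp n) \<longlonglongrightarrow> 0"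
proof -
  let ?X = "\<lambda>n. scale n *\<^sub>R (matpow R_inv n ** matpow M n)"
  from phase_mult_h_pow_bounded obtain C
    where C: "\<forall>n x. norm (phase_mult k u A (h_pow n) *v x) \<le> C * norm x" ..
  have "scale n *\<^sub>R (matpow M n *v v) = phase_mult k u A (h_pow n) *v (?X n *v v)" for n
  proof -
    have "phase_mult k u A (h_pow n) *v (matpow R_inv n *v y) = y" for y
      using phase_mult_h_pow[of n] by (simp only: matrix_vector_mul_assoc matrix_vector_mul_lid)
    moreover have "?X n *v v = scale n *\<^sub>R (matpow R_inv n *v (matpow M n *v v))"
      by (simp only: scaleR_matrix_vector_assoc matrix_vector_mul_assoc)
    ultimately show ?thesis by (simp only: matrix_vector_mult_scaleR)
  qed
  then have eq: "scale n *\<^sub>R (matpow M n *v v) - asymp n =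
      phase_mult k u A (h_pow n) *v (?X n *v v - limit_matrix k u A *v v)" for n
    by (simp add: asymp_def matrix_vector_mult_diff_distrib)
  have "(\<lambda>n. ?X n *v v) \<longlonglongrightarrow> limit_matrix k u A *v v"
    by (intro tendsto_matrix_vector_mult tendsto_vec_nth limit_matrix_tendsto)
  then have "(\<lambda>n. C * norm (?X n *v v - limit_matrix k u A *v v)) \<longlonglongrightarrow> C * 0"
    by (intro tendsto_mult tendsto_const tendsto_norm_zero LIM_zero)
  then have lim: "(\<lambda>n. C * norm (?X n *v v - limit_matrix k u A *v v)) \<longlonglongrightarrow> 0" by simp
  show ?thesis
    unfolding eq by (rule Lim_null_comparison[OF always_eventually lim]) (simp add: C)
qed

lemma asymp_in_hat_space: "asymp n \<in> hat_space k u A v"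
proof -
  have "asymp n = matpow (tilde k u A 0) 0 *v (digits_prod k (tilde k u A) 0 *v
      (phase_mult k u A (h_pow n) *v (limit_matrix k u A *v v)))"
    by (simp add: asymp_def digits_prod.simps)
  then show ?thesis unfolding hat_space_def using h_pow_in_phase_group by (intro span_base) blast
qed

text \<open>Nondegeneracy gives positivity at each h; compactness makes it uniform. A sequence of
  values tending to 0 or below would have a subsequence along which the phases converge to some h in
  the group where positivity fails.\<close>

lemma asymp_positive:
  "\<exists>\<epsilon>>0. \<forall>n. inner u (((\<Sum>j<k. A j) - A 0) *v asymp n) \<ge> \<epsilon>"
proof (rule ccontr)
  let ?q = "\<lambda>x. inner u (((\<Sum>j<k. A j) - A 0) *v x)"
  assume neg: "\<not> (\<exists>\<epsilon>>0. \<forall>n. ?q (asymp n) \<ge> \<epsilon>)"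
  have "\<exists>n. ?q (asymp n) < 1 / real (Suc j)" for j
  proof -
    have "1 / real (Suc j) > 0" by simp
    then show ?thesis using neg by (meson linorder_not_less)
  qed
  then obtain n where n: "\<And>j. ?q (asymp (n j)) < 1 / real (Suc j)" by metis
  have "bounded (range (\<lambda>j. phases k u A z ^ n j))" for z
    by (intro boundedI[of _ 1]) (auto simp: norm_power norm_phases)
  moreover have "finite (peripheral_spectrum M)"
    using finite_spectrum[of M] by (simp add: peripheral_spectrum_def)
  ultimately obtain \<sigma> :: "nat \<Rightarrow> nat" where \<sigma>: "strict_mono \<sigma>"
      "\<And>z. z \<in> peripheral_spectrum M \<Longrightarrow> convergent (\<lambda>j. phases k u A z ^ n (\<sigma> j))"
    using finite_family_convergent_subsequence[of "peripheral_spectrum M" "\<lambda>z j. phases k u A z ^ n j"] by blast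
  define h where "h z = lim (\<lambda>j. phases k u A z ^ n (\<sigma> j))" for z
  have lim_h: "(\<lambda>j. h_pow (n (\<sigma> j)) z) \<longlonglongrightarrow> h z" for z
  proof (cases "z \<in> peripheral_spectrum M")
    case True
    then show ?thesis using \<sigma>(2) by (simp add: h_def convergent_LIMSEQ_iff)
  next
    case False
    then have "phases k u A z = 1" by (simp add: phases_def)
    then show ?thesis by (simp add: h_def)
  qed
  have h: "h \<in> phase_group k u A"
    unfolding phase_group_def
    by (rule Lim_in_closed_set[OF closed_closure _ _ tendsto_fun[OF lim_h]])
      (auto intro!: always_eventually subsetD[OF closure_subset])
  have "(\<lambda>j. spectral_mult (phase_factor (h_pow (n (\<sigma> j)))) $ a $ b) \<longlonglongrightarrow> spectral_mult (phase_factor h) $ a $ b" for a b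
    unfolding spectral_mult_def mat_mult_scalar sum_component vec_lambda_beta
    by (intro tendsto_intros) (auto simp: phase_factor_def lim_h)
  then have "(\<lambda>j. Re (cmat (phase_mult k u A (h_pow (n (\<sigma> j)))) $ a $ b)) \<longlonglongrightarrow> Re (cmat (phase_mult k u A h) $ a $ b)" for a b
    unfolding cmat_phase_mult_group[OF h_pow_in_phase_group] cmat_phase_mult_group[OF h]
    by (intro tendsto_Re)
  then have "(\<lambda>j. asymp (n (\<sigma> j))) \<longlonglongrightarrow> phase_mult k u A h *v (limit_matrix k u A *v v)"
    unfolding asymp_def by (intro tendsto_matrix_vector_mult) simp
  then have "(\<lambda>j. ?q (asymp (n (\<sigma> j)))) \<longlonglongrightarrow> ?q (phase_mult k u A h *v (limit_matrix k u A *v v))"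
    by (intro tendsto_inner tendsto_const bounded_linear.tendsto[OF matrix_vector_mul_bounded_linear])
  moreover have "(\<lambda>j. 1 / real (Suc (\<sigma> j))) \<longlonglongrightarrow> 0"
    using LIMSEQ_subseq_LIMSEQ[OF lim_1_over_real_power[of 1, THEN LIMSEQ_Suc] \<sigma>(1)] by (simp add: o_def)
  ultimately have "?q (phase_mult k u A h *v (limit_matrix k u A *v v)) \<le> 0"
    by (rule LIMSEQ_le) (use n less_imp_le in blast)
  moreover have "?q (phase_mult k u A h *v (limit_matrix k u A *v v)) > 0"
    using nondeg h by (simp add: nondegenerate_representation_def)
  ultimately show False by simp
qed

end

section \<open>Joint spectral radius\<close>

text \<open>Fekete's lemma in multiplicative form: the limit is the infimum. One index m with root
  below c' controls all n by writing n = q m + r.\<close>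

lemma submultiplicative_root_convergent:
  fixes a :: "nat \<Rightarrow> real"
  assumes nonneg: "\<And>n. a n \<ge> 0" and submult: "\<And>m n. a (m + n) \<le> a m * a n"
  shows "convergent (\<lambda>n. root n (a n))"
proof -
  define l where "l = Inf ((\<lambda>n. root n (a n)) ` {1..})"
  have bdd: "bdd_below ((\<lambda>n. root n (a n)) ` {1..})"
    by (intro bdd_belowI[of _ 0]) (auto simp: nonneg)
  have lower: "l \<le> root n (a n)" if "n \<ge> 1" for n
    unfolding l_def by (rule cInf_lower[OF _ bdd]) (use that in auto)
  have l: "l \<ge> 0" unfolding l_def by (rule cInf_greatest) (auto simp: nonneg)
  have upper: "\<forall>\<^sub>F n in sequentially. root n (a n) < c" if c: "c > l" for c
  proof -
    obtain c' where c': "l < c'" "c' < c" using dense[OF c] by blast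
    obtain m where m: "m \<ge> 1" "root m (a m) < c'"
      using cInf_lessD[of "(\<lambda>n. root n (a n)) ` {1..}" c'] c'(1) by (auto simp: l_def)
    have c'0: "c' > 0" using l c' by simp
    have "a m = root m (a m) ^ m" using m(1) nonneg by simp
    also have "\<dots> \<le> c' ^ m" using less_imp_le[OF m(2)] real_root_ge_zero[OF nonneg] by (rule power_mono)
    finally have am: "a m \<le> c' ^ m" .
    \<comment> \<open>Dominates the remainder terms a r / c'^r for all r < m; the added 1 keeps K
      positive, so its n-th root tends to 1.\<close>
    define K where "K = 1 + (\<Sum>r<m. a r / c' ^ r)"
    have K: "K \<ge> 1" unfolding K_def using nonneg c'0 by (simp add: sum_nonneg)
    have aq: "a (q * m + r) \<le> c' ^ (q * m) * a r" for q r
    proof (induction q)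
      case (Suc q)
      have "a (Suc q * m + r) = a (m + (q * m + r))" by (simp add: algebra_simps)
      also have "\<dots> \<le> a m * a (q * m + r)" by (rule submult)
      also have "\<dots> \<le> c' ^ m * (c' ^ (q * m) * a r)"
        using am Suc nonneg c'0 by (intro mult_mono) auto
      finally show ?case by (simp add: power_add mult_ac)
    qed simp
    have bound: "a n \<le> K * c' ^ n" for n
    proof -
      have r: "n mod m < m" using m(1) by simp
      have "a n = a (n div m * m + n mod m)" by simp
      also have "\<dots> \<le> c' ^ (n div m * m) * a (n mod m)" by (rule aq)
      also have "a (n mod m) \<le> K * c' ^ (n mod m)"
      proof -
        have "a (n mod m) / c' ^ (n mod m) \<le> (\<Sum>r<m. a r / c' ^ r)"
          using r nonneg c'0 by (intro member_le_sum) auto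
        then have "a (n mod m) / c' ^ (n mod m) \<le> K" by (simp add: K_def)
        then show ?thesis using c'0 by (simp add: divide_le_eq)
      qed
      finally have "a n \<le> c' ^ (n div m * m) * (K * c' ^ (n mod m))" using c'0 by simp
      also have "\<dots> = K * c' ^ (n div m * m + n mod m)" by (simp only: power_add) simp
      finally show ?thesis by simp
    qed
    have "(\<lambda>n. root n K * c') \<longlonglongrightarrow> 1 * c'"
      using K by (intro tendsto_intros LIMSEQ_root_const) auto
    then have "\<forall>\<^sub>F n in sequentially. root n K * c' < c"
      using c'(2) by (intro order_tendstoD) auto
    then show ?thesis using eventually_gt_at_top[of 0]
    proof eventually_elim
      case (elim n)
      have "root n (a n) \<le> root n (K * c' ^ n)" using elim bound by simp
      also have "\<dots> = root n K * c'" using elim c'0 by (simp add: real_root_mult real_root_power_cancel)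
      finally show ?case using elim by simp
    qed
  qed
  have "(\<lambda>n. root n (a n)) \<longlonglongrightarrow> l"
  proof (rule order_tendstoI)
    fix c assume "c < l"
    show "\<forall>\<^sub>F n in sequentially. c < root n (a n)"
      using eventually_ge_at_top[of 1] by (rule eventually_mono) (rule less_le_trans[OF \<open>c < l\<close> lower])
  qed (rule upper)
  then show ?thesis by (rule convergentI)
qed

section \<open>Products over words and the joint spectral radius\<close>

definition word_prod :: "(nat \<Rightarrow> real^'d^'d) \<Rightarrow> nat list \<Rightarrow> real^'d^'d" where
  "word_prod T w = foldr (\<lambda>i M. T i ** M) w (Finite_Cartesian_Product.mat 1)"

lemma word_prod_Nil [simp]: "word_prod T [] = Finite_Cartesian_Product.mat 1"
  and word_prod_Cons: "word_prod T (i # w) = T i ** word_prod T w"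
  by (simp_all add: word_prod_def)

lemma word_prod_append: "word_prod T (w @ w') = word_prod T w ** word_prod T w'"
  by (induction w) (simp_all add: word_prod_Cons matrix_mul_assoc)

definition words :: "nat \<Rightarrow> nat \<Rightarrow> nat list set" where
  "words k n = {w. length w = n \<and> set w \<subseteq> {..<k}}"

lemma finite_words: "finite (words k n)"
  using finite_lists_length_eq[of "{..<k}" n] by (simp add: words_def conj_commute)

lemma card_words: "card (words k n) = k ^ n"
  using card_lists_length_eq[of "{..<k}" n] by (simp add: words_def conj_commute)

lemma words_nonempty: "k > 0 \<Longrightarrow> words k n \<noteq> {}"
  using card_words[of k n] by auto

lemma words_Suc: "words k (Suc n) = (\<lambda>(i, w). i # w) ` ({..<k} \<times> words k n)"
  by (auto simp: words_def image_iff length_Suc_conv)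

lemma sum_word_prod:
  "(\<Sum>w\<in>words k n. word_prod T w *v x) = (((*v) (\<Sum>i<k. T i)) ^^ n) x"
proof (induction n)
  case 0
  have "words k 0 = {[]}" by (auto simp: words_def)
  then show ?case by simp
next
  case (Suc n)
  have "(\<Sum>w\<in>words k (Suc n). word_prod T w *v x) = (\<Sum>(i, w)\<in>{..<k} \<times> words k n. T i *v (word_prod T w *v x))"
    unfolding words_Suc by (subst sum.reindex) (auto simp: inj_on_def word_prod_Cons matrix_vector_mul_assoc intro!: sum.cong)
  also have "\<dots> = (\<Sum>i<k. T i *v (\<Sum>w\<in>words k n. word_prod T w *v x))"
    by (simp add: sum.cartesian_product[symmetric] linear_sum[OF matrix_vector_mul_linear])
  also have "\<dots> = (\<Sum>i<k. T i) *v (\<Sum>w\<in>words k n. word_prod T w *v x)"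
    by (simp add: matrix_sum_vector_mult)
  finally show ?case by (simp add: Suc)
qed

definition max_norm :: "nat \<Rightarrow> (nat \<Rightarrow> real^'d^'d) \<Rightarrow> nat \<Rightarrow> real" where
  "max_norm k T n = Max ((\<lambda>w. onorm ((*v) (word_prod T w))) ` words k n)"

lemma onorm_le_max_norm: "w \<in> words k n \<Longrightarrow> onorm ((*v) (word_prod T w)) \<le> max_norm k T n"
  unfolding max_norm_def by (intro Max_ge) (auto simp: finite_words)

lemma norm_word_prod_le:
  assumes "w \<in> words k n"
  shows "norm (word_prod T w *v x) \<le> max_norm k T n * norm x"
proof -
  have "norm (word_prod T w *v x) \<le> onorm ((*v) (word_prod T w)) * norm x"
    by (intro onorm matrix_vector_mul_bounded_linear)
  also have "\<dots> \<le> max_norm k T n * norm x"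
    by (intro mult_right_mono onorm_le_max_norm assms) auto
  finally show ?thesis .
qed

lemma max_norm_le:
  assumes "k > 0" "\<And>w x. w \<in> words k n \<Longrightarrow> norm (word_prod T w *v x) \<le> C * norm x"
  shows "max_norm k T n \<le> C"
  unfolding max_norm_def using assms(2)
  by (subst Max_le_iff) (auto simp: finite_words words_nonempty assms(1) intro!: onorm_le)

lemma max_norm_nonneg:
  assumes "k > 0"
  shows "max_norm k T n \<ge> 0"
proof -
  obtain w where "w \<in> words k n" using words_nonempty[OF assms] by blast
  then show ?thesis using onorm_le_max_norm[of w k n T] onorm_pos_le[OF matrix_vector_mul_bounded_linear[of "word_prod T w"]]
    by linarith
qed

lemma max_norm_submult:
  assumes "k > 0"
  shows "max_norm k T (m + n) \<le> max_norm k T m * max_norm k T n"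
proof (rule max_norm_le[OF assms])
  fix w x assume w: "w \<in> words k (m + n)"
  then have 1: "take m w \<in> words k m" and 2: "drop m w \<in> words k n"
    by (auto simp: words_def dest: in_set_takeD in_set_dropD)
  have "word_prod T w *v x = word_prod T (take m w) *v (word_prod T (drop m w) *v x)"
    by (simp only: matrix_vector_mul_assoc word_prod_append[symmetric] append_take_drop_id)
  then have "norm (word_prod T w *v x) \<le> max_norm k T m * norm (word_prod T (drop m w) *v x)"
    using norm_word_prod_le[OF 1] by simp
  also have "\<dots> \<le> max_norm k T m * (max_norm k T n * norm x)"
    by (intro mult_left_mono norm_word_prod_le[OF 2] max_norm_nonneg[OF assms])
  finally show "norm (word_prod T w *v x) \<le> max_norm k T m * max_norm k T n * norm x"
    by (simp add: mult.assoc)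
qed

text \<open>Justifies the \<open>lim\<close> in the definition; since \<open>root n\<close> is
  monotone it commutes with the maximum, and the maximal norms are submultiplicative.\<close>

lemma joint_spectral_radius_tendsto:
  assumes "k > 0"
  shows "(\<lambda>n. root n (max_norm k T n)) \<longlonglongrightarrow> joint_spectral_radius k T"
proof -
  have "Max {root n (onorm ((*v) (foldr (\<lambda>i M. T i ** M) w (Finite_Cartesian_Product.mat 1)))) | w.
      length w = n \<and> set w \<subseteq> {..<k}} = root n (max_norm k T n)" for n
  proof -
    have "{root n (onorm ((*v) (foldr (\<lambda>i M. T i ** M) w (Finite_Cartesian_Product.mat 1)))) | w.
      length w = n \<and> set w \<subseteq> {..<k}} = root n ` (\<lambda>w. onorm ((*v) (word_prod T w))) ` words k n"
      by (auto simp: words_def word_prod_def)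
    moreover have "mono (root n)"
      by (cases "n = 0") (auto simp: mono_def)
    ultimately show ?thesis
      unfolding max_norm_def by (simp add: mono_Max_commute finite_words words_nonempty[OF assms])
  qed
  moreover have "convergent (\<lambda>n. root n (max_norm k T n))"
    by (rule submultiplicative_root_convergent[OF max_norm_nonneg[OF assms] max_norm_submult[OF assms]])
  ultimately show ?thesis unfolding joint_spectral_radius_def by (simp add: convergent_LIMSEQ_iff)
qed

lemma joint_spectral_radius_nonneg: "k > 0 \<Longrightarrow> joint_spectral_radius k T \<ge> 0"
  by (rule LIMSEQ_le_const[OF joint_spectral_radius_tendsto]) (auto intro: max_norm_nonneg real_root_ge_zero)

lemma eventually_max_norm_less:
  assumes "k > 0" "joint_spectral_radius k T < t"
  shows "\<forall>\<^sub>F n in sequentially. max_norm k T n < t ^ n"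
proof -
  have "\<forall>\<^sub>F n in sequentially. root n (max_norm k T n) < t"
    using order_tendstoD(2)[OF joint_spectral_radius_tendsto[OF assms(1)] assms(2)] .
  then show ?thesis using eventually_gt_at_top[of 0]
  proof eventually_elim
    case (elim n)
    have "max_norm k T n = root n (max_norm k T n) ^ n" using elim max_norm_nonneg[OF assms(1), of T n] by simp
    also have "\<dots> < t ^ n" using elim max_norm_nonneg[OF assms(1), of T n] by (intro power_strict_mono) (auto intro: real_root_ge_zero)
    finally show ?case .
  qed
qed

lemma joint_spectral_radius_le:
  assumes "k > 0" "t \<ge> 0" "\<And>n. n > 0 \<Longrightarrow> max_norm k T n \<le> C * t ^ n"
  shows "joint_spectral_radius k T \<le> t"
proof -
  \<comment> \<open>\<open>1 + \<bar>C\<bar>\<close> replaces \<open>C\<close> to have a positive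
    constant, whose n-th root tends to 1.\<close>
  have "(\<lambda>n. root n (1 + \<bar>C\<bar>) * t) \<longlonglongrightarrow> 1 * t"
    by (intro tendsto_intros LIMSEQ_root_const) auto
  moreover have "\<forall>\<^sub>F n in sequentially. root n (max_norm k T n) \<le> root n (1 + \<bar>C\<bar>) * t"
    using eventually_gt_at_top[of 0]
  proof eventually_elim
    case (elim n)
    have "max_norm k T n \<le> C * t ^ n" using assms(3) elim by simp
    also have "\<dots> \<le> (1 + \<bar>C\<bar>) * t ^ n" using assms(2) by (intro mult_right_mono) auto
    finally have "root n (max_norm k T n) \<le> root n ((1 + \<bar>C\<bar>) * t ^ n)" using elim by simp
    then show ?case using elim assms(2) by (simp add: real_root_mult real_root_power_cancel)
  qed
  ultimately show ?thesis
    using tendsto_le[OF _ _ joint_spectral_radius_tendsto[OF assms(1)]] by force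
qed

text \<open>The n-th power of the sum is a sum of k^n products, so the largest of them is at least
  the average. The witness x may change with n.\<close>

lemma joint_spectral_radius_ge:
  assumes "k > 0" "\<rho> \<ge> 0" "c > 0"
    "\<And>n. \<exists>x. norm x > 0 \<and> c * \<rho> ^ n * norm x \<le> norm ((((*v) (\<Sum>i<k. T i)) ^^ n) x)"
  shows "\<rho> / real k \<le> joint_spectral_radius k T"
proof -
  have bound: "c * (\<rho> / real k) ^ n \<le> max_norm k T n" for n
  proof -
    obtain x where x: "norm x > 0" "c * \<rho> ^ n * norm x \<le> norm ((((*v) (\<Sum>i<k. T i)) ^^ n) x)"
      using assms(4) by blast
    note x(2)
    also have "norm ((((*v) (\<Sum>i<k. T i)) ^^ n) x) \<le> (\<Sum>w\<in>words k n. max_norm k T n * norm x)"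
      unfolding sum_word_prod[symmetric] by (rule sum_norm_le) (rule norm_word_prod_le)
    also have "\<dots> = real k ^ n * max_norm k T n * norm x" by (simp add: card_words)
    finally have "c * \<rho> ^ n \<le> real k ^ n * max_norm k T n" using x(1) by simp
    then show ?thesis using assms(1) by (simp add: power_divide field_simps)
  qed
  have "(\<lambda>n. root n c * (\<rho> / real k)) \<longlonglongrightarrow> 1 * (\<rho> / real k)"
    by (intro tendsto_intros LIMSEQ_root_const assms(3))
  moreover have "\<forall>\<^sub>F n in sequentially. root n c * (\<rho> / real k) \<le> root n (max_norm k T n)"
    using eventually_gt_at_top[of 0]
  proof eventually_elim
    case (elim n)
    have "root n (c * (\<rho> / real k) ^ n) \<le> root n (max_norm k T n)" using elim bound by simp
    then show ?case using elim assms(2) by (simp add: real_root_mult real_root_power_cancel)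
  qed
  ultimately show ?thesis
    using tendsto_le[OF _ joint_spectral_radius_tendsto[OF assms(1)]] by force
qed

lemma word_prod_invariant:
  assumes "\<And>i x. i < k \<Longrightarrow> x \<in> W \<Longrightarrow> T i *v x \<in> W" "set w \<subseteq> {..<k}" "x \<in> W"
  shows "word_prod T w *v x \<in> W"
  using assms(2,3)
  by (induction w) (auto simp: word_prod_Cons matrix_vector_mul_assoc[symmetric] intro: assms(1))

text \<open>\<open>T_in\<close> and \<open>T_proj\<close> say that each T i is an operator on S
  extended by 0 to the orthogonal complement, which is the form of the \<open>hat\<close>
  matrices.\<close>

locale irreducible_family =
  fixes k :: nat and T :: "nat \<Rightarrow> real^'d^'d" and S :: "(real^'d) set"
  assumes k_pos: "k > 0" and subspace_S: "Real_Vector_Spaces.subspace S" and S_nz: "S \<noteq> {0}"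
    and T_in: "\<And>i x. i < k \<Longrightarrow> T i *v x \<in> S"
    and T_proj: "\<And>i. i < k \<Longrightarrow> T i ** orth_proj S = T i"
    and irreducible: "no_common_invariant_subspace k S T"
begin

lemma invariant_trivial:
  assumes "Real_Vector_Spaces.subspace W" "W \<subseteq> S" "\<And>i x. i < k \<Longrightarrow> x \<in> W \<Longrightarrow> T i *v x \<in> W"
  shows "W = {0} \<or> W = S"
  using irreducible assms unfolding no_common_invariant_subspace_def by blast

lemma word_prod_in: "set w \<subseteq> {..<k} \<Longrightarrow> x \<in> S \<Longrightarrow> word_prod T w *v x \<in> S"
  by (rule word_prod_invariant[of k S T]) (auto intro: T_in)

lemma compact_unit_sphere: "compact {x \<in> S. norm x = 1}"
proof -
  have "{x \<in> S. norm x = 1} = S \<inter> sphere 0 1" by auto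
  then show ?thesis using closed_subspace[OF subspace_S] by (simp add: closed_Int_compact)
qed

text \<open>
  An irreducible family has bounded products after normalisation: otherwise every unit vector is
  doubled by some word, by compactness of bounded length, and concatenating such words makes the
  joint spectral radius too large.
\<close>

theorem products_bounded:
  assumes pos: "joint_spectral_radius k T > 0"
  shows "\<exists>C. \<forall>w x. set w \<subseteq> {..<k} \<longrightarrow> x \<in> S \<longrightarrow>
    norm (word_prod T w *v x) \<le> C * joint_spectral_radius k T ^ length w * norm x"
proof -
  let ?\<rho> = "joint_spectral_radius k T"
  \<comment> \<open>The vectors with bounded normalised orbit form an invariant subspace, since
    appending a letter only changes the constant; by irreducibility it is all of S or
    trivial.\<close>
  define E where "E = {x \<in> S. \<exists>C. \<forall>w. set w \<subseteq> {..<k} \<longrightarrow> norm (word_prod T w *v x) \<le> C * ?\<rho> ^ length w}"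
  have "Real_Vector_Spaces.subspace E"
  proof (rule subspaceI)
    show "0 \<in> E" using subspace_0[OF subspace_S] by (auto simp: E_def intro!: exI[of _ 0])
  next
    fix x y assume x: "x \<in> E" and y: "y \<in> E"
    from x obtain C where C: "\<And>w. set w \<subseteq> {..<k} \<Longrightarrow> norm (word_prod T w *v x) \<le> C * ?\<rho> ^ length w" unfolding E_def by auto
    from y obtain D where D: "\<And>w. set w \<subseteq> {..<k} \<Longrightarrow> norm (word_prod T w *v y) \<le> D * ?\<rho> ^ length w" unfolding E_def by auto
    have "norm (word_prod T w *v (x + y)) \<le> (C + D) * ?\<rho> ^ length w" if "set w \<subseteq> {..<k}" for w
      using C[OF that] D[OF that] norm_triangle_ineq[of "word_prod T w *v x" "word_prod T w *v y"]
      by (simp add: matrix_vector_right_distrib distrib_right)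
    then show "x + y \<in> E" using x y subspace_add[OF subspace_S] unfolding E_def by blast
  next
    fix c x assume x: "x \<in> E"
    from x obtain C where C: "\<And>w. set w \<subseteq> {..<k} \<Longrightarrow> norm (word_prod T w *v x) \<le> C * ?\<rho> ^ length w" unfolding E_def by auto
    have "norm (word_prod T w *v (c *\<^sub>R x)) \<le> (\<bar>c\<bar> * C) * ?\<rho> ^ length w" if "set w \<subseteq> {..<k}" for w
      using mult_left_mono[OF C[OF that], of "\<bar>c\<bar>"] by (simp add: matrix_vector_mult_scaleR mult.assoc)
    then show "c *\<^sub>R x \<in> E" using x subspace_scale[OF subspace_S] unfolding E_def by blast
  qed
  moreover have "T i *v x \<in> E" if "i < k" "x \<in> E" for i x
  proof -
    from that obtain C where C: "\<And>w. set w \<subseteq> {..<k} \<Longrightarrow> norm (word_prod T w *v x) \<le> C * ?\<rho> ^ length w" unfolding E_def by auto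
    have "norm (word_prod T w *v (T i *v x)) \<le> (C * ?\<rho>) * ?\<rho> ^ length w" if "set w \<subseteq> {..<k}" for w
      using C[of "w @ [i]"] that \<open>i < k\<close> by (simp add: word_prod_append word_prod_Cons matrix_vector_mul_assoc mult_ac)
    then show ?thesis using T_in that unfolding E_def by blast
  qed
  ultimately have "E = {0} \<or> E = S" by (intro invariant_trivial) (auto simp: E_def)
  then show ?thesis
  proof
    assume E: "E = S"
    obtain Q where Q: "Q \<subseteq> S" "pairwise orthogonal Q" "\<And>x. x \<in> Q \<Longrightarrow> norm x = 1" "Real_Vector_Spaces.independent Q" "Real_Vector_Spaces.span Q = S"
      using orthonormal_basis_subspace[OF subspace_S] by metis
    \<comment> \<open>The constants so far depend on the vector; an orthonormal basis makes them
      uniform.\<close>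
    have "\<exists>C. \<forall>w. set w \<subseteq> {..<k} \<longrightarrow> norm (word_prod T w *v b) \<le> C * ?\<rho> ^ length w" if "b \<in> Q" for b
      using that Q(1) E unfolding E_def by blast
    then obtain C where C: "\<And>b w. b \<in> Q \<Longrightarrow> set w \<subseteq> {..<k} \<Longrightarrow> norm (word_prod T w *v b) \<le> C b * ?\<rho> ^ length w"
      by metis
    have fin: "finite Q" using Q(4) by (rule independent_imp_finite)
    have "norm (word_prod T w *v x) \<le> (\<Sum>b\<in>Q. C b) * ?\<rho> ^ length w * norm x" if "set w \<subseteq> {..<k}" "x \<in> S" for w x
    proof -
      have x: "(\<Sum>b\<in>Q. inner x b *\<^sub>R b) = x"
        by (rule orthonormal_basis_expand) (use Q that fin in auto)
      have "word_prod T w *v x = (\<Sum>b\<in>Q. inner x b *\<^sub>R (word_prod T w *v b))"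
        by (subst x[symmetric]) (simp add: linear_sum[OF matrix_vector_mul_linear] matrix_vector_mult_scaleR)
      also have "norm \<dots> \<le> (\<Sum>b\<in>Q. norm x * (C b * ?\<rho> ^ length w))"
      proof (rule sum_norm_le)
        fix b assume b: "b \<in> Q"
        have "\<bar>inner x b\<bar> \<le> norm x" using Cauchy_Schwarz_ineq2[of x b] Q(3)[OF b] by simp
        then show "norm (inner x b *\<^sub>R (word_prod T w *v b)) \<le> norm x * (C b * ?\<rho> ^ length w)"
          using C[OF b that(1)] by (simp add: mult_mono)
      qed
      also have "\<dots> = (\<Sum>b\<in>Q. C b) * ?\<rho> ^ length w * norm x"
        by (simp add: sum_distrib_left sum_distrib_right mult_ac)
      finally show ?thesis .
    qed
    then show ?thesis by blast
  next
    assume E: "E = {0}"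
    let ?U = "{x \<in> S. norm x = 1}"
    let ?O = "\<lambda>w. {x. norm (word_prod T w *v x) > 2 * ?\<rho> ^ length w}"
    have cover: "?U \<subseteq> \<Union> (?O ` {w. set w \<subseteq> {..<k}})"
    proof
      fix x assume x: "x \<in> ?U"
      then have "x \<notin> E" "x \<in> S" using E by auto
      then have "\<not> (\<forall>w. set w \<subseteq> {..<k} \<longrightarrow> norm (word_prod T w *v x) \<le> 2 * ?\<rho> ^ length w)"
        unfolding E_def mem_Collect_eq by blast
      then obtain w where "set w \<subseteq> {..<k}" "norm (word_prod T w *v x) > 2 * ?\<rho> ^ length w"
        unfolding not_all not_imp not_le by (elim exE conjE)
      then show "x \<in> \<Union> (?O ` {w. set w \<subseteq> {..<k}})" by (intro UN_I[of w] CollectI)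
    qed
    have "open (?O w)" for w
      by (intro open_Collect_less continuous_intros)
    then obtain W where W: "W \<subseteq> {w. set w \<subseteq> {..<k}}" "finite W" "?U \<subseteq> \<Union> (?O ` W)"
      by (rule compactE_image[OF compact_unit_sphere _ cover])
    \<comment> \<open>A bound on the length of a doubling word; \<open>Suc\<close> keeps it
      positive, so that the L-th root below makes sense.\<close>
    define L where "L = Suc (Max (length ` W))"
    have len: "length w \<le> L" if "w \<in> W" for w
      using that W(2) unfolding L_def by (simp add: le_SucI)
    obtain x0 where "x0 \<in> S" "x0 \<noteq> 0" using S_nz subspace_0[OF subspace_S] by blast
    then have x0: "(1 / norm x0) *\<^sub>R x0 \<in> ?U" using subspace_scale[OF subspace_S] by simp
    define x1 where "x1 = (1 / norm x0) *\<^sub>R x0"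
    have x1: "x1 \<in> S" "norm x1 = 1" using x0 by (auto simp: x1_def)
    \<comment> \<open>Both length bounds are needed: the lower one to reach the range where the norm
      estimate is valid, the upper one to turn n doublings into a growth rate per letter.\<close>
    have grow: "\<exists>w. set w \<subseteq> {..<k} \<and> n \<le> length w \<and> length w \<le> n * L \<and>
        norm (word_prod T w *v x1) \<ge> 2 ^ n * ?\<rho> ^ length w" for n
    proof (induction n)
      case 0
      then show ?case using x1 by (intro exI[of _ "[]"]) auto
    next
      case (Suc n)
      then obtain w where w: "set w \<subseteq> {..<k}" "n \<le> length w" "length w \<le> n * L"
        "norm (word_prod T w *v x1) \<ge> 2 ^ n * ?\<rho> ^ length w" by blast
      define y where "y = word_prod T w *v x1"
      have "2 ^ n * ?\<rho> ^ length w > 0" using pos by simp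
      then have y: "y \<in> S" "norm y > 0" using w word_prod_in x1 by (auto simp: y_def)
      then have "(1 / norm y) *\<^sub>R y \<in> ?U" using subspace_scale[OF subspace_S] by simp
      then obtain w' where w': "w' \<in> W" "norm (word_prod T w' *v ((1 / norm y) *\<^sub>R y)) > 2 * ?\<rho> ^ length w'"
        using W(3) by blast
      then have g: "norm (word_prod T w' *v y) > 2 * ?\<rho> ^ length w' * norm y"
        using y(2) by (simp add: matrix_vector_mult_scaleR field_simps)
      have "w' \<noteq> []" using g y(2) by auto
      then have "length w' \<ge> 1" by (cases w') auto
      moreover have "2 ^ Suc n * ?\<rho> ^ length (w' @ w) \<le> norm (word_prod T (w' @ w) *v x1)"
      proof -
        have "2 ^ Suc n * ?\<rho> ^ length (w' @ w) = 2 * ?\<rho> ^ length w' * (2 ^ n * ?\<rho> ^ length w)"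
          by (simp add: power_add mult_ac)
        also have "\<dots> \<le> 2 * ?\<rho> ^ length w' * norm y"
          using w(4) pos by (intro mult_left_mono) (auto simp: y_def)
        also have "\<dots> \<le> norm (word_prod T w' *v y)" using g by simp
        finally show ?thesis by (simp add: y_def word_prod_append matrix_vector_mul_assoc)
      qed
      ultimately show ?case using w W(1) w'(1) len[OF w'(1)]
        by (intro exI[of _ "w' @ w"]) auto
    qed
    have L: "L > 0" by (simp add: L_def)
    \<comment> \<open>Doubling at least once per L letters forces the rate \<rho> 2^(1/L), with
      \<rho> here the joint spectral radius; but norms of long products are eventually below t^n for
      every t above that radius.\<close>
    define t where "t = ?\<rho> * root L 2"
    have "root L 2 > 1" using L by (simp add: real_root_gt_1_iff)
    then have t: "t > ?\<rho>" using pos by (simp add: t_def)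
    then obtain N where N: "\<And>m. m \<ge> N \<Longrightarrow> max_norm k T m < t ^ m"
      using eventually_max_norm_less[OF k_pos t] unfolding eventually_sequentially by blast
    obtain w where w: "set w \<subseteq> {..<k}" "N \<le> length w" "length w \<le> N * L"
        "norm (word_prod T w *v x1) \<ge> 2 ^ N * ?\<rho> ^ length w" using grow[of N] by blast
    have "2 ^ N * ?\<rho> ^ length w \<le> max_norm k T (length w)"
      using w(4) norm_word_prod_le[of w k "length w" T x1] w(1) x1 by (auto simp: words_def)
    also have "\<dots> < t ^ length w" using N w(2) by blast
    also have "\<dots> = root L 2 ^ length w * ?\<rho> ^ length w" by (simp add: t_def power_mult_distrib)
    also have "\<dots> \<le> root L 2 ^ (N * L) * ?\<rho> ^ length w"
      using w(3) \<open>root L 2 > 1\<close> pos by (intro mult_right_mono power_increasing) auto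
    also have "root L 2 ^ (N * L) = 2 ^ N"
      using L by (simp add: power_mult[of _ L N, symmetric] mult.commute power_mult)
    finally show ?thesis by simp
  qed
qed

end

section \<open>Positive irreducible families\<close>

text \<open>\<open>d b\<close> represents the coordinate functional of the basis vector \<open>b\<close>.\<close>

locale positive_family = irreducible_family k T S
  for k and T :: "nat \<Rightarrow> real^'d^'d" and S +
  fixes B :: "(real^'d) set" and d :: "real^'d \<Rightarrow> real^'d"
  assumes fin_B: "finite B" and B_S: "B \<subseteq> S" and d_S: "\<And>b. d b \<in> S"
    and d_B: "\<And>b c. b \<in> B \<Longrightarrow> c \<in> B \<Longrightarrow> inner (d c) b = (if b = c then 1 else 0)"
    and expand: "\<And>x. x \<in> S \<Longrightarrow> (\<Sum>b\<in>B. inner (d b) x *\<^sub>R b) = x"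
    and nonneg: "\<And>i b c. i < k \<Longrightarrow> b \<in> B \<Longrightarrow> c \<in> B \<Longrightarrow> inner (d c) (T i *v b) \<ge> 0"
begin

abbreviation "T_sum \<equiv> \<Sum>i<k. T i"

definition pos_cone :: "(real^'d) set" where
  "pos_cone = {x \<in> S. \<forall>b\<in>B. inner (d b) x \<ge> 0}"

definition dual_cone :: "(real^'d) set" where
  "dual_cone = {z \<in> S. \<forall>b\<in>B. inner z b \<ge> 0}"

lemma B_nonempty: "B \<noteq> {}"
proof
  assume "B = {}"
  then have "S \<subseteq> {0}" using expand by auto
  then show False using S_nz subspace_0[OF subspace_S] by blast
qed

lemma inner_expand: "x \<in> S \<Longrightarrow> inner z x = (\<Sum>b\<in>B. inner (d b) x * inner z b)"
  by (subst (1) expand[symmetric]) (auto simp: inner_sum_right)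

lemma B_pos_cone: "b \<in> B \<Longrightarrow> b \<in> pos_cone"
  using B_S by (auto simp: pos_cone_def d_B)

lemma T_pos_cone:
  assumes "i < k" "x \<in> pos_cone"
  shows "T i *v x \<in> pos_cone"
proof -
  have x: "x \<in> S" "\<And>b. b \<in> B \<Longrightarrow> inner (d b) x \<ge> 0" using assms(2) by (auto simp: pos_cone_def)
  have "inner (d c) (T i *v x) \<ge> 0" if "c \<in> B" for c
  proof -
    have "T i *v x = (\<Sum>b\<in>B. inner (d b) x *\<^sub>R (T i *v b))"
      by (subst (1) expand[OF x(1), symmetric])
        (simp add: linear_sum[OF matrix_vector_mul_linear] matrix_vector_mult_scaleR)
    then show ?thesis
      using x(2) nonneg[OF assms(1) _ that] by (auto simp: inner_sum_right intro!: sum_nonneg)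
  qed
  then show ?thesis using T_in[OF assms(1)] by (auto simp: pos_cone_def)
qed

lemma dual_cone_pos_cone:
  assumes "z \<in> dual_cone" "x \<in> pos_cone"
  shows "inner z x \<ge> 0"
  using assms by (subst inner_expand) (auto simp: pos_cone_def dual_cone_def intro!: sum_nonneg)

text \<open>Rows are represented by vectors of S via the inner product; \<open>T_proj\<close> keeps
  them in S under right multiplication.\<close>

lemma transpose_T_in:
  assumes "i < k"
  shows "z v* T i \<in> S"
proof -
  have "inner (orth_proj S *v (z v* T i)) x = inner (z v* T i) x" for x
    unfolding orth_proj_self_adjoint[OF subspace_S] dot_lmul_matrix
    by (simp add: matrix_vector_mul_assoc T_proj[OF assms])
  then have "orth_proj S *v (z v* T i) = z v* T i"
    by (metis vector_eq_rdot)
  then show ?thesis using orth_proj_props(1)[OF subspace_S] by metis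
qed

lemma transpose_T_dual_cone:
  assumes "i < k" "z \<in> dual_cone"
  shows "z v* T i \<in> dual_cone"
proof -
  have "inner z (T i *v b) \<ge> 0" if "b \<in> B" for b
    by (rule dual_cone_pos_cone[OF assms(2) T_pos_cone[OF assms(1) B_pos_cone[OF that]]])
  then show ?thesis unfolding dual_cone_def mem_Collect_eq dot_lmul_matrix
    using transpose_T_in[OF assms(1)] by blast
qed

text \<open>The functional e. It vanishes on no nonzero vector of the cone, and it bounds the
  leading-digit row uniformly.\<close>

definition coord_sum :: "real^'d" where "coord_sum = (\<Sum>b\<in>B. d b)"

lemma coord_sum_in: "coord_sum \<in> S"
  unfolding coord_sum_def by (intro subspace_sum subspace_S d_S)

lemma coord_sum_B: "b \<in> B \<Longrightarrow> inner coord_sum b = 1"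
  by (simp add: coord_sum_def inner_sum_left d_B fin_B)

lemma coord_sum_dual_cone: "coord_sum \<in> dual_cone"
  by (simp add: dual_cone_def coord_sum_in coord_sum_B)

lemma inner_coord_sum: "inner coord_sum x = (\<Sum>b\<in>B. inner (d b) x)"
  by (simp add: coord_sum_def inner_sum_left)

lemma pos_cone_eq_0:
  assumes "x \<in> pos_cone" "inner coord_sum x = 0"
  shows "x = 0"
proof -
  have "\<forall>b\<in>B. inner (d b) x = 0"
    using assms fin_B unfolding inner_coord_sum by (subst (asm) sum_nonneg_eq_0_iff) (auto simp: pos_cone_def)
  moreover have "(\<Sum>b\<in>B. inner (d b) x *\<^sub>R b) = x" using assms(1) by (intro expand) (simp add: pos_cone_def)
  ultimately show ?thesis by simp
qed

lemma subspace_span_closed: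
  assumes "\<And>b. b \<in> C \<Longrightarrow> f b \<in> Real_Vector_Spaces.span C'" "linear f" "x \<in> Real_Vector_Spaces.span C"
  shows "f x \<in> Real_Vector_Spaces.span C'"
proof -
  have "f ` Real_Vector_Spaces.span C = Real_Vector_Spaces.span (f ` C)"
    using linear_span_image[OF assms(2)] by simp
  also have "\<dots> \<subseteq> Real_Vector_Spaces.span C'" by (rule span_minimal) (use assms(1) in auto)
  finally show ?thesis using assms(3) by blast
qed

theorem perron_vector:
  assumes "\<exists>x\<in>S. T_sum *v x \<noteq> 0"
  obtains y c where "y \<in> S" "c > 0" "T_sum *v y = c *\<^sub>R y" "\<And>b. b \<in> B \<Longrightarrow> inner (d b) y > 0"
proof -
  let ?D = "{x \<in> S. (\<forall>b\<in>B. inner (d b) x \<ge> 0) \<and> inner coord_sum x = 1}"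
  have T_sum_v: "T_sum *v x = (\<Sum>i<k. T i *v x)" for x by (simp add: matrix_sum_vector_mult)
  have T_sum_cone: "T_sum *v x \<in> pos_cone" if "x \<in> pos_cone" for x
    unfolding T_sum_v using T_pos_cone[OF _ that] subspace_sum[OF subspace_S, of "{..<k}"]
    by (auto simp: pos_cone_def inner_sum_right intro!: sum_nonneg)
  have D_cone: "x \<in> pos_cone" if "x \<in> ?D" for x using that by (simp add: pos_cone_def)
  \<comment> \<open>Needed to normalise the Brouwer map. If the sum of the T i killed e on x,
    positivity would give T i x = 0 for every i, the line through x would be invariant and hence all
    of S, and the sum would vanish on S.\<close>
  have nz: "inner coord_sum (T_sum *v x) > 0" if x: "x \<in> ?D" for x
  proof (rule ccontr)
    assume "\<not> inner coord_sum (T_sum *v x) > 0"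
    moreover have "inner coord_sum (T_sum *v x) \<ge> 0"
      by (intro dual_cone_pos_cone coord_sum_dual_cone T_sum_cone D_cone x)
    ultimately have "inner coord_sum (T_sum *v x) = 0" by linarith
    then have "(\<Sum>i<k. inner coord_sum (T i *v x)) = 0" by (simp add: T_sum_v inner_sum_right)
    moreover have "inner coord_sum (T i *v x) \<ge> 0" if "i \<in> {..<k}" for i
      by (rule dual_cone_pos_cone[OF coord_sum_dual_cone T_pos_cone[OF _ D_cone[OF x]]]) (use that in simp)
    ultimately have "inner coord_sum (T i *v x) = 0" if "i < k" for i
      using sum_nonneg_eq_0_iff[of "{..<k}" "\<lambda>i. inner coord_sum (T i *v x)"] that by simp
    then have T0: "T i *v x = 0" if "i < k" for i
      using that by (intro pos_cone_eq_0 T_pos_cone D_cone x) auto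
    have "Real_Vector_Spaces.span {x} = {0} \<or> Real_Vector_Spaces.span {x} = S"
    proof (rule invariant_trivial)
      show "Real_Vector_Spaces.span {x} \<subseteq> S" by (rule span_minimal) (use x subspace_S in auto)
      show "T i *v y \<in> Real_Vector_Spaces.span {x}" if "i < k" "y \<in> Real_Vector_Spaces.span {x}" for i y
        by (rule subspace_span_closed[OF _ matrix_vector_mul_linear that(2)]) (simp add: T0[OF that(1)] span_0)
    qed simp
    moreover have "x \<in> Real_Vector_Spaces.span {x}" by (simp add: span_base)
    moreover have "x \<noteq> 0" using x by auto
    ultimately have S: "Real_Vector_Spaces.span {x} = S" by auto
    have "T_sum *v y = 0" if "y \<in> S" for y
    proof -
      have "T_sum *v x = 0" by (simp add: T_sum_v T0)
      then have "T_sum *v y \<in> Real_Vector_Spaces.span {0}"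
        by (intro subspace_span_closed[OF _ matrix_vector_mul_linear that[folded S]]) (simp add: span_0)
      then show ?thesis by simp
    qed
    then show False using assms by blast
  qed
  have D_eq: "?D = S \<inter> (\<Inter>b\<in>B. {x. inner (d b) x \<ge> 0}) \<inter> {x. inner coord_sum x = 1}" by auto
  have "closed ?D"
    unfolding D_eq by (intro closed_Int closed_INT ballI closed_subspace subspace_S closed_halfspace_ge closed_hyperplane)
  moreover have "bounded ?D"
  proof (rule boundedI)
    fix x assume x: "x \<in> ?D"
    have "inner (d b) x \<le> 1" if "b \<in> B" for b
    proof -
      have "inner (d b) x \<le> (\<Sum>b\<in>B. inner (d b) x)" using that x fin_B by (intro member_le_sum) auto
      then show ?thesis using x by (simp add: inner_coord_sum)
    qed
    then have "norm (\<Sum>b\<in>B. inner (d b) x *\<^sub>R b) \<le> (\<Sum>b\<in>B. 1 * norm b)"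
      using x by (intro sum_norm_le) (auto intro: mult_left_le_one_le)
    then show "norm x \<le> (\<Sum>b\<in>B. 1 * norm b)" using expand x by simp
  qed
  ultimately have "compact ?D" by (simp add: compact_eq_bounded_closed)
  moreover have "convex ?D"
    unfolding D_eq by (intro convex_Int convex_INT subspace_imp_convex subspace_S convex_halfspace_ge convex_hyperplane)
  moreover have "?D \<noteq> {}"
  proof -
    obtain b where b: "b \<in> B" using B_nonempty by blast
    then have "b \<in> ?D" using B_S by (auto simp: d_B coord_sum_B)
    then show ?thesis by blast
  qed
  moreover have "continuous_on ?D (\<lambda>x. (1 / inner coord_sum (T_sum *v x)) *\<^sub>R (T_sum *v x))"
    by (intro continuous_intros ballI) (use nz in force)
  moreover have "(\<lambda>x. (1 / inner coord_sum (T_sum *v x)) *\<^sub>R (T_sum *v x)) \<in> ?D \<rightarrow> ?D"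
  proof
    fix x assume x: "x \<in> ?D"
    then show "(1 / inner coord_sum (T_sum *v x)) *\<^sub>R (T_sum *v x) \<in> ?D"
      using T_sum_cone[OF D_cone[OF x]] nz[OF x] subspace_scale[OF subspace_S]
      by (simp add: pos_cone_def)
  qed
  ultimately obtain y where y: "y \<in> ?D" "(1 / inner coord_sum (T_sum *v y)) *\<^sub>R (T_sum *v y) = y"
    by (rule brouwer)
  define c where "c = inner coord_sum (T_sum *v y)"
  have c: "c > 0" using nz[OF y(1)] by (simp add: c_def)
  have Ty: "T_sum *v y = c *\<^sub>R y"
    by (subst (2) y(2)[symmetric]) (use c in \<open>simp add: c_def[symmetric]\<close>)
  have yS: "y \<in> S" and y0: "\<And>b. b \<in> B \<Longrightarrow> inner (d b) y \<ge> 0" using y(1) by auto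
  \<comment> \<open>Strict positivity: the basis vectors in the support of y span an invariant
    nonzero subspace, hence S, so no coordinate functional can vanish on all of them.\<close>
  let ?P = "{b \<in> B. inner (d b) y > 0}"
  have Tb: "T i *v b \<in> Real_Vector_Spaces.span ?P" if i: "i < k" and b: "b \<in> ?P" for i b
  proof -
    \<comment> \<open>All terms are nonnegative, so a positive a-coordinate of T i b would show up
      in that of T_sum y = c y, which is 0 off the support.\<close>
    have "inner (d a) (T i *v b) = 0" if a: "a \<in> B" "a \<notin> ?P" for a
    proof -
      have "inner (d b) y * inner (d a) (T i *v b) \<le> inner (d a) (T i *v y)"
      proof -
        have "T i *v y = (\<Sum>b\<in>B. inner (d b) y *\<^sub>R (T i *v b))"
          by (subst (1) expand[OF yS, symmetric])
            (simp add: linear_sum[OF matrix_vector_mul_linear] matrix_vector_mult_scaleR)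
        then have "inner (d a) (T i *v y) = (\<Sum>b\<in>B. inner (d b) y * inner (d a) (T i *v b))"
          by (simp add: inner_sum_right)
        then show ?thesis
          using b by (simp only:) (rule member_le_sum[where f = "\<lambda>b. inner (d b) y * inner (d a) (T i *v b)"],
            use fin_B y0 nonneg[OF i _ a(1)] in auto)
      qed
      also have "inner (d a) (T i *v y) \<le> (\<Sum>j<k. inner (d a) (T j *v y))"
        using i T_pos_cone[OF _ D_cone[OF y(1)]] a(1)
        by (intro member_le_sum[where f = "\<lambda>j. inner (d a) (T j *v y)"]) (auto simp: pos_cone_def)
      also have "\<dots> = inner (d a) (T_sum *v y)" by (simp add: T_sum_v inner_sum_right)
      also have "\<dots> = 0" using Ty a y0[OF a(1)] by simp
      finally have "inner (d b) y * inner (d a) (T i *v b) \<le> 0" .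
      moreover have "inner (d a) (T i *v b) \<ge> 0" using nonneg[OF i _ a(1)] b by simp
      moreover have "inner (d b) y > 0" using b by simp
      ultimately show ?thesis by (simp add: mult_le_0_iff)
    qed
    then have "(\<Sum>a\<in>B. inner (d a) (T i *v b) *\<^sub>R a) \<in> Real_Vector_Spaces.span ?P"
    proof (intro span_sum)
      fix a assume a: "a \<in> B" and 0: "\<And>a. a \<in> B \<Longrightarrow> a \<notin> ?P \<Longrightarrow> inner (d a) (T i *v b) = 0"
      show "inner (d a) (T i *v b) *\<^sub>R a \<in> Real_Vector_Spaces.span ?P"
      proof (cases "a \<in> ?P")
        case True
        then show ?thesis by (intro span_scale span_base)
      next
        case False
        then show ?thesis using 0[OF a False] by (simp add: span_0)
      qed
    qed
    then show ?thesis using expand[OF T_in[OF i]] by simp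
  qed
  have "Real_Vector_Spaces.span ?P = {0} \<or> Real_Vector_Spaces.span ?P = S"
  proof (rule invariant_trivial)
    show "Real_Vector_Spaces.span ?P \<subseteq> S" by (rule span_minimal) (use B_S subspace_S in auto)
    show "T i *v x \<in> Real_Vector_Spaces.span ?P" if "i < k" "x \<in> Real_Vector_Spaces.span ?P" for i x
      by (rule subspace_span_closed[OF _ matrix_vector_mul_linear that(2)]) (rule Tb[OF that(1)])
  qed simp
  moreover have "y \<in> Real_Vector_Spaces.span ?P"
  proof -
    have "(\<Sum>b\<in>B. inner (d b) y *\<^sub>R b) \<in> Real_Vector_Spaces.span ?P"
    proof (intro span_sum)
      fix b assume b: "b \<in> B"
      show "inner (d b) y *\<^sub>R b \<in> Real_Vector_Spaces.span ?P"
      proof (cases "b \<in> ?P")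
        case True
        then show ?thesis by (intro span_scale span_base)
      next
        case False
        then show ?thesis using b y0[OF b] by (simp add: span_0)
      qed
    qed
    then show ?thesis using expand[OF yS] by simp
  qed
  moreover have "y \<noteq> 0" using y(1) by auto
  ultimately have spanP: "Real_Vector_Spaces.span ?P = S" by auto
  have "inner (d b) y > 0" if b: "b \<in> B" for b
  proof (rule ccontr)
    assume "\<not> inner (d b) y > 0"
    then have "inner (d b) a = 0" if "a \<in> ?P" for a using that b d_B[of a b] by auto
    then have "inner (d b) x = 0" if "x \<in> Real_Vector_Spaces.span ?P" for x
      using linear_eq_0_on_span[OF bounded_linear.linear[OF bounded_linear_inner_right] _ that] by blast
    then have "inner (d b) b = 0" using spanP B_S b by blast
    then show False using d_B[OF b b] by simp
  qed
  then show thesis by (rule that[OF yS c Ty])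
qed

end

text \<open>
  With \<open>z\<close> the row vector of a cylinder, \<open>affinity k T y \<rho> n z\<close> is the normalised sum of the
  square roots of the masses of its subcylinders of depth \<open>n\<close>.
\<close>

primrec affinity :: "nat \<Rightarrow> (nat \<Rightarrow> real^'d^'d) \<Rightarrow> real^'d \<Rightarrow> real \<Rightarrow> nat \<Rightarrow> real^'d \<Rightarrow> real" where
  "affinity k T y \<rho> 0 z = sqrt (inner z y)"
| "affinity k T y \<rho> (Suc n) z = (\<Sum>i<k. affinity k T y \<rho> n (z v* T i)) / sqrt (real k * \<rho>)"

lemma continuous_vector_matrix [continuous_intros]:
  "continuous_on X f \<Longrightarrow> continuous_on X (\<lambda>x. f x v* (M :: real^'n^'m))"
  unfolding vector_matrix_mult_def by (intro continuous_intros)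

lemma continuous_affinity: "continuous_on X (affinity k T y \<rho> n)"
proof -
  have "continuous_on X (\<lambda>x. affinity k T y \<rho> n (f x))" if "continuous_on X f" for f
    using that
  proof (induction n arbitrary: f)
    case 0
    then show ?case by (auto intro!: continuous_intros)
  next
    case (Suc n)
    show ?case unfolding affinity.simps divide_inverse
      by (intro continuous_intros Suc)
  qed
  from this[of "\<lambda>x. x"] show ?thesis by (simp add: continuous_on_id)
qed

lemma vector_matrix_scaleR: "(c *\<^sub>R z) v* M = c *\<^sub>R (z v* (M :: real^'n^'m))"
  by (simp add: vec_eq_iff vector_matrix_mult_def sum_distrib_left mult_ac)

lemma affinity_scale: "c \<ge> 0 \<Longrightarrow> affinity k T y \<rho> n (c *\<^sub>R z) = sqrt c * affinity k T y \<rho> n z"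
  by (induction n arbitrary: z)
    (simp_all add: real_sqrt_mult vector_matrix_scaleR sum_distrib_left)

section \<open>Contraction of the affinity\<close>

context positive_family
begin

context
  fixes y :: "real^'d" and c \<rho> :: real
  assumes y_S: "y \<in> S" and Ty: "T_sum *v y = c *\<^sub>R y" and y_pos: "\<And>b. b \<in> B \<Longrightarrow> inner (d b) y > 0"
    and \<rho>_pos: "\<rho> > 0" and c_le: "c \<le> \<rho>"
begin

lemma y_cone: "y \<in> pos_cone"
  using y_S y_pos by (auto simp: pos_cone_def intro: less_imp_le)

lemma dual_y_nonneg: "z \<in> dual_cone \<Longrightarrow> inner z y \<ge> 0"
  by (rule dual_cone_pos_cone[OF _ y_cone])

lemma sum_dual_y: "(\<Sum>i<k. inner (z v* T i) y) = c * inner z y"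
proof -
  have "(\<Sum>i<k. inner (z v* T i) y) = inner z (T_sum *v y)"
    by (simp add: dot_lmul_matrix inner_sum_right matrix_sum_vector_mult)
  then show ?thesis by (simp add: Ty)
qed

lemma affinity_nonneg: "z \<in> dual_cone \<Longrightarrow> affinity k T y \<rho> n z \<ge> 0"
  using \<rho>_pos k_pos
  by (induction n arbitrary: z) (auto intro!: divide_nonneg_nonneg sum_nonneg transpose_T_dual_cone dual_y_nonneg)

text \<open>Cauchy-Schwarz over the k children of a cylinder; their masses sum to c times the parent
  mass, and c <= \<rho> is absorbed by the normalisation sqrt (k \<rho>).\<close>

lemma affinity_Suc_0:
  assumes z: "z \<in> dual_cone"
  shows "affinity k T y \<rho> (Suc 0) z \<le> affinity k T y \<rho> 0 z"
proof -
  let ?s = "\<lambda>i. sqrt (inner (z v* T i) y)"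
  have z': "inner (z v* T i) y \<ge> 0" if "i < k" for i
    by (intro dual_y_nonneg transpose_T_dual_cone that z)
  have "(\<Sum>i<k. ?s i)\<^sup>2 \<le> (\<Sum>i<k. (?s i)\<^sup>2) * real (card {..<k})"
    by (rule sum_squared_le_sum_of_squares) 
  also have "(\<Sum>i<k. (?s i)\<^sup>2) = c * inner z y"
    unfolding sum_dual_y[symmetric] by (intro sum.cong) (auto simp: z')
  also have "c * inner z y * real (card {..<k}) \<le> \<rho> * inner z y * real k"
    using c_le dual_y_nonneg[OF z] by (simp add: mult_right_mono)
  finally have "(\<Sum>i<k. ?s i) \<le> sqrt (\<rho> * inner z y * real k)" by (rule real_le_rsqrt)
  then have "(\<Sum>i<k. ?s i) \<le> sqrt (real k * \<rho>) * sqrt (inner z y)"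
    by (simp add: real_sqrt_mult mult_ac)
  then show ?thesis using k_pos \<rho>_pos by (simp add: divide_le_eq mult.commute)
qed

lemma affinity_decreasing:
  "z \<in> dual_cone \<Longrightarrow> affinity k T y \<rho> (Suc n) z \<le> affinity k T y \<rho> n z"
proof (induction n arbitrary: z)
  case 0
  then show ?case by (rule affinity_Suc_0)
next
  case (Suc n)
  have "affinity k T y \<rho> (Suc (Suc n)) z = (\<Sum>i<k. affinity k T y \<rho> (Suc n) (z v* T i)) / sqrt (real k * \<rho>)"
    by (rule affinity.simps)
  also have "\<dots> \<le> (\<Sum>i<k. affinity k T y \<rho> n (z v* T i)) / sqrt (real k * \<rho>)"
    using \<rho>_pos by (intro divide_right_mono sum_mono Suc.IH transpose_T_dual_cone Suc.prems) auto
  finally show ?case by simp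
qed

lemma affinity_antimono:
  assumes "z \<in> dual_cone" "m \<le> n"
  shows "affinity k T y \<rho> n z \<le> affinity k T y \<rho> m z"
  using assms(2)
proof (induction rule: dec_induct)
  case (step n)
  then show ?case by (intro order_trans[OF affinity_decreasing[OF assms(1)]])
qed simp

text \<open>The equality case of Cauchy-Schwarz: all children carry the same value. Constancy passes
  to each child because the affinities of the children can only decrease while their sum stays
  fixed.\<close>

lemma affinity_constant_step:
  assumes z: "z \<in> dual_cone" and const: "\<And>n. affinity k T y \<rho> n z = affinity k T y \<rho> 0 z"
    and i: "i < k"
  shows "inner (z v* T i) y = \<rho> / real k * inner z y"
    and "affinity k T y \<rho> n (z v* T i) = affinity k T y \<rho> 0 (z v* T i)"
proof -
  let ?s = "\<lambda>i. sqrt (inner (z v* T i) y)" and ?t = "sqrt (inner z y)"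
  \<comment> \<open>The common value that the square roots must take in the equality case.\<close>
  define \<sigma> where "\<sigma> = sqrt (\<rho> / real k) * ?t"
  have z': "inner (z v* T j) y \<ge> 0" if "j < k" for j
    by (intro dual_y_nonneg transpose_T_dual_cone that z)
  have kr: "sqrt (real k * \<rho>) > 0" using k_pos \<rho>_pos by simp
  have sum_s: "(\<Sum>j<k. ?s j) = sqrt (real k * \<rho>) * ?t"
  proof -
    have "(\<Sum>j<k. ?s j) = sqrt (real k * \<rho>) * ((\<Sum>j<k. ?s j) / sqrt (real k * \<rho>))"
      using k_pos \<rho>_pos by simp
    also have "(\<Sum>j<k. ?s j) / sqrt (real k * \<rho>) = ?t"
      using const[of "Suc 0"] by (simp only: affinity.simps)
    finally show ?thesis .
  qed
  have sq: "(\<Sum>j<k. (?s j)\<^sup>2) \<le> \<rho> * ?t\<^sup>2"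
  proof -
    have "(\<Sum>j<k. (?s j)\<^sup>2) = c * inner z y"
      unfolding sum_dual_y[symmetric] by (intro sum.cong) (auto simp: z')
    then show ?thesis using c_le dual_y_nonneg[OF z] by (simp add: mult_right_mono)
  qed
  have kk: "sqrt (\<rho> / real k) * sqrt (real k * \<rho>) = \<rho>"
    using \<rho>_pos k_pos by (simp add: real_sqrt_mult[symmetric])
  \<comment> \<open>After expansion the bound is \<rho> t^2 - 2 \<rho> t^2 + \<rho> t^2 = 0 with t^2
    = z y.\<close>
  have "(\<Sum>j<k. (?s j - \<sigma>)\<^sup>2) = (\<Sum>j<k. (?s j)\<^sup>2) - 2 * \<sigma> * (\<Sum>j<k. ?s j) + real k * \<sigma>\<^sup>2"
    by (simp add: power2_diff sum.distrib sum_subtractf sum_distrib_left mult_ac)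
  also have "\<dots> \<le> \<rho> * ?t\<^sup>2 - 2 * \<sigma> * (sqrt (real k * \<rho>) * ?t) + real k * \<sigma>\<^sup>2"
    using sq sum_s by simp
  also have "2 * \<sigma> * (sqrt (real k * \<rho>) * ?t) = 2 * (sqrt (\<rho> / real k) * sqrt (real k * \<rho>)) * ?t\<^sup>2"
    by (simp add: \<sigma>_def power2_eq_square)
  also have "real k * \<sigma>\<^sup>2 = \<rho> * ?t\<^sup>2"
    using \<rho>_pos k_pos by (simp add: \<sigma>_def power_mult_distrib)
  finally have "(\<Sum>j<k. (?s j - \<sigma>)\<^sup>2) \<le> 0" unfolding kk by simp
  moreover have "(?s i - \<sigma>)\<^sup>2 \<le> (\<Sum>j<k. (?s j - \<sigma>)\<^sup>2)"
    using i by (intro member_le_sum) auto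
  ultimately have "(?s i - \<sigma>)\<^sup>2 \<le> 0" by linarith
  then have "?s i = \<sigma>" by simp
  then have "(?s i)\<^sup>2 = \<sigma>\<^sup>2" by simp
  then show "inner (z v* T i) y = \<rho> / real k * inner z y"
    using z'[OF i] dual_y_nonneg[OF z] \<rho>_pos by (simp add: \<sigma>_def power_mult_distrib)
  have "affinity k T y \<rho> (Suc n) z = affinity k T y \<rho> (Suc 0) z" using const by metis
  then have eq: "(\<Sum>j<k. affinity k T y \<rho> n (z v* T j)) = (\<Sum>j<k. affinity k T y \<rho> 0 (z v* T j))"
    using k_pos \<rho>_pos by simp
  have le: "affinity k T y \<rho> n (z v* T j) \<le> affinity k T y \<rho> 0 (z v* T j)" if "j < k" for j
    by (intro affinity_antimono transpose_T_dual_cone that z) auto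
  show "affinity k T y \<rho> n (z v* T i) = affinity k T y \<rho> 0 (z v* T i)"
  proof (rule ccontr)
    assume "affinity k T y \<rho> n (z v* T i) \<noteq> affinity k T y \<rho> 0 (z v* T i)"
    then have "affinity k T y \<rho> n (z v* T i) < affinity k T y \<rho> 0 (z v* T i)" using le[OF i] by simp
    then have "(\<Sum>j<k. affinity k T y \<rho> n (z v* T j)) < (\<Sum>j<k. affinity k T y \<rho> 0 (z v* T j))"
      using i le by (intro sum_strict_mono_ex1) auto
    then show False using eq by simp
  qed
qed

lemma affinity_constant_words:
  assumes "z \<in> dual_cone" "\<And>n. affinity k T y \<rho> n z = affinity k T y \<rho> 0 z" "set w \<subseteq> {..<k}"
  shows "inner z (word_prod T w *v y) = (\<rho> / real k) ^ length w * inner z y"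
  using assms
proof (induction w arbitrary: z)
  case (Cons i w)
  have i: "i < k" using Cons.prems by simp
  have "inner z (word_prod T (i # w) *v y) = inner (z v* T i) (word_prod T w *v y)"
    by (simp add: word_prod_Cons dot_lmul_matrix matrix_vector_mul_assoc)
  also have "\<dots> = (\<rho> / real k) ^ length w * inner (z v* T i) y"
    by (rule Cons.IH) (use Cons.prems i affinity_constant_step(2)[OF Cons.prems(1,2)] in \<open>auto intro: transpose_T_dual_cone\<close>)
  also have "\<dots> = (\<rho> / real k) ^ length (i # w) * inner z y"
    by (simp add: affinity_constant_step(1)[OF Cons.prems(1,2) i])
  finally show ?case .
qed simp

text \<open>Strict positivity of y lets each coordinate of x be bounded by a multiple of that of y;
  as z is nonnegative on the basis, z y then controls z as a functional on S.\<close>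

lemma abs_inner_le_dual_y:
  obtains C where "\<And>z x. z \<in> dual_cone \<Longrightarrow> x \<in> S \<Longrightarrow> \<bar>inner z x\<bar> \<le> C * norm x * inner z y" "C \<ge> 0"
proof -
  define C where "C = (\<Sum>b\<in>B. norm (d b) / inner (d b) y)"
  have C: "norm (d b) \<le> C * inner (d b) y" if "b \<in> B" for b
  proof -
    have "norm (d b) / inner (d b) y \<le> C"
      unfolding C_def using fin_B that y_pos by (intro member_le_sum) (auto intro: divide_nonneg_pos)
    then show ?thesis using y_pos[OF that] by (simp add: divide_le_eq)
  qed
  have "\<bar>inner z x\<bar> \<le> C * norm x * inner z y" if z: "z \<in> dual_cone" and x: "x \<in> S" for z x
  proof -
    have "\<bar>inner z x\<bar> \<le> (\<Sum>b\<in>B. \<bar>inner (d b) x * inner z b\<bar>)"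
      unfolding inner_expand[OF x, of z] by (rule sum_abs)
    also have "\<dots> \<le> (\<Sum>b\<in>B. C * norm x * (inner (d b) y * inner z b))"
    proof (rule sum_mono)
      fix b assume b: "b \<in> B"
      have zb: "inner z b \<ge> 0" using z b by (auto simp: dual_cone_def)
      have "\<bar>inner (d b) x\<bar> \<le> norm (d b) * norm x" by (rule Cauchy_Schwarz_ineq2)
      also have "\<dots> \<le> C * inner (d b) y * norm x" using C[OF b] by (intro mult_right_mono) auto
      finally have "\<bar>inner (d b) x\<bar> * inner z b \<le> C * inner (d b) y * norm x * inner z b"
        using zb by (rule mult_right_mono)
      then show "\<bar>inner (d b) x * inner z b\<bar> \<le> C * norm x * (inner (d b) y * inner z b)"
        using zb by (simp add: abs_mult mult_ac)
    qed
    also have "\<dots> = C * norm x * inner z y"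
      by (simp add: inner_expand[OF y_S, of z] sum_distrib_left)
    finally show ?thesis .
  qed
  moreover have "C \<ge> 0" unfolding C_def using y_pos by (intro sum_nonneg) (auto intro: divide_nonneg_pos)
  ultimately show thesis by (rule that)
qed

text \<open>
  A row vector with constant affinity has bounded orbit, and its orbit separates points by
  irreducibility, so that all products are bounded.
\<close>

lemma affinity_not_constant:
  assumes z: "z \<in> dual_cone" and const: "\<And>n. affinity k T y \<rho> n z = affinity k T y \<rho> 0 z"
    and zy: "inner z y > 0"
  shows "joint_spectral_radius k T \<le> \<rho> / real k"
proof -
  let ?r = "\<rho> / real k"
  have r: "?r > 0" using \<rho>_pos k_pos by simp
  obtain C where C: "\<And>z x. z \<in> dual_cone \<Longrightarrow> x \<in> S \<Longrightarrow> \<bar>inner z x\<bar> \<le> C * norm x * inner z y" "C \<ge> 0"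
    by (rule abs_inner_le_dual_y) (rule that)
  have dual_word: "z v* word_prod T w \<in> dual_cone" if "set w \<subseteq> {..<k}" for w
    using that z
  proof (induction w arbitrary: z)
    case (Cons i w)
    have "z v* word_prod T (i # w) = (z v* T i) v* word_prod T w"
      by (simp add: word_prod_Cons vector_matrix_mul_assoc)
    then show ?case using Cons by (auto intro: transpose_T_dual_cone)
  qed simp
  have bound: "\<bar>inner z (word_prod T w *v x)\<bar> \<le> C * inner z y * ?r ^ length w * norm x"
    if "set w \<subseteq> {..<k}" "x \<in> S" for w x
  proof -
    have "\<bar>inner z (word_prod T w *v x)\<bar> \<le> C * norm x * inner z (word_prod T w *v y)"
      using C(1)[OF dual_word[OF that(1)] that(2)] by (simp add: dot_lmul_matrix)
    then show ?thesis using affinity_constant_words[OF z const that(1)] by (simp add: mult_ac)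
  qed
  \<comment> \<open>The vectors that the orbit of z does not see. They form an invariant subspace
    missing y, by the empty word, so only 0 remains.\<close>
  let ?W = "{x \<in> S. \<forall>w. set w \<subseteq> {..<k} \<longrightarrow> inner z (word_prod T w *v x) = 0}"
  have "Real_Vector_Spaces.subspace ?W"
    using subspace_S by (auto simp: real_vector.subspace_def matrix_vector_right_distrib inner_add_right
        matrix_vector_mult_scaleR)
  moreover have "T i *v x \<in> ?W" if "i < k" "x \<in> ?W" for i x
  proof -
    have "inner z (word_prod T w *v (T i *v x)) = 0" if "set w \<subseteq> {..<k}" for w
    proof -
      have "set (w @ [i]) \<subseteq> {..<k}" using that \<open>i < k\<close> by simp
      then have "inner z (word_prod T (w @ [i]) *v x) = 0"
        using \<open>x \<in> ?W\<close>[THEN CollectD, THEN conjunct2, THEN spec, of "w @ [i]"] by (rule rev_mp)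
      then show ?thesis by (simp add: word_prod_append word_prod_Cons matrix_vector_mul_assoc)
    qed
    then show ?thesis using T_in[OF \<open>i < k\<close>] by blast
  qed
  ultimately have "?W = {0} \<or> ?W = S" by (intro invariant_trivial) auto
  moreover have "y \<notin> ?W"
  proof
    assume "y \<in> ?W"
    then have "\<forall>w. set w \<subseteq> {..<k} \<longrightarrow> inner z (word_prod T w *v y) = 0" unfolding mem_Collect_eq by (rule conjunct2)
    from spec[OF this, of "[]"] have "inner z (word_prod T [] *v y) = 0" by simp
    then show False using zy by simp
  qed
  ultimately have W: "?W = {0}" using y_S by blast
  let ?U = "{x \<in> S. norm x = 1}"
  let ?O = "\<lambda>w. {x. inner z (word_prod T w *v x) \<noteq> 0}"
  have cover: "?U \<subseteq> \<Union> (?O ` {w. set w \<subseteq> {..<k}})"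
  proof
    fix x assume x: "x \<in> ?U"
    then have "x \<notin> ?W" "x \<in> S" unfolding W by auto
    then have "\<not> (\<forall>w. set w \<subseteq> {..<k} \<longrightarrow> inner z (word_prod T w *v x) = 0)"
      unfolding mem_Collect_eq by blast
    then obtain w where "set w \<subseteq> {..<k}" "inner z (word_prod T w *v x) \<noteq> 0"
      unfolding not_all not_imp by (elim exE conjE)
    then show "x \<in> \<Union> (?O ` {w. set w \<subseteq> {..<k}})" by (intro UN_I[of w] CollectI)
  qed
  have "open (?O w)" for w
    by (intro open_Collect_neq continuous_intros)
  then obtain F where F: "F \<subseteq> {w. set w \<subseteq> {..<k}}" "finite F" "?U \<subseteq> \<Union> (?O ` F)"
    by (rule compactE_image[OF compact_unit_sphere _ cover])
  \<comment> \<open>Finitely many words already separate the unit sphere, so this seminorm is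
    bounded below there by some positive \<open>\<delta>\<close>.\<close>
  let ?N = "\<lambda>x. \<Sum>w\<in>F. \<bar>inner z (word_prod T w *v x)\<bar>"
  have "\<exists>x\<in>?U. \<forall>x'\<in>?U. ?N x \<le> ?N x'"
  proof (rule continuous_attains_inf[OF compact_unit_sphere])
    have "(1 / norm y) *\<^sub>R y \<in> ?U" using y_S zy subspace_scale[OF subspace_S] by auto
    then show "?U \<noteq> {}" by blast
    show "continuous_on ?U ?N" by (intro continuous_intros)
  qed
  then obtain x0 where x0: "x0 \<in> ?U" "\<And>x. x \<in> ?U \<Longrightarrow> ?N x0 \<le> ?N x" by blast
  define \<delta> where "\<delta> = ?N x0"
  have \<delta>: "\<delta> > 0"
  proof -
    obtain w where w: "w \<in> F" "inner z (word_prod T w *v x0) \<noteq> 0" using F(3) x0(1) by blast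
    have "0 < \<bar>inner z (word_prod T w *v x0)\<bar>" using w by simp
    also have "\<dots> \<le> ?N x0" using w(1) F(2) by (intro member_le_sum) auto
    finally show ?thesis by (simp add: \<delta>_def)
  qed
  have norm_le: "\<delta> * norm x \<le> ?N x" if x: "x \<in> S" for x
  proof (cases "x = 0")
    case False
    then have "(1 / norm x) *\<^sub>R x \<in> ?U" using x subspace_scale[OF subspace_S] by simp
    then have "\<delta> \<le> ?N ((1 / norm x) *\<^sub>R x)" unfolding \<delta>_def by (rule x0(2))
    also have "\<dots> = ?N x / norm x"
      by (simp add: matrix_vector_mult_scaleR abs_mult sum_divide_distrib)
    finally show ?thesis using False by (simp add: le_divide_eq)
  qed simp
  \<comment> \<open>Collects the orbit bounds for the words \<open>w @ v\<close> with w in the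
    finite test set F; the part depending on v factors out.\<close>
  define D where "D = (\<Sum>w\<in>F. C * inner z y * ?r ^ length w) / \<delta>"
  have prod_bound: "norm (word_prod T v *v x) \<le> D * ?r ^ length v * norm x" if v: "set v \<subseteq> {..<k}" and x: "x \<in> S" for v x
  proof -
    have "\<delta> * norm (word_prod T v *v x) \<le> ?N (word_prod T v *v x)"
      by (intro norm_le word_prod_in v x)
    also have "\<dots> \<le> (\<Sum>w\<in>F. C * inner z y * ?r ^ length w * (?r ^ length v * norm x))"
    proof (rule sum_mono)
      fix w assume "w \<in> F"
      then have "set (w @ v) \<subseteq> {..<k}" using F(1) v by auto
      from bound[OF this x] show "\<bar>inner z (word_prod T w *v (word_prod T v *v x))\<bar> \<le> C * inner z y * ?r ^ length w * (?r ^ length v * norm x)"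
        by (simp add: word_prod_append matrix_vector_mul_assoc power_add mult_ac)
    qed
    also have "\<dots> = \<delta> * (D * ?r ^ length v * norm x)"
      using \<delta> by (simp add: D_def sum_distrib_right mult.assoc)
    finally show ?thesis using \<delta> by simp
  qed
  have P1: "norm (orth_proj S *v x) \<le> norm x" for x
  proof -
    have "(norm (orth_proj S *v x))\<^sup>2 = inner x (orth_proj S *v x)"
      by (simp add: power2_norm_eq_inner orth_proj_self_adjoint[OF subspace_S] orth_proj_ident[OF subspace_S orth_proj_props(1)[OF subspace_S]])
    also have "\<dots> \<le> norm x * norm (orth_proj S *v x)" by (rule norm_cauchy_schwarz)
    finally show ?thesis by (cases "orth_proj S *v x = 0") (auto simp: power2_eq_square mult_le_cancel_right)
  qed
  have D: "D \<ge> 0"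
    unfolding D_def using C(2) zy r \<delta> by (auto intro!: divide_nonneg_pos sum_nonneg)
  \<comment> \<open>The operator norm ranges over all vectors, whereas the bounds hold on S. The
    last letter of a nonempty word inserts the projection onto S, hence the restriction to n > 0
    below.\<close>
  have proj: "word_prod T w *v x = word_prod T w *v (orth_proj S *v x)" if "set w \<subseteq> {..<k}" "w \<noteq> []" for w x
  proof -
    obtain w' i where w: "w = w' @ [i]" using \<open>w \<noteq> []\<close> by (metis rev_exhaust)
    then have "T i ** orth_proj S = T i" using that by (intro T_proj) auto
    then show ?thesis
      by (simp add: w word_prod_append word_prod_Cons matrix_vector_mul_assoc matrix_mul_assoc[symmetric])
  qed
  show ?thesis
  proof (rule joint_spectral_radius_le[OF k_pos])
    show "max_norm k T n \<le> D * ?r ^ n" if "n > 0" for n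
    proof (rule max_norm_le[OF k_pos])
      fix w x assume "w \<in> words k n"
      then have w: "set w \<subseteq> {..<k}" "length w = n" by (auto simp: words_def)
      then have "w \<noteq> []" using that by auto
      then have "norm (word_prod T w *v x) \<le> D * ?r ^ n * norm (orth_proj S *v x)"
        using prod_bound[OF w(1) orth_proj_props(1)[OF subspace_S], of x]
        by (subst proj[OF w(1) \<open>w \<noteq> []\<close>]) (simp add: w(2))
      also have "\<dots> \<le> D * ?r ^ n * norm x" using D r P1 by (intro mult_left_mono) auto
      finally show "norm (word_prod T w *v x) \<le> D * ?r ^ n * norm x" .
    qed
  qed (use r in simp)
qed

text \<open>A Dini argument on the compact slice z y = 1: the decreasing continuous affinities drop
  below 1 uniformly at some level, which yields a contraction factor that can be iterated.\<close>

theorem affinity_tendsto_0: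
  assumes jsr: "\<rho> / real k < joint_spectral_radius k T" and z: "z \<in> dual_cone"
  shows "(\<lambda>n. affinity k T y \<rho> n z) \<longlonglongrightarrow> 0"
proof -
  let ?Z = "{z \<in> dual_cone. inner z y = 1}"
  have compact_Z: "compact ?Z"
  proof -
    have "?Z = S \<inter> (\<Inter>b\<in>B. {z. 0 \<le> inner z b}) \<inter> {z. inner z y = 1}"
      by (auto simp: dual_cone_def)
    moreover have "closed (S \<inter> (\<Inter>b\<in>B. {z. 0 \<le> inner z b}) \<inter> {z. inner z y = 1})"
      by (intro closed_Int closed_INT ballI closed_subspace subspace_S closed_Collect_le closed_Collect_eq continuous_intros)
    ultimately have "closed ?Z" by simp
    moreover obtain C where C: "\<And>z x. z \<in> dual_cone \<Longrightarrow> x \<in> S \<Longrightarrow> \<bar>inner z x\<bar> \<le> C * norm x * inner z y" "C \<ge> 0"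
      by (rule abs_inner_le_dual_y) (rule that)
    have "bounded ?Z"
    proof (rule boundedI)
      fix z assume "z \<in> ?Z"
      then have z: "z \<in> dual_cone" "z \<in> S" "inner z y = 1" by (simp_all add: dual_cone_def)
      have "\<bar>inner z z\<bar> \<le> C * norm z * 1" using C(1)[OF z(1,2)] z(3) by simp
      then show "norm z \<le> C" using C(2)
        by (cases "z = 0") (auto simp: power2_norm_eq_inner[symmetric] power2_eq_square)
    qed
    ultimately show ?thesis by (simp add: compact_eq_bounded_closed)
  qed
  have "\<exists>l. \<forall>z\<in>?Z. affinity k T y \<rho> l z < 1"
  proof (rule ccontr)
    assume neg: "\<not> (\<exists>l. \<forall>z\<in>?Z. affinity k T y \<rho> l z < 1)"
    \<comment> \<open>If no level works, these nested compact sets have a common point, a row whose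
      affinity is constant; this is excluded by the gap between \<rho> / k and the joint spectral
      radius.\<close>
    let ?F = "\<lambda>l. ?Z \<inter> {z. 1 \<le> affinity k T y \<rho> l z}"
    have "\<Inter> (range ?F) \<noteq> {}"
    proof (rule compact_nest)
      show "compact (?F l)" for l
        by (intro compact_Int_closed compact_Z closed_Collect_le continuous_intros continuous_affinity)
      show "?F l \<noteq> {}" for l
      proof -
        obtain z where "z \<in> ?Z" "1 \<le> affinity k T y \<rho> l z" using neg by (meson not_less)
        then show ?thesis by blast
      qed
      show "?F n \<subseteq> ?F m" if "m \<le> n" for m n
        using affinity_antimono[OF _ that] by (auto intro: order_trans)
    qed
    then obtain z where z: "z \<in> ?Z" "\<And>l. 1 \<le> affinity k T y \<rho> l z" by blast
    have "affinity k T y \<rho> n z = affinity k T y \<rho> 0 z" for n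
      using affinity_antimono[of z 0 n] z(1) z(2)[of n] by simp
    from affinity_not_constant[OF _ this] z(1) jsr show False by simp
  qed
  then obtain l where l: "\<And>z. z \<in> ?Z \<Longrightarrow> affinity k T y \<rho> l z < 1" by blast
  have "\<exists>\<delta><1. \<delta> \<ge> 0 \<and> (\<forall>z\<in>?Z. affinity k T y \<rho> l z \<le> \<delta>)"
  proof (cases "?Z = {}")
    case True
    then show ?thesis by (intro exI[of _ 0]) auto
  next
    case False
    from continuous_attains_sup[OF compact_Z False continuous_affinity[of _ k T y \<rho> l]]
    obtain z0 where z0: "z0 \<in> ?Z" "\<forall>z\<in>?Z. affinity k T y \<rho> l z \<le> affinity k T y \<rho> l z0"
      by (elim bexE)
    show ?thesis
    proof (intro exI conjI)
      show "affinity k T y \<rho> l z0 < 1" by (rule l[OF z0(1)])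
      show "affinity k T y \<rho> l z0 \<ge> 0" using z0(1) by (intro affinity_nonneg) simp
    qed (rule z0(2))
  qed
  then obtain \<delta> where \<delta>: "\<delta> < 1" "\<delta> \<ge> 0" "\<And>z. z \<in> ?Z \<Longrightarrow> affinity k T y \<rho> l z \<le> \<delta>" by blast
  \<comment> \<open>The affinity is homogeneous of degree 1/2 in z, so the bound on the slice
    extends to the whole dual cone.\<close>
  have contract: "affinity k T y \<rho> l z \<le> \<delta> * affinity k T y \<rho> 0 z" if z: "z \<in> dual_cone" for z
  proof (cases "inner z y = 0")
    case True
    then show ?thesis using affinity_antimono[OF z, of 0 l] by simp
  next
    case False
    let ?t = "inner z y"
    have t: "?t > 0" using False dual_y_nonneg[OF z] by simp
    have "(1 / ?t) *\<^sub>R z \<in> ?Z" using t z by (auto simp: dual_cone_def subspace_scale[OF subspace_S])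
    then have "affinity k T y \<rho> l ((1 / ?t) *\<^sub>R z) \<le> \<delta>" by (rule \<delta>(3))
    then show ?thesis using t by (simp add: affinity_scale real_sqrt_divide divide_le_eq)
  qed
  have contract': "affinity k T y \<rho> (n + l) z \<le> \<delta> * affinity k T y \<rho> n z" if "z \<in> dual_cone" for n z
    using that
  proof (induction n arbitrary: z)
    case 0
    then show ?case using contract by simp
  next
    case (Suc n)
    have "(\<Sum>i<k. affinity k T y \<rho> (n + l) (z v* T i)) \<le> (\<Sum>i<k. \<delta> * affinity k T y \<rho> n (z v* T i))"
      by (intro sum_mono Suc.IH transpose_T_dual_cone Suc.prems) auto
    then have "(\<Sum>i<k. affinity k T y \<rho> (n + l) (z v* T i)) / sqrt (real k * \<rho>) \<le>
        (\<Sum>i<k. \<delta> * affinity k T y \<rho> n (z v* T i)) / sqrt (real k * \<rho>)"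
      using \<rho>_pos by (intro divide_right_mono) auto
    then show ?case by (simp add: sum_distrib_left)
  qed
  have iter: "affinity k T y \<rho> (m * l) z \<le> \<delta> ^ m * affinity k T y \<rho> 0 z" for m
  proof (induction m)
    case (Suc m)
    have "affinity k T y \<rho> (Suc m * l) z \<le> \<delta> * affinity k T y \<rho> (m * l) z"
      using contract'[OF z, of "m * l"] by (simp add: add.commute)
    also have "\<dots> \<le> \<delta> * (\<delta> ^ m * affinity k T y \<rho> 0 z)" using Suc \<delta>(2) by (rule mult_left_mono)
    finally show ?case by (simp add: mult.assoc)
  qed simp
  show ?thesis
  proof (rule LIMSEQ_I)
    fix e :: real assume e: "e > 0"
    have "(\<lambda>m. \<delta> ^ m * affinity k T y \<rho> 0 z) \<longlonglongrightarrow> 0 * affinity k T y \<rho> 0 z"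
      by (intro tendsto_intros LIMSEQ_realpow_zero \<delta>)
    then have "\<forall>\<^sub>F m in sequentially. \<delta> ^ m * affinity k T y \<rho> 0 z < e"
      using e by (intro order_tendstoD(2)) auto
    then obtain m where m: "\<delta> ^ m * affinity k T y \<rho> 0 z < e"
      by (auto dest: eventually_happens'[OF sequentially_bot])
    have "affinity k T y \<rho> n z < e" if "n \<ge> m * l" for n
      using affinity_antimono[OF z that] iter[of m] m by linarith
    then show "\<exists>N. \<forall>n\<ge>N. norm (affinity k T y \<rho> n z - 0) < e"
      using affinity_nonneg[OF z] by (intro exI[of _ "m * l"]) auto
  qed
qed

end

end

section \<open>Measures on the torus and cylinders\<close>

text \<open>With K = k^L (k - 1) and j < K these are the images of the integers whose first L + 1
  base-k digits form the number k^L + j.\<close>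

definition cyl :: "nat \<Rightarrow> nat \<Rightarrow> real set" where
  "cyl K j = {real j / real K..<real (Suc j) / real K}"

lemma cyl_borel [measurable, simp]: "cyl K j \<in> sets borel"
  by (simp add: cyl_def)

lemma mem_cyl_iff:
  assumes "K > 0"
  shows "x \<in> cyl K j \<longleftrightarrow> \<lfloor>x * real K\<rfloor> = int j"
  using assms by (simp add: cyl_def floor_eq_iff field_simps)

lemma cyl_cover:
  assumes "K > 0" "x \<in> {0..<1}"
  obtains j where "j < K" "x \<in> cyl K j"
proof -
  have "0 \<le> x * real K" "x * real K < real K" using assms by auto
  then have "nat \<lfloor>x * real K\<rfloor> < K" "int (nat \<lfloor>x * real K\<rfloor>) = \<lfloor>x * real K\<rfloor>"
    by (simp_all add: floor_less_iff nat_less_iff)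
  then show thesis using that mem_cyl_iff[OF assms(1)] by metis
qed

lemma cyl_disjoint: "K > 0 \<Longrightarrow> disjoint_family_on (cyl K) J"
  by (auto simp: disjoint_family_on_def mem_cyl_iff)

lemma cyl_subset: "j < K \<Longrightarrow> cyl K j \<subseteq> {0..<1}"
  by (auto simp: cyl_def divide_le_eq field_simps intro: order_trans[rotated])

lemma sets_torus_borel: "X \<in> sets torus_borel \<longleftrightarrow> X \<subseteq> {0..<1} \<and> X \<in> sets borel"
  by (auto simp: torus_borel_def sets_restrict_space_iff)

lemma space_torus_borel: "space torus_borel = {0..<1}"
  by (simp add: torus_borel_def space_restrict_space)

lemma null_sets_torus_lebesgue: "X \<in> null_sets torus_lebesgue \<longleftrightarrow> X \<subseteq> {0..<1} \<and> X \<in> null_sets lborel"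
  by (simp add: torus_lebesgue_def null_sets_restrict_space)

lemma cyl_torus: "j < K \<Longrightarrow> cyl K j \<in> sets torus_borel"
  by (simp add: sets_torus_borel cyl_subset)

lemma measure_lborel_cyl: "K > 0 \<Longrightarrow> Sigma_Algebra.measure lborel (cyl K j) = 1 / real K"
  by (simp add: cyl_def divide_right_mono diff_divide_distrib[symmetric])

lemma emeasure_lborel_cyl_less: "emeasure lborel (cyl K j) < \<top>"
proof -
  have "cyl K j \<subseteq> {real j / real K..real (Suc j) / real K}" unfolding cyl_def by (rule atLeastLessThan_subseteq_atLeastAtMost_iff[THEN iffD2]) simp
  then show ?thesis
    using emeasure_bounded_finite[OF bounded_subset[OF bounded_closed_interval]] by (simp add: infinity_ennreal_def)
qed

lemma measure_UN_cyl:
  assumes "K > 0" "finite J" "\<And>j. j \<in> J \<Longrightarrow> cyl K j \<in> sets M" "\<And>j. j \<in> J \<Longrightarrow> emeasure M (cyl K j) < \<top>"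
  shows "Sigma_Algebra.measure M (\<Union>j\<in>J. cyl K j) = (\<Sum>j\<in>J. Sigma_Algebra.measure M (cyl K j))"
  using assms by (intro measure_finite_Union cyl_disjoint) (auto simp: top.not_eq_extremum)

text \<open>A compact Lebesgue null set is covered by short cylinders inside an open neighbourhood
  of small measure; inner regularity then passes to arbitrary Borel null sets.\<close>

lemma absolutely_continuous_of_cylinders:
  fixes \<nu> :: "real measure" and K :: "nat \<Rightarrow> nat"
  assumes fin: "finite_measure \<nu>" and sets: "sets \<nu> = sets torus_borel"
    and K: "filterlim K at_top sequentially" and C: "C \<ge> 0"
    and bound: "\<And>L j. K L > 0 \<Longrightarrow> j < K L \<Longrightarrow> Sigma_Algebra.measure \<nu> (cyl (K L) j) \<le> C / real (K L)"
  shows "absolutely_continuous torus_lebesgue \<nu>"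
proof -
  interpret finite_measure \<nu> by (rule fin)
  have space: "space \<nu> = {0..<1}" using sets_eq_imp_space_eq[OF sets] by (simp add: space_torus_borel)
  have null_compact: "emeasure \<nu> Q = 0" if Q: "compact Q" "Q \<subseteq> {0..<1}" "Q \<in> null_sets lborel" for Q
  proof -
    have Q_sets: "Q \<in> sets \<nu>" using Q by (simp add: sets sets_torus_borel borel_closed compact_imp_closed)
    have "Sigma_Algebra.measure \<nu> Q \<le> C * e" if e: "e > 0" for e
    proof -
      obtain U where U: "open U" "Q \<subseteq> U" "emeasure lborel (U - Q) < ennreal e"
        using outer_regular_lborel[of Q e] Q e by (metis borel_closed compact_imp_closed)
      \<comment> \<open>A cylinder shorter than \<open>\<delta>\<close> that meets Q stays inside U,
        so K L only has to exceed 1 / \<open>\<delta>\<close>.\<close>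
      then obtain \<delta> where \<delta>: "\<delta> > 0" "(\<Union>x\<in>Q. ball x \<delta>) \<subseteq> U"
        using compact_subset_open_imp_ball_epsilon_subset Q(1) by metis
      obtain n :: nat where n: "real n > 1 / \<delta>" using reals_Archimedean2 by blast
      have "\<forall>\<^sub>F L in sequentially. K L \<ge> Suc n" using K by (simp add: filterlim_at_top)
      then obtain L where L: "K L \<ge> Suc n" by (auto dest: eventually_happens'[OF sequentially_bot])
      let ?K = "K L"
      have K0: "?K > 0" using L by simp
      have "1 / \<delta> < real ?K" using n L by linarith
      then have K\<delta>: "1 / real ?K < \<delta>" using \<delta>(1) K0 by (simp add: field_simps)
      define J where "J = {j. j < ?K \<and> cyl ?K j \<inter> Q \<noteq> {}}"
      have J: "finite J" by (simp add: J_def)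
      have Q_J: "Q \<subseteq> (\<Union>j\<in>J. cyl ?K j)"
      proof
        fix x assume x: "x \<in> Q"
        then obtain j where "j < ?K" "x \<in> cyl ?K j" using cyl_cover[OF K0, of x] Q(2) by blast
        then show "x \<in> (\<Union>j\<in>J. cyl ?K j)" using x by (auto simp: J_def)
      qed
      have J_U: "(\<Union>j\<in>J. cyl ?K j) \<subseteq> U"
      proof
        fix x assume "x \<in> (\<Union>j\<in>J. cyl ?K j)"
        then obtain j y where j: "x \<in> cyl ?K j" "y \<in> cyl ?K j" "y \<in> Q" by (auto simp: J_def)
        have "real (Suc j) / real ?K = real j / real ?K + 1 / real ?K" by (simp add: add_divide_distrib)
        then have "dist y x < 1 / real ?K" using j(1,2) by (auto simp: cyl_def dist_real_def)
        then show "x \<in> U" using \<delta>(2) j(3) K\<delta> by (force simp: subset_iff)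
      qed
      have "Sigma_Algebra.measure \<nu> Q \<le> Sigma_Algebra.measure \<nu> (\<Union>j\<in>J. cyl ?K j)"
        using Q_J J by (intro finite_measure_mono) (auto simp: sets J_def intro!: sets.finite_UN cyl_torus)
      also have "\<dots> \<le> (\<Sum>j\<in>J. Sigma_Algebra.measure \<nu> (cyl ?K j))"
        using J by (intro finite_measure_subadditive_finite) (auto simp: sets J_def cyl_torus)
      also have "\<dots> \<le> (\<Sum>j\<in>J. C / real ?K)" using bound[OF K0] by (intro sum_mono) (auto simp: J_def)
      also have "\<dots> = C * Sigma_Algebra.measure lborel (\<Union>j\<in>J. cyl ?K j)"
        by (subst measure_UN_cyl[OF K0 J]) (auto simp: measure_lborel_cyl[OF K0] emeasure_lborel_cyl_less)
      also have "Sigma_Algebra.measure lborel (\<Union>j\<in>J. cyl ?K j) \<le> e"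
      proof -
        have "emeasure lborel (\<Union>j\<in>J. cyl ?K j) \<le> emeasure lborel U"
          using J_U U(1) by (intro emeasure_mono) auto
        also have "\<dots> \<le> emeasure lborel ((U - Q) \<union> Q)" using U(1) Q by (intro emeasure_mono) auto
        also have "\<dots> \<le> emeasure lborel (U - Q) + emeasure lborel Q"
          using U(1) Q(3) by (intro emeasure_subadditive) auto
        also have "\<dots> \<le> ennreal e" using U(3) Q(3) by auto
        finally show ?thesis using e by (simp add: measure_def enn2real_leI)
      qed
      finally show ?thesis using C by (simp add: mult_left_mono)
    qed
    then have "Sigma_Algebra.measure \<nu> Q \<le> 0"
    proof -
      assume *: "\<And>e. e > 0 \<Longrightarrow> Sigma_Algebra.measure \<nu> Q \<le> C * e"
      show ?thesis
      proof (rule field_le_epsilon)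
        fix e :: real assume "e > 0"
        then have "Sigma_Algebra.measure \<nu> Q \<le> C * (e / (C + 1))" using C by (intro *) simp
        also have "\<dots> \<le> e" using C \<open>e > 0\<close> by (simp add: field_simps)
        finally show "Sigma_Algebra.measure \<nu> Q \<le> 0 + e" by simp
      qed
    qed
    then show ?thesis by (simp add: emeasure_eq_measure measure_nonneg order_antisym)
  qed
  \<comment> \<open>Regularity is applied to a Borel measure on the whole line, so
    \<open>\<nu>\<close> is pushed forward along the inclusion.\<close>
  define \<nu>' where "\<nu>' = distr \<nu> borel (\<lambda>x. x)"
  have id_meas: "(\<lambda>x. x) \<in> borel_measurable \<nu>"
  proof (rule measurableI)
    fix X :: "real set" assume "X \<in> sets borel"
    then show "(\<lambda>x. x) -` X \<inter> space \<nu> \<in> sets \<nu>" by (auto simp: space sets sets_torus_borel)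
  qed auto
  have \<nu>': "emeasure \<nu>' X = emeasure \<nu> (X \<inter> {0..<1})" if "X \<in> sets borel" for X
    unfolding \<nu>'_def using that id_meas by (simp add: emeasure_distr space)
  show ?thesis unfolding absolutely_continuous_def
  proof
    fix X assume "X \<in> null_sets torus_lebesgue"
    then have X: "X \<subseteq> {0..<1}" "X \<in> null_sets lborel" by (auto simp: null_sets_torus_lebesgue)
    then have X_b: "X \<in> sets borel" by auto
    have "emeasure \<nu>' X = (SUP Q\<in>{Q. Q \<subseteq> X \<and> compact Q}. emeasure \<nu>' Q)"
    proof (rule inner_regular)
      show "emeasure \<nu>' (space \<nu>') \<noteq> \<infinity>" using \<nu>'[of UNIV] emeasure_finite by (simp add: \<nu>'_def)
    qed (use X_b in \<open>simp_all add: \<nu>'_def\<close>)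
    also have "\<dots> = 0"
    proof -
      have "emeasure \<nu>' Q = 0" if "Q \<subseteq> X" "compact Q" for Q
      proof -
        have "Q \<in> null_sets lborel"
          using that X(2) by (intro null_sets_subset[OF X(2)]) (auto simp: borel_closed compact_imp_closed)
        then have "emeasure \<nu> Q = 0" using that X(1) by (intro null_compact) auto
        moreover have "Q \<inter> {0..<1} = Q" using that X(1) by auto
        ultimately show ?thesis using that by (simp add: \<nu>' borel_closed compact_imp_closed)
      qed
      then show ?thesis by (auto simp: SUP_eq_iff bot_ennreal intro!: antisym SUP_least)
    qed
    finally have "emeasure \<nu> X = 0" using X X_b \<nu>'[OF X_b] by (simp add: Int_absorb2)
    then show "X \<in> null_sets \<nu>" using X X_b by (auto simp: null_sets_def sets sets_torus_borel)
  qed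
qed

text \<open>
  Vanishing Hellinger affinity with Lebesgue measure: the cylinders of \<open>\<nu>\<close>-density above \<open>1\<close> have
  small Lebesgue measure, and the others small \<open>\<nu>\<close>-measure.
\<close>

lemma singular_of_cylinders:
  fixes \<nu> :: "real measure" and K :: "nat \<Rightarrow> nat"
  assumes fin: "finite_measure \<nu>" and sets: "sets \<nu> = sets torus_borel"
    and K0: "\<And>L. K L > 0"
    and lim: "(\<lambda>L. \<Sum>j<K L. sqrt (Sigma_Algebra.measure \<nu> (cyl (K L) j) / real (K L))) \<longlonglongrightarrow> 0"
  shows "\<exists>S\<in>null_sets torus_lebesgue. space \<nu> - S \<in> null_sets \<nu>"
proof -
  interpret finite_measure \<nu> by (rule fin)
  have space: "space \<nu> = {0..<1}" using sets_eq_imp_space_eq[OF sets] by (simp add: space_torus_borel)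
  let ?m = "\<lambda>L j. Sigma_Algebra.measure \<nu> (cyl (K L) j)"
  let ?s = "\<lambda>L. \<Sum>j<K L. sqrt (?m L j / real (K L))"
  \<comment> \<open>The cylinders where the average density of \<open>\<nu>\<close> exceeds 1. On
    them 1/K <= sqrt (m/K), on the others m <= sqrt (m/K), with m the
    \<open>\<nu>\<close>-mass.\<close>
  define J where "J L = {j. j < K L \<and> ?m L j > 1 / real (K L)}" for L
  define E where "E L = (\<Union>j\<in>J L. cyl (K L) j)" for L
  have fin_J: "finite (J L)" for L by (simp add: J_def)
  have E_borel: "E L \<in> sets borel" for L unfolding E_def by (intro sets.finite_UN fin_J) auto
  have E_sub: "E L \<subseteq> {0..<1}" for L
    unfolding E_def using cyl_subset[of _ "K L"] by (auto simp: J_def)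
  have E_\<nu>: "E L \<in> sets \<nu>" for L using E_borel E_sub by (simp add: sets sets_torus_borel)
  have leb: "Sigma_Algebra.measure lborel (E L) \<le> ?s L" for L
  proof -
    have "Sigma_Algebra.measure lborel (E L) = (\<Sum>j\<in>J L. 1 / real (K L))"
      unfolding E_def
      by (subst measure_UN_cyl[OF K0 fin_J]) (auto simp: measure_lborel_cyl[OF K0] emeasure_lborel_cyl_less)
    also have "\<dots> \<le> (\<Sum>j\<in>J L. sqrt (?m L j / real (K L)))"
    proof (rule sum_mono)
      fix j assume j: "j \<in> J L"
      have "1 / real (K L) * (1 / real (K L)) \<le> ?m L j * (1 / real (K L))"
        using j by (intro mult_right_mono) (auto simp: J_def)
      then show "1 / real (K L) \<le> sqrt (?m L j / real (K L))"
        by (intro real_le_rsqrt) (simp add: power2_eq_square)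
    qed
    also have "\<dots> \<le> ?s L" by (rule sum_mono2) (auto simp: J_def)
    finally show ?thesis .
  qed
  have nu: "Sigma_Algebra.measure \<nu> (space \<nu> - E L) \<le> ?s L" for L
  proof -
    let ?J' = "{..<K L} - J L"
    have "space \<nu> - E L \<subseteq> (\<Union>j\<in>?J'. cyl (K L) j)"
    proof
      fix x assume x: "x \<in> space \<nu> - E L"
      then obtain j where "j < K L" "x \<in> cyl (K L) j" using cyl_cover[OF K0[of L], of x] by (auto simp: space)
      then show "x \<in> (\<Union>j\<in>?J'. cyl (K L) j)" using x by (auto simp: E_def)
    qed
    then have "Sigma_Algebra.measure \<nu> (space \<nu> - E L) \<le> Sigma_Algebra.measure \<nu> (\<Union>j\<in>?J'. cyl (K L) j)"
      by (intro finite_measure_mono) (auto simp: sets intro!: sets.finite_UN cyl_torus)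
    also have "\<dots> \<le> (\<Sum>j\<in>?J'. ?m L j)"
      by (intro finite_measure_subadditive_finite) (auto simp: sets cyl_torus)
    also have "\<dots> \<le> (\<Sum>j\<in>?J'. sqrt (?m L j / real (K L)))"
    proof (rule sum_mono)
      fix j assume "j \<in> ?J'"
      then have "?m L j \<le> 1 / real (K L)" by (auto simp: J_def not_less)
      then have "?m L j * ?m L j \<le> ?m L j * (1 / real (K L))"
        by (intro mult_left_mono) (auto simp: measure_nonneg)
      then show "?m L j \<le> sqrt (?m L j / real (K L))"
        by (intro real_le_rsqrt) (simp add: power2_eq_square)
    qed
    also have "\<dots> \<le> ?s L" by (rule sum_mono2) (auto simp: measure_nonneg)
    finally show ?thesis .
  qed
  have "\<exists>L. ?s L \<le> (1 / 2) ^ m" for m :: nat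
  proof -
    have "\<forall>\<^sub>F L in sequentially. ?s L < (1 / 2) ^ m" using lim by (rule order_tendstoD) simp
    then show ?thesis by (auto dest!: eventually_happens'[OF sequentially_bot] intro: less_imp_le)
  qed
  \<comment> \<open>A subsequence with geometric bounds, to apply Borel-Cantelli to the sets E for
    Lebesgue measure and to their complements for \<open>\<nu>\<close>.\<close>
  then obtain \<sigma> where \<sigma>: "\<And>m. ?s (\<sigma> m) \<le> (1 / 2) ^ m" by metis
  have summable: "summable (\<lambda>m. (1 / 2 :: real) ^ m)" by (rule summable_geometric) simp
  have "limsup (\<lambda>m. E (\<sigma> m)) \<in> null_sets lborel"
  proof (rule borel_cantelli_limsup1)
    show "emeasure lborel (E (\<sigma> m)) < \<infinity>" for m
      by (rule emeasure_bounded_finite[OF bounded_subset[OF bounded_closed_interval[of 0 1]]])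
        (use E_sub[of "\<sigma> m"] in \<open>auto simp: subset_iff less_imp_le\<close>)
    show "summable (\<lambda>m. Sigma_Algebra.measure lborel (E (\<sigma> m)))"
      by (rule summable_comparison_test'[OF summable, of 0]) (use order_trans[OF leb \<sigma>] in simp)
  qed (use E_borel in simp)
  moreover have "limsup (\<lambda>m. space \<nu> - E (\<sigma> m)) \<in> null_sets \<nu>"
  proof (rule borel_cantelli_limsup1)
    show "summable (\<lambda>m. Sigma_Algebra.measure \<nu> (space \<nu> - E (\<sigma> m)))"
      by (rule summable_comparison_test'[OF summable, of 0]) (use order_trans[OF nu \<sigma>] in \<open>simp add: measure_nonneg\<close>)
  qed (use E_\<nu> in \<open>auto simp: less_top[symmetric]\<close>)
  moreover have "limsup (\<lambda>m. E (\<sigma> m)) \<subseteq> {0..<1}"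
    using E_sub by (fastforce simp: limsup_INF_SUP)
  moreover have "space \<nu> - limsup (\<lambda>m. E (\<sigma> m)) \<subseteq> limsup (\<lambda>m. space \<nu> - E (\<sigma> m))"
    by (auto simp: limsup_INF_SUP) (metis atLeast_iff max.cobounded1 max.cobounded2)
  moreover have "limsup (\<lambda>m. E (\<sigma> m)) \<in> sets \<nu>"
    using calculation(1,3) by (auto simp: sets sets_torus_borel)
  ultimately show ?thesis
    by (intro bexI[of _ "limsup (\<lambda>m. E (\<sigma> m))"]) (auto simp: null_sets_torus_lebesgue intro: null_sets_subset)
qed

text \<open>The distance to the nearest integer, written with \<open>arccos\<close> and
  \<open>cos\<close> so that continuity and periodicity are immediate.\<close>

definition torus_dist :: "real \<Rightarrow> real" where
  "torus_dist t = arccos (cos (2 * pi * t)) / (2 * pi)"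

lemma continuous_torus_dist [continuous_intros]:
  fixes f :: "'a::t2_space \<Rightarrow> real"
  shows "continuous_on X f \<Longrightarrow> continuous_on X (\<lambda>t. torus_dist (f t))"
  unfolding torus_dist_def by (intro continuous_intros) (auto intro!: continuous_intros)

lemma torus_dist_periodic: "torus_dist (t + 1) = torus_dist t"
  by (simp add: torus_dist_def distrib_left cos_add)

lemma torus_dist_nearest: obtains n :: int where "torus_dist t = \<bar>t - of_int n\<bar>"
proof -
  obtain n :: int where n: "arccos (cos (2 * pi * t)) = \<bar>2 * pi * t - real_of_int n * (2 * pi)\<bar>"
    by (rule arccos_cos_eq_abs_2pi)
  also have "2 * pi * t - real_of_int n * (2 * pi) = (2 * pi) * (t - real_of_int n)"
    by (simp add: algebra_simps)
  finally have "torus_dist t = \<bar>t - of_int n\<bar>" by (simp add: torus_dist_def abs_mult)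
  then show thesis by (rule that)
qed

lemma torus_dist_small: "\<bar>t\<bar> \<le> 1 / 2 \<Longrightarrow> torus_dist t = \<bar>t\<bar>"
  unfolding torus_dist_def by (subst arccos_cos_eq_abs) (auto simp: abs_mult mult.commute)

lemma torus_dist_nonneg: "torus_dist t \<ge> 0"
  by (rule torus_dist_nearest[of t]) simp

lemma periodic_int: "(\<And>x. \<phi> (x + 1) = (\<phi> x :: 'a)) \<Longrightarrow> \<phi> (x + of_int n) = \<phi> (x :: real)"
proof (induction n arbitrary: x rule: int_induct[of _ 0])
  case (step1 i)
  have "\<phi> (x + of_int (i + 1)) = \<phi> ((x + of_int i) + 1)" by (simp add: add.assoc)
  then show ?case using step1 by simp
next
  case (step2 i)
  have "\<phi> (x + of_int i) = \<phi> ((x + of_int (i - 1)) + 1)" by simp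
  then show ?case using step2 by metis
qed simp

lemma periodic_frac: "(\<And>x. \<phi> (x + 1) = (\<phi> x :: 'a)) \<Longrightarrow> \<phi> (frac x) = \<phi> (x :: real)"
  using periodic_int[of \<phi> "frac x" "\<lfloor>x\<rfloor>"] by (simp add: frac_def)

lemma periodic_bounded:
  fixes \<phi> :: "real \<Rightarrow> real"
  assumes "continuous_on UNIV \<phi>" "\<And>x. \<phi> (x + 1) = \<phi> x"
  obtains C where "\<And>x. norm (\<phi> x) \<le> C"
proof -
  have "compact (\<phi> ` {0..1})"
    by (intro compact_continuous_image continuous_on_subset[OF assms(1)]) auto
  then obtain C where C: "\<forall>y\<in>\<phi> ` {0..1}. norm y \<le> C"
    using compact_imp_bounded bounded_iff by metis
  have "norm (\<phi> x) \<le> C" for x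
  proof -
    have "frac x \<in> {0..1}" using frac_ge_0[of x] frac_lt_1[of x] by (simp add: less_imp_le)
    then have "norm (\<phi> (frac x)) \<le> C" using C by blast
    then show ?thesis by (simp only: periodic_frac[of \<phi>, OF assms(2)])
  qed
  then show thesis by (rule that)
qed

lemma continuous_torus_measurable:
  assumes "sets \<nu> = sets torus_borel" "continuous_on UNIV (\<phi> :: real \<Rightarrow> real)"
  shows "\<phi> \<in> borel_measurable \<nu>"
proof -
  have "\<phi> \<in> borel_measurable torus_borel"
    unfolding torus_borel_def using borel_measurable_continuous_onI[OF assms(2)]
    by (rule measurable_restrict_space1)
  then show ?thesis using measurable_cong_sets[OF assms(1) refl] by blast
qed

text \<open>
  \<open>b L j\<close> bounds the asymptotic mass of the \<open>j\<close>-th cylinder of level \<open>L\<close>, in the weak sense of test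
  functions carried by finitely many cylinders.
\<close>

locale cylinder_limit =
  fixes \<nu> :: "real measure" and \<mu> :: "nat \<Rightarrow> real measure" and K :: "nat \<Rightarrow> nat"
    and b :: "nat \<Rightarrow> nat \<Rightarrow> real"
  assumes prob: "prob_space \<nu>" and sets_\<nu>: "sets \<nu> = sets torus_borel"
    and conv: "torus_weak_conv \<mu> \<nu>"
    and K_pos: "\<And>L. K L > 0"
    and test: "\<And>L J \<phi> \<epsilon>. J \<subseteq> {..<K L} \<Longrightarrow> \<epsilon> > 0 \<Longrightarrow> continuous_on UNIV \<phi> \<Longrightarrow> (\<And>t. 0 \<le> \<phi> t \<and> \<phi> t \<le> (1::real)) \<Longrightarrow>
      (\<And>t. t \<in> {0..<1} \<Longrightarrow> \<phi> t > 0 \<Longrightarrow> t \<in> (\<Union>j\<in>J. cyl (K L) j)) \<Longrightarrow>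
      \<forall>\<^sub>F n in sequentially. integral\<^sup>L (\<mu> n) \<phi> \<le> (\<Sum>j\<in>J. b L j) + \<epsilon>"
    and small: "\<And>\<epsilon>. \<epsilon> > 0 \<Longrightarrow> \<exists>L. \<forall>j<K L. b L j \<le> \<epsilon>"
begin

sublocale prob_space \<nu> by (rule prob)

lemma space_\<nu>: "space \<nu> = {0..<1}"
  using sets_eq_imp_space_eq[OF sets_\<nu>] by (simp add: space_torus_borel)

lemma integral_le:
  assumes "J \<subseteq> {..<K L}" "continuous_on UNIV \<phi>" "\<And>t. \<phi> (t + 1) = \<phi> t"
    "\<And>t. 0 \<le> \<phi> t \<and> \<phi> t \<le> (1::real)"
    "\<And>t. t \<in> {0..<1} \<Longrightarrow> \<phi> t > 0 \<Longrightarrow> t \<in> (\<Union>j\<in>J. cyl (K L) j)"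
  shows "integral\<^sup>L \<nu> \<phi> \<le> (\<Sum>j\<in>J. b L j)"
proof (rule field_le_epsilon)
  fix \<epsilon> :: real assume "\<epsilon> > 0"
  have "(\<lambda>n. integral\<^sup>L (\<mu> n) \<phi>) \<longlonglongrightarrow> integral\<^sup>L \<nu> \<phi>"
    using conv assms(2,3) unfolding torus_weak_conv_def by blast
  then show "integral\<^sup>L \<nu> \<phi> \<le> (\<Sum>j\<in>J. b L j) + \<epsilon>"
    by (rule tendsto_upperbound[OF _ test[OF assms(1) \<open>\<epsilon> > 0\<close> assms(2,4,5)]]) auto
qed

lemma measure_le_integral:
  assumes "X \<in> sets \<nu>" "continuous_on UNIV \<phi>" "\<And>t. 0 \<le> \<phi> t \<and> \<phi> t \<le> (1::real)" "\<And>t. t \<in> X \<Longrightarrow> \<phi> t = 1"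
  shows "Sigma_Algebra.measure \<nu> X \<le> integral\<^sup>L \<nu> \<phi>"
proof -
  have "Sigma_Algebra.measure \<nu> X = integral\<^sup>L \<nu> (indicator X)" using assms(1) by simp
  also have "\<dots> \<le> integral\<^sup>L \<nu> \<phi>"
  proof (rule integral_mono)
    show "integrable \<nu> (indicator X :: real \<Rightarrow> real)" using assms(1) by (simp add: emeasure_eq_measure)
    show "integrable \<nu> \<phi>"
      by (rule integrable_const_bound[of _ 1]) (use assms continuous_torus_measurable[OF sets_\<nu>] in auto)
  qed (use assms(3,4) in \<open>auto simp: indicator_def\<close>)
  finally show ?thesis by simp
qed

text \<open>A tent of half-width 1/K around x meets boundedly many cylinders of level L, each of
  arbitrarily small mass.\<close>

lemma no_atoms:
  assumes x: "x \<in> {0..<1}"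
  shows "Sigma_Algebra.measure \<nu> {x} = 0"
proof -
  have le: "Sigma_Algebra.measure \<nu> {x} \<le> \<epsilon>" if \<epsilon>: "\<epsilon> > 0" for \<epsilon>
  proof -
    obtain L where L: "\<And>j. j < K L \<Longrightarrow> b L j \<le> \<epsilon> / 9" using small[of "\<epsilon> / 9"] \<epsilon> by auto
    let ?K = "K L"
    define \<phi> where "\<phi> t = max 0 (1 - real ?K * torus_dist (t - x))" for t
    \<comment> \<open>Here n accounts for wrapping around the circle and e for the two neighbouring
      cylinders: 3 * 3 = 9 candidates, the origin of \<epsilon> / 9.\<close>
    define J where "J = {j. j < ?K \<and> (\<exists>n\<in>{-1, 0, 1}. \<exists>e\<in>{-1, 0, 1}. int j = \<lfloor>x * real ?K\<rfloor> + n * int ?K + e)}"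
    have "J \<subseteq> (\<lambda>(n, e). nat (\<lfloor>x * real ?K\<rfloor> + n * int ?K + e)) ` ({-1, 0, 1} \<times> {-1, 0, 1})"
    proof
      fix j assume "j \<in> J"
      then obtain n e where ne: "n \<in> {-1, 0, 1}" "e \<in> {-1, 0, 1}" "int j = \<lfloor>x * real ?K\<rfloor> + n * int ?K + e"
        by (auto simp only: J_def)
      then have "j = nat (\<lfloor>x * real ?K\<rfloor> + n * int ?K + e)" by simp
      then show "j \<in> (\<lambda>(n, e). nat (\<lfloor>x * real ?K\<rfloor> + n * int ?K + e)) ` ({-1, 0, 1} \<times> {-1, 0, 1})"
        using ne(1,2) by (intro image_eqI[of _ _ "(n, e)"]) auto
    qed
    then have "card J \<le> card ((\<lambda>(n, e). nat (\<lfloor>x * real ?K\<rfloor> + n * int ?K + e)) ` ({-1, 0, 1 :: int} \<times> {-1, 0, 1}))"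
      by (intro card_mono) auto
    also have "\<dots> \<le> card ({-1, 0, 1 :: int} \<times> {-1, 0, 1 :: int})" by (rule card_image_le) auto
    finally have card_J: "card J \<le> 9" by (simp add: card_cartesian_product)
    have cont: "continuous_on UNIV \<phi>" unfolding \<phi>_def by (intro continuous_intros)
    have "torus_dist (t + 1 - x) = torus_dist (t - x)" for t
      using torus_dist_periodic[of "t - x"] by (simp add: algebra_simps)
    then have per: "\<phi> (t + 1) = \<phi> t" for t by (simp add: \<phi>_def)
    have range: "0 \<le> \<phi> t \<and> \<phi> t \<le> 1" for t using torus_dist_nonneg by (simp add: \<phi>_def)
    have supp: "t \<in> (\<Union>j\<in>J. cyl ?K j)" if t: "t \<in> {0..<1}" "\<phi> t > 0" for t
    proof -
      obtain n :: int where n: "torus_dist (t - x) = \<bar>t - x - of_int n\<bar>" by (rule torus_dist_nearest)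
      have "real ?K * torus_dist (t - x) < 1" using t(2) by (simp add: \<phi>_def max_def split: if_splits)
      then have "\<bar>real ?K * (t - x - of_int n)\<bar> < 1" unfolding n abs_mult by simp
      then have near: "\<bar>t * real ?K - (x * real ?K + of_int (n * int ?K))\<bar> < 1" by (simp add: algebra_simps)
      have "\<bar>t - x - of_int n\<bar> < 1"
      proof -
        have "\<bar>t - x - of_int n\<bar> * 1 \<le> \<bar>t - x - of_int n\<bar> * real ?K"
          using K_pos[of L] by (intro mult_left_mono) auto
        also have "\<dots> < 1" using \<open>real ?K * torus_dist (t - x) < 1\<close> by (simp add: n mult.commute)
        finally show ?thesis by simp
      qed
      moreover have "\<bar>t - x\<bar> < 1" using t(1) x by auto
      ultimately have "\<bar>real_of_int n\<bar> < 2" by linarith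
      then have "n \<in> {-1, 0, 1}" by auto
      moreover have "\<lfloor>t * real ?K\<rfloor> - (\<lfloor>x * real ?K\<rfloor> + n * int ?K) \<in> {-1, 0, 1}"
      proof -
        have "\<lfloor>x * real ?K + of_int (n * int ?K)\<rfloor> = \<lfloor>x * real ?K\<rfloor> + n * int ?K" by (rule floor_add_int[symmetric])
        moreover have "\<bar>\<lfloor>t * real ?K\<rfloor> - \<lfloor>x * real ?K + of_int (n * int ?K)\<rfloor>\<bar> \<le> 1" using near by linarith
        ultimately have "\<bar>\<lfloor>t * real ?K\<rfloor> - (\<lfloor>x * real ?K\<rfloor> + n * int ?K)\<bar> \<le> 1" by simp
        then show ?thesis by auto
      qed
      moreover obtain j where j: "j < ?K" "t \<in> cyl ?K j" using cyl_cover[OF K_pos t(1)] .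
      moreover have "\<lfloor>t * real ?K\<rfloor> = int j" using j(2) mem_cyl_iff[OF K_pos] by blast
      ultimately have "j \<in> J" unfolding J_def
        by (intro CollectI conjI bexI[of _ n] bexI[of _ "\<lfloor>t * real ?K\<rfloor> - (\<lfloor>x * real ?K\<rfloor> + n * int ?K)"]) auto
      then show ?thesis using j by blast
    qed
    have "Sigma_Algebra.measure \<nu> {x} \<le> integral\<^sup>L \<nu> \<phi>"
    proof (rule measure_le_integral[OF _ cont range])
      show "{x} \<in> sets \<nu>" using x by (simp add: sets_\<nu> sets_torus_borel)
      show "\<phi> t = 1" if "t \<in> {x}" for t using that by (simp add: \<phi>_def torus_dist_small[of 0])
    qed
    also have "\<dots> \<le> (\<Sum>j\<in>J. b L j)"
      by (rule integral_le[OF _ cont per range supp]) (auto simp: J_def)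
    also have "\<dots> \<le> (\<Sum>j\<in>J. \<epsilon> / 9)"
    proof (rule sum_mono)
      fix j assume "j \<in> J"
      then have "j < ?K" by (simp add: J_def)
      then show "b L j \<le> \<epsilon> / 9" by (rule L)
    qed
    also have "\<dots> \<le> \<epsilon>" using card_J \<epsilon> by (simp add: field_simps)
    finally show ?thesis .
  qed
  have "Sigma_Algebra.measure \<nu> {x} \<le> 0"
    by (rule field_le_epsilon) (use le in simp)
  then show ?thesis by (simp add: measure_nonneg order_antisym)
qed

text \<open>Periodic test functions rise to the indicator of the open cylinder, which gives the
  bound there; the left endpoint has mass 0.\<close>

lemma measure_cyl_le:
  assumes j: "j < K L"
  shows "Sigma_Algebra.measure \<nu> (cyl (K L) j) \<le> b L j"
proof -
  let ?K = "K L"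
  define a c where "a = real j / real ?K" and "c = real (Suc j) / real ?K"
  define m where "m = (a + c) / 2"
  define h where "h = (c - a) / 2"
  have ac: "0 \<le> a" "a < c" "c \<le> 1" using j K_pos[of L] by (auto simp: a_def c_def field_simps)
  have cyl: "cyl ?K j = {a..<c}" by (simp add: cyl_def a_def c_def)
  have mh: "m - h = a" "m + h = c" "h > 0" using ac by (auto simp: m_def h_def field_simps)
  define \<phi> where "\<phi> n t = min 1 (real n * max 0 (h - torus_dist (t - m)))" for n t
  have cont: "continuous_on UNIV (\<phi> n)" for n unfolding \<phi>_def by (intro continuous_intros)
  have "torus_dist (t + 1 - m) = torus_dist (t - m)" for t
    using torus_dist_periodic[of "t - m"] by (simp add: algebra_simps)
  then have per: "\<phi> n (t + 1) = \<phi> n t" for n t by (simp add: \<phi>_def)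
  have range: "0 \<le> \<phi> n t \<and> \<phi> n t \<le> 1" for n t by (simp add: \<phi>_def)
  have pos_iff: "h - torus_dist (t - m) > 0 \<longleftrightarrow> t \<in> {a<..<c}" if t: "t \<in> {0..<1}" for t
  proof
    assume h: "h - torus_dist (t - m) > 0"
    obtain n :: int where n: "torus_dist (t - m) = \<bar>t - m - of_int n\<bar>" by (rule torus_dist_nearest)
    then have 1: "\<bar>t - m - of_int n\<bar> < h" using h by simp
    \<comment> \<open>No wrapping occurs: t lies in [0,1) and t - n in the open cylinder, which is
      contained in [0,1), so n = 0.\<close>
    have "real_of_int n < 1" "real_of_int n > -1" using 1 t ac mh by (auto simp: abs_if split: if_splits)
    then have "n = 0" by auto
    then show "t \<in> {a<..<c}" using 1 mh by (auto simp: abs_if split: if_splits)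
  next
    assume "t \<in> {a<..<c}"
    then have 1: "\<bar>t - m\<bar> < h" using mh by (auto simp: abs_if)
    moreover have "h \<le> 1 / 2" using ac by (simp add: h_def)
    ultimately have "torus_dist (t - m) = \<bar>t - m\<bar>" by (intro torus_dist_small) simp
    then show "h - torus_dist (t - m) > 0" using 1 by simp
  qed
  have int_le: "integral\<^sup>L \<nu> (\<phi> n) \<le> b L j" for n
  proof -
    have "integral\<^sup>L \<nu> (\<phi> n) \<le> (\<Sum>j\<in>{j}. b L j)"
    proof (rule integral_le[OF _ cont per range])
      fix t assume t: "t \<in> {0..<1::real}" "\<phi> n t > 0"
      then have "real n * max 0 (h - torus_dist (t - m)) > 0" by (simp add: \<phi>_def)
      then have "h - torus_dist (t - m) > 0" by (simp add: zero_less_mult_iff max_def split: if_splits)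
      then show "t \<in> (\<Union>j\<in>{j}. cyl ?K j)" using pos_iff[OF t(1)] by (simp add: cyl)
    qed (use j in simp)
    then show ?thesis by simp
  qed
  have open_sets: "{a<..<c} \<in> sets \<nu>" using ac by (auto simp: sets_\<nu> sets_torus_borel)
  have "(\<lambda>n. integral\<^sup>L \<nu> (\<phi> n)) \<longlonglongrightarrow> integral\<^sup>L \<nu> (indicator {a<..<c})"
  proof (rule integral_dominated_convergence[where w = "\<lambda>_. 1"])
    show "AE t in \<nu>. (\<lambda>n. \<phi> n t) \<longlonglongrightarrow> indicator {a<..<c} t"
    proof (rule AE_I2)
      fix t assume "t \<in> space \<nu>"
      then have t: "t \<in> {0..<1}" by (simp add: space_\<nu>)
      show "(\<lambda>n. \<phi> n t) \<longlonglongrightarrow> indicator {a<..<c} t"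
      proof (cases "t \<in> {a<..<c}")
        case False
        then have "\<not> h - torus_dist (t - m) > 0" using pos_iff[OF t] by blast
        then have "max 0 (h - torus_dist (t - m)) = 0" by (simp only: not_less max_absorb1)
        then show ?thesis using False by (simp add: \<phi>_def)
      next
        case True
        let ?g = "max 0 (h - torus_dist (t - m))"
        have g: "?g > 0" using True pos_iff[OF t] by simp
        obtain N :: nat where N: "real N > 1 / ?g" using reals_Archimedean2 by blast
        have "\<phi> n t = 1" if "n \<ge> N" for n
        proof -
          have "1 / ?g \<le> real n" using of_nat_mono[OF that, where 'a=real] by (rule order_trans[OF less_imp_le[OF N]])
          then have "real n * ?g \<ge> 1" using g by (simp add: pos_divide_le_eq)
          then show ?thesis by (simp add: \<phi>_def)
        qed
        then have "(\<lambda>n. \<phi> n t) \<longlonglongrightarrow> 1"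
          by (intro tendsto_eventually) (auto simp: eventually_sequentially)
        then show ?thesis using True by simp
      qed
    qed
    show "AE t in \<nu>. norm (\<phi> n t) \<le> 1" for n using range by (intro AE_I2) simp
  qed (use open_sets cont continuous_torus_measurable[OF sets_\<nu>] in auto)
  then have "integral\<^sup>L \<nu> (indicator {a<..<c}) \<le> b L j"
    by (rule LIMSEQ_le_const2) (use int_le in blast)
  then have open_le: "Sigma_Algebra.measure \<nu> {a<..<c} \<le> b L j" using open_sets by simp
  have "cyl ?K j = {a} \<union> {a<..<c}" using ac by (auto simp: cyl)
  also have "Sigma_Algebra.measure \<nu> \<dots> \<le> Sigma_Algebra.measure \<nu> {a} + Sigma_Algebra.measure \<nu> {a<..<c}"
    using open_sets ac by (intro measure_Un_le) (auto simp: sets_\<nu> sets_torus_borel)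
  also have "Sigma_Algebra.measure \<nu> {a} = 0" by (rule no_atoms) (use ac in auto)
  finally show ?thesis using open_le by simp
qed

end

text \<open>Viewed on the line the measures are carried by [0,1), hence tight, and tightness yields
  a weakly convergent subsequence.\<close>

lemma periodic_weak_limit_exists:
  fixes \<mu> :: "nat \<Rightarrow> real measure"
  assumes prob: "\<And>n. prob_space (\<mu> n)" and sets: "\<And>n. sets (\<mu> n) = sets torus_borel"
  shows "\<exists>r \<nu>. strict_mono r \<and> prob_space \<nu> \<and> sets \<nu> = sets torus_borel \<and> torus_weak_conv (\<lambda>n. \<mu> (r n)) \<nu>"
proof -
  define \<mu>' where "\<mu>' n = distr (\<mu> n) borel (\<lambda>x. x)" for n
  have meas: "(\<lambda>x. x) \<in> borel_measurable (\<mu> n)" for n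
    by (rule continuous_torus_measurable[OF sets]) (rule continuous_on_id)
  have rd: "real_distribution (\<mu>' n)" for n
    unfolding \<mu>'_def by (rule prob_space.real_distribution_distr[OF prob meas])
  have "tight \<mu>'"
    unfolding tight_def
  proof (intro conjI allI impI rd)
    fix \<epsilon> :: real assume \<epsilon>: "\<epsilon> > 0"
    have "Sigma_Algebra.measure (\<mu>' n) {-1<..1} = 1" for n
    proof -
      have "space (\<mu> n) = {0..<1}" using sets_eq_imp_space_eq[OF sets] by (simp add: space_torus_borel)
      then have "(\<lambda>x. x) -` {-1<..1} \<inter> space (\<mu> n) = space (\<mu> n)" by auto
      then show ?thesis
        unfolding \<mu>'_def by (subst measure_distr[OF meas]) (simp_all add: prob_space.prob_space[OF prob])
    qed
    then show "\<exists>a b. a < b \<and> (\<forall>n. 1 - \<epsilon> < Sigma_Algebra.measure (\<mu>' n) {a<..b})"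
      using \<epsilon> by (intro exI[of _ "-1"] exI[of _ 1]) auto
  qed
  then obtain r M where r: "strict_mono r" and M: "real_distribution M" and wc: "weak_conv_m (\<mu>' \<circ> r) M"
    using tight_imp_convergent_subsubsequence[of \<mu>' id] by (auto simp: strict_mono_id)
  interpret M: real_distribution M by (rule M)
  \<comment> \<open>The limit on the line may charge the point 1, so it is folded back by
    \<open>frac\<close>; periodic test functions do not notice.\<close>
  define \<nu> where "\<nu> = distr M torus_borel frac"
  have frac: "frac \<in> measurable M torus_borel"
  proof -
    have "(frac :: real \<Rightarrow> real) \<in> borel_measurable borel" unfolding frac_def[abs_def]
      by (intro borel_measurable_diff borel_measurable_real_floor borel_measurable_continuous_onI[OF continuous_on_id])
    then have "frac \<in> measurable M borel" by (simp add: measurable_def M.events_eq_borel M.space_eq_univ)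
    then show ?thesis unfolding torus_borel_def
      by (intro measurable_restrict_space2) (auto simp: frac_ge_0 frac_lt_1)
  qed
  have "prob_space \<nu>" unfolding \<nu>_def by (rule M.prob_space_distr[OF frac])
  moreover have "sets \<nu> = sets torus_borel" by (simp add: \<nu>_def)
  moreover have "torus_weak_conv (\<lambda>n. \<mu> (r n)) \<nu>"
    unfolding torus_weak_conv_def
  proof (intro allI impI)
    fix \<phi> :: "real \<Rightarrow> real" assume \<phi>: "continuous_on UNIV \<phi> \<and> (\<forall>x. \<phi> (x + 1) = \<phi> x)"
    obtain C where C: "\<And>x. norm (\<phi> x) \<le> C" using periodic_bounded[of \<phi>] \<phi> by blast
    have "(\<lambda>n. integral\<^sup>L ((\<mu>' \<circ> r) n) \<phi>) \<longlonglongrightarrow> integral\<^sup>L M \<phi>"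
      by (rule weak_conv_imp_integral_bdd_continuous_conv[OF _ M wc _ C])
        (use rd \<phi> in \<open>auto simp: continuous_on_eq_continuous_at\<close>)
    moreover have "integral\<^sup>L ((\<mu>' \<circ> r) n) \<phi> = integral\<^sup>L (\<mu> (r n)) \<phi>" for n
      unfolding \<mu>'_def o_def using \<phi>
      by (subst integral_distr[OF meas]) (auto intro: borel_measurable_continuous_onI)
    moreover have "integral\<^sup>L \<nu> \<phi> = integral\<^sup>L M \<phi>"
      unfolding \<nu>_def using \<phi>
      by (subst integral_distr[OF frac continuous_torus_measurable[OF refl]])
        (auto simp: periodic_frac)
    ultimately show "(\<lambda>n. integral\<^sup>L (\<mu> (r n)) \<phi>) \<longlonglongrightarrow> integral\<^sup>L \<nu> \<phi>" by simp
  qed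
  ultimately show ?thesis using r by blast
qed

section \<open>The reduced family\<close>

lemma digits_prod_0 [simp]: "digits_prod k T 0 = Finite_Cartesian_Product.mat 1"
  by (simp add: digits_prod.simps)

lemma digits_prod_append:
  assumes "k \<ge> 2" "i < k" "m > 0 \<or> i > 0"
  shows "digits_prod k T (k * m + i) = digits_prod k T m ** T i"
  using assms by (subst digits_prod.simps) auto

lemma digits_prod_digit: "k \<ge> 2 \<Longrightarrow> 0 < i \<Longrightarrow> i < k \<Longrightarrow> digits_prod k T i = T i"
  using digits_prod_append[of k i 0 T] by simp

text \<open>The digit i, then m zeros, then the digits of n (none if n = 0) is again an expansion
  since i is nonzero. The induction strips the last digit of n. This is what closes the spanning set
  of the reduced space.\<close>

lemma digits_prod_prepend:
  assumes k: "k \<ge> 2" and i: "0 < i" "i < k"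
  shows "\<exists>n'\<ge>1. digits_prod k T n' = T i ** matpow (T 0) m ** digits_prod k T n"
proof (induction n rule: less_induct)
  case (less n)
  show ?case
  proof (cases "n = 0")
    case True
    have "\<exists>n'\<ge>1. digits_prod k T n' = T i ** matpow (T 0) m"
    proof (induction m)
      case 0
      then show ?case using digits_prod_digit[OF k i, of T] i by (intro exI[of _ i]) auto
    next
      case (Suc m)
      then obtain n' where n': "n' \<ge> 1" "digits_prod k T n' = T i ** matpow (T 0) m" by blast
      have "digits_prod k T (k * n' + 0) = T i ** matpow (T 0) (Suc m)"
        using k n' by (subst digits_prod_append) (auto simp: matpow_Suc2 matrix_mul_assoc)
      then show ?case using n'(1) k by (intro exI[of _ "k * n'"]) auto
    qed
    then show ?thesis using True by simp
  next
    case False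
    then have "n div k < n" using k by (intro div_less_dividend) auto
    then obtain n' where n': "n' \<ge> 1" "digits_prod k T n' = T i ** matpow (T 0) m ** digits_prod k T (n div k)"
      using less by blast
    have "n mod k < k" using k by simp
    have "n div k > 0 \<or> n mod k > 0" using False k by (metis div_mult_mod_eq gr0I mult_zero_left add_0)
    then have "digits_prod k T (k * (n div k) + n mod k) = digits_prod k T (n div k) ** T (n mod k)"
      by (rule digits_prod_append[OF k \<open>n mod k < k\<close>])
    then have dn: "digits_prod k T n = digits_prod k T (n div k) ** T (n mod k)" by simp
    have "digits_prod k T (k * n' + n mod k) = T i ** matpow (T 0) m ** digits_prod k T n"
      using n' by (subst digits_prod_append[OF k \<open>n mod k < k\<close>]) (auto simp: dn matrix_mul_assoc)
    moreover have "1 \<le> k * n'" using n'(1) k by simp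
    then have "1 \<le> k * n' + n mod k" by (rule trans_le_add1)
    ultimately show ?thesis by (intro exI[of _ "k * n' + n mod k"] conjI)
  qed
qed

text \<open>Groups the numbers with prefix m by the digit following m.\<close>

lemma sum_digit_split:
  fixes g :: "nat \<Rightarrow> 'a::comm_monoid_add"
  shows "(\<Sum>x<k ^ Suc j. g (m * k ^ Suc j + x)) = (\<Sum>i<k. \<Sum>x<k ^ j. g ((k * m + i) * k ^ j + x))"
proof -
  have "(\<Sum>x<k ^ Suc j. g (m * k ^ Suc j + x)) = (\<Sum>i<k. \<Sum>x\<in>{i * k ^ j..<i * k ^ j + k ^ j}. g (m * k ^ Suc j + x))"
    by (subst sum.nat_group) simp
  also have "\<dots> = (\<Sum>i<k. \<Sum>x<k ^ j. g ((k * m + i) * k ^ j + x))"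
  proof (rule sum.cong[OF refl])
    fix i
    have "(\<Sum>x\<in>{i * k ^ j..<i * k ^ j + k ^ j}. g (m * k ^ Suc j + x)) = (\<Sum>x<k ^ j. g (m * k ^ Suc j + (i * k ^ j + x)))"
      by (subst sum.atLeastLessThan_shift_0) (simp add: atLeast0LessThan)
    also have "\<dots> = (\<Sum>x<k ^ j. g ((k * m + i) * k ^ j + x))"
      by (intro sum.cong refl arg_cong[where f = g]) (simp add: algebra_simps)
    finally show "(\<Sum>x\<in>{i * k ^ j..<i * k ^ j + k ^ j}. g (m * k ^ Suc j + x)) = (\<Sum>x<k ^ j. g ((k * m + i) * k ^ j + x))" .
  qed
  finally show ?thesis .
qed

lemma sum_lessThan_add:
  fixes g :: "nat \<Rightarrow> 'a::comm_monoid_add"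
  shows "(\<Sum>x<a + b. g x) = (\<Sum>x<a. g x) + (\<Sum>x<b. g (a + x))"
  by (induction b) (simp_all add: add.assoc)

text \<open>Groups the numbers with j + 1 digits by their leading digit, which runs from 1 to k -
  1.\<close>

lemma sum_leading_digit_split:
  fixes g :: "nat \<Rightarrow> 'a::ab_group_add"
  assumes "k \<ge> 1"
  shows "(\<Sum>x<k ^ j * (k - 1). g (k ^ j + x)) = (\<Sum>i\<in>{1..<k}. \<Sum>x<k ^ j. g (i * k ^ j + x))"
proof -
  have kj: "k ^ Suc j = k ^ j + k ^ j * (k - 1)" using assms by (cases k) auto
  have "(\<Sum>x<k ^ Suc j. g x) = (\<Sum>x<k ^ j. g x) + (\<Sum>x<k ^ j * (k - 1). g (k ^ j + x))"
    unfolding kj by (rule sum_lessThan_add)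
  moreover have "(\<Sum>x<k ^ Suc j. g x) = (\<Sum>i<k. \<Sum>x<k ^ j. g (i * k ^ j + x))"
    using sum_digit_split[of g 0 k j] by simp
  moreover have "{..<k} = insert 0 {1..<k}" using assms by auto
  ultimately show ?thesis by simp
qed

lemma subspace_hat_space: "Real_Vector_Spaces.subspace (hat_space k u A v)"
  by (simp add: hat_space_def)

lemma vector_matrix_linear: "linear (\<lambda>x. x v* (M :: real^'n^'m))"
  by (rule linearI, simp add: vec_eq_iff vector_matrix_mult_def sum.distrib algebra_simps)
    (rule vector_matrix_scaleR)

lemma rep_space_row:
  assumes "m \<ge> 1"
  shows "u v* digits_prod k A m \<in> rep_space k u A"
  unfolding rep_space_def using assms by (intro span_base) blast

lemma rep_space_invariant:
  assumes "k \<ge> 2" "i < k" "x \<in> rep_space k u A"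
  shows "x v* A i \<in> rep_space k u A"
proof -
  let ?G = "{u v* digits_prod k A n | n. n \<ge> 1}"
  have "(\<lambda>x. x v* A i) ` Real_Vector_Spaces.span ?G = Real_Vector_Spaces.span ((\<lambda>x. x v* A i) ` ?G)"
    by (rule linear_span_image[OF vector_matrix_linear, symmetric])
  also have "\<dots> \<subseteq> rep_space k u A"
  proof (rule span_minimal[OF _ subspace_rep_space], rule image_subsetI)
    fix x assume "x \<in> ?G"
    then obtain n where n: "n \<ge> 1" "x = u v* digits_prod k A n" by blast
    have "x v* A i = u v* digits_prod k A (k * n + i)"
      using n assms(1,2) by (subst digits_prod_append) (auto simp: vector_matrix_mul_assoc)
    moreover have "1 \<le> k * n" using n(1) assms(1) by simp
    then have "u v* digits_prod k A (k * n + i) \<in> rep_space k u A"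
      by (intro rep_space_row trans_le_add1)
    ultimately show "x v* A i \<in> rep_space k u A" by simp
  qed
  finally show ?thesis using assms(3) unfolding rep_space_def by blast
qed

text \<open>Both projections in \<open>tilde\<close> can be moved onto the row, where they act
  trivially because V is invariant under right multiplication by the A i.\<close>

lemma rep_space_tilde:
  assumes "k \<ge> 2" "i < k" "x \<in> rep_space k u A"
  shows "inner (x v* A i) y = inner x (tilde k u A i *v y)"
proof -
  let ?P = "orth_proj (rep_space k u A)"
  note P = subspace_rep_space[of k u A]
  have "inner x (tilde k u A i *v y) = inner (?P *v x) (A i *v (?P *v y))"
    unfolding orth_proj_self_adjoint[OF P] by (simp add: tilde_def matrix_vector_mul_assoc matrix_mul_assoc)
  also have "\<dots> = inner (x v* A i) (?P *v y)"
    by (simp add: orth_proj_ident[OF P assms(3)] dot_lmul_matrix)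
  also have "\<dots> = inner (?P *v (x v* A i)) y" by (rule orth_proj_self_adjoint[OF P, symmetric])
  also have "\<dots> = inner (x v* A i) y"
    by (simp only: orth_proj_ident[OF P rep_space_invariant[OF assms]])
  finally show ?thesis ..
qed

lemma tilde_sum_eq: "tilde_sum k u A = (\<Sum>i<k. tilde k u A i)"
  by (simp add: tilde_sum_def tilde_def matrix_sum_mult_distrib matrix_mult_sum_distrib)

text \<open>On a generator, i = 0 lengthens the run of zeros, while a nonzero i absorbs that run
  into a longer number with an empty run in front.\<close>

lemma hat_space_invariant:
  assumes "k \<ge> 2" "i < k" "x \<in> hat_space k u A v"
  shows "tilde k u A i *v x \<in> hat_space k u A v"
proof -
  let ?T = "tilde k u A"
  let ?w = "\<lambda>h. phase_mult k u A h *v (limit_matrix k u A *v v)"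
  let ?G = "{matpow (?T 0) m *v (digits_prod k ?T n *v ?w h) | m n h. h \<in> phase_group k u A}"
  have "(\<lambda>x. ?T i *v x) ` Real_Vector_Spaces.span ?G = Real_Vector_Spaces.span ((\<lambda>x. ?T i *v x) ` ?G)"
    by (rule linear_span_image[OF matrix_vector_mul_linear, symmetric])
  also have "\<dots> \<subseteq> hat_space k u A v"
  proof (rule span_minimal[OF _ subspace_hat_space], rule image_subsetI)
    fix x assume "x \<in> ?G"
    then obtain m n h where x: "x = matpow (?T 0) m *v (digits_prod k ?T n *v ?w h)" "h \<in> phase_group k u A"
      by blast
    show "?T i *v x \<in> hat_space k u A v"
    proof (cases "i = 0")
      case True
      then have "?T i *v x = matpow (?T 0) (Suc m) *v (digits_prod k ?T n *v ?w h)"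
        by (simp only: x(1) matpow_vector_Suc)
      then show ?thesis unfolding hat_space_def using x(2) by (intro span_base) blast
    next
      case False
      then obtain n' where "digits_prod k ?T n' = ?T i ** matpow (?T 0) m ** digits_prod k ?T n"
        using digits_prod_prepend[OF assms(1) _ assms(2), of ?T m n] by auto
      then have "?T i *v x = matpow (?T 0) 0 *v (digits_prod k ?T n' *v ?w h)"
        by (simp only: x(1) matrix_vector_mul_assoc matrix_mul_assoc matpow_0 matrix_mul_lid)
      then show ?thesis unfolding hat_space_def using x(2) by (intro span_base) blast
    qed
  qed
  finally show ?thesis using assms(3) unfolding hat_space_def by blast
qed

lemma hat_in: "hat k u A v i *v x \<in> hat_space k u A v"
  unfolding hat_def matrix_vector_mul_assoc[symmetric] by (rule orth_proj_props[OF subspace_hat_space])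

lemma hat_proj: "hat k u A v i ** orth_proj (hat_space k u A v) = hat k u A v i"
  unfolding hat_def matrix_mul_assoc[symmetric] orth_proj_idem[OF subspace_hat_space] ..

lemma hat_eq_tilde:
  assumes "k \<ge> 2" "i < k" "x \<in> hat_space k u A v"
  shows "hat k u A v i *v x = tilde k u A i *v x"
  unfolding hat_def matrix_vector_mul_assoc[symmetric]
  by (simp only: orth_proj_ident[OF subspace_hat_space assms(3)] orth_proj_ident[OF subspace_hat_space hat_space_invariant[OF assms]])

text \<open>Coordinate functionals are represented by vectors and projected to the span, so that
  rows and columns live in the same subspace and can both be paired by \<open>inner\<close>.\<close>

lemma coordinate_functionals:
  fixes B :: "(real^'d) set"
  assumes indep: "Real_Vector_Spaces.independent B"
  defines "S \<equiv> Real_Vector_Spaces.span B"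
  obtains d :: "real^'d \<Rightarrow> real^'d" where "\<And>b. d b \<in> S"
    "\<And>b c. b \<in> B \<Longrightarrow> c \<in> B \<Longrightarrow> inner (d c) b = (if b = c then 1 else 0)"
    "\<And>x b. x \<in> S \<Longrightarrow> b \<in> B \<Longrightarrow> inner (d b) x = Real_Vector_Spaces.representation B x b"
    "\<And>x. x \<in> S \<Longrightarrow> (\<Sum>b\<in>B. inner (d b) x *\<^sub>R b) = x"
proof -
  have fin: "finite B" using indep by (rule independent_imp_finite)
  have S: "Real_Vector_Spaces.subspace S" by (simp add: S_def)
  have "\<exists>e. \<forall>b\<in>B. inner e b = (if b = c then 1 else 0)" for c
  proof -
    obtain g :: "real^'d \<Rightarrow> real" where g: "linear g" "\<forall>b\<in>B. g b = (if b = c then 1 else 0)"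
      using linear_independent_extend[OF indep, of "\<lambda>b. if b = c then 1 else 0"] by blast
    have "inner (adjoint g 1) b = g b" for b
      using adjoint_works[OF g(1), of b 1] by (simp add: inner_commute)
    then show ?thesis using g(2) by (intro exI[of _ "adjoint g 1"]) simp
  qed
  then obtain e where e: "\<And>b c. b \<in> B \<Longrightarrow> inner (e c) b = (if b = c then 1 else 0)" by metis
  define d where "d c = orth_proj S *v e c" for c
  have d_B: "inner (d c) b = (if b = c then 1 else 0)" if "b \<in> B" for b c
  proof -
    have "b \<in> S" using that by (simp add: S_def span_base)
    then show ?thesis
      unfolding d_def orth_proj_self_adjoint[OF S] by (simp add: orth_proj_ident[OF S] e that)
  qed
  have rep: "inner (d b) x = Real_Vector_Spaces.representation B x b" if "x \<in> S" "b \<in> B" for x b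
  proof -
    have "x = (\<Sum>c\<in>B. Real_Vector_Spaces.representation B x c *\<^sub>R c)"
      using that(1) by (intro real_vector.sum_representation_eq[symmetric]) (auto simp: indep fin S_def)
    then have "inner (d b) x = (\<Sum>c\<in>B. Real_Vector_Spaces.representation B x c * inner (d b) c)"
      by (metis (no_types, lifting) inner_scaleR_right inner_sum_right sum.cong)
    also have "\<dots> = (\<Sum>c\<in>B. if c = b then Real_Vector_Spaces.representation B x c else 0)"
      by (intro sum.cong) (auto simp: d_B)
    also have "\<dots> = Real_Vector_Spaces.representation B x b" using that(2) fin by simp
    finally show ?thesis .
  qed
  show thesis
  proof (rule that[of d])
    show "d b \<in> S" for b unfolding d_def by (rule orth_proj_props[OF S])
    show "(\<Sum>b\<in>B. inner (d b) x *\<^sub>R b) = x" if "x \<in> S" for x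
    proof -
      have "(\<Sum>b\<in>B. inner (d b) x *\<^sub>R b) = (\<Sum>c\<in>B. Real_Vector_Spaces.representation B x c *\<^sub>R c)"
        by (intro sum.cong refl) (simp add: rep that)
      also have "\<dots> = x"
        using that(1) by (intro real_vector.sum_representation_eq) (use that in \<open>auto simp: indep fin S_def\<close>)
      finally show ?thesis .
    qed
  qed (auto simp: d_B rep)
qed

section \<open>Block sums and growth in the reduced space\<close>

locale ghost_rep = nondegenerate_rep k u A Z Pr v
  for k and u :: "real^'d" and A Z Pr v +
  fixes f :: "nat \<Rightarrow> real"
  assumes k2: "k \<ge> 2" and f_nonneg: "\<And>n. f n \<ge> 0" and lin: "linear_representation k f u A v"
begin

abbreviation "S \<equiv> hat_space k u A v"
abbreviation "H \<equiv> hat k u A v"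
abbreviation "H_sum \<equiv> \<Sum>i<k. H i"

definition row :: "nat \<Rightarrow> real^'d" where "row m = u v* digits_prod k A m"

text \<open>A_0 is subtracted because the leading digit of a number in the block is nonzero.\<close>

definition total :: "real^'d \<Rightarrow> real" where "total x = inner u (((\<Sum>j<k. A j) - A 0) *v x)"

lemma total_bounded_linear: "bounded_linear total"
  unfolding total_def
  by (rule bounded_linear_compose[OF bounded_linear_inner_right matrix_vector_mul_bounded_linear])

lemma row_step: "m \<ge> 1 \<Longrightarrow> i < k \<Longrightarrow> row (k * m + i) = row m v* A i"
  using k2 by (simp add: row_def digits_prod_append vector_matrix_mul_assoc)

lemma row_tilde: "m \<ge> 1 \<Longrightarrow> i < k \<Longrightarrow> inner (row (k * m + i)) y = inner (row m) (tilde k u A i *v y)"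
  by (simp only: row_step) (rule rep_space_tilde[OF k2], simp, simp only: row_def, rule rep_space_row, simp)

lemma row_hat: "m \<ge> 1 \<Longrightarrow> i < k \<Longrightarrow> y \<in> S \<Longrightarrow> inner (row (k * m + i)) y = inner (row m) (H i *v y)"
  by (simp only: row_tilde hat_eq_tilde[OF k2])

lemma k_times_ge: "m \<ge> 1 \<Longrightarrow> k * m + i \<ge> 1"
proof (rule trans_le_add1)
  show "1 \<le> k * m" if "m \<ge> 1" using that k2 by simp
qed

text \<open>Summing over all j-digit continuations of m turns the digit matrices into powers of
  their sum. As m >= 1 the row lies in V, so \<open>tilde\<close> may replace A.\<close>

lemma block_f: "m \<ge> 1 \<Longrightarrow> (\<Sum>x<k ^ j. f (m * k ^ j + x)) = inner (row m) (matpow M j *v v)"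
proof (induction j arbitrary: m)
  case 0
  have "f m = inner u (digits_prod k A m *v v)" using lin by (simp add: linear_representation_def)
  then show ?case by (simp add: row_def dot_lmul_matrix)
next
  case (Suc j)
  have "(\<Sum>x<k ^ Suc j. f (m * k ^ Suc j + x)) = (\<Sum>i<k. inner (row (k * m + i)) (matpow M j *v v))"
    unfolding sum_digit_split using Suc.IH[OF k_times_ge[OF Suc.prems]] by (intro sum.cong refl) blast
  also have "\<dots> = (\<Sum>i<k. inner (row m) (tilde k u A i *v (matpow M j *v v)))"
    by (intro sum.cong refl row_tilde Suc.prems) simp
  also have "\<dots> = inner (row m) (matpow M (Suc j) *v v)"
    by (simp add: matpow_vector_Suc tilde_sum_eq matrix_sum_vector_mult inner_sum_right)
  finally show ?case .
qed

lemma block_sum_shift: "block_sum k f N = (\<Sum>x<k ^ N * (k - 1). f (k ^ N + x))"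
proof -
  have "k ^ (N + 1) - k ^ N = k ^ N * (k - 1)" by (simp add: algebra_simps)
  then show ?thesis
    unfolding block_sum_def by (subst sum.atLeastLessThan_shift_0) (simp add: atLeast0LessThan)
qed

lemma block_sum_total: "block_sum k f N = total (matpow M N *v v)"
proof -
  let ?y = "matpow M N *v v"
  have "block_sum k f N = (\<Sum>i\<in>{1..<k}. \<Sum>x<k ^ N. f (i * k ^ N + x))"
    unfolding block_sum_shift by (rule sum_leading_digit_split) (use k2 in simp)
  also have "\<dots> = (\<Sum>i\<in>{1..<k}. inner u (A i *v ?y))"
  proof (rule sum.cong[OF refl])
    fix i assume i: "i \<in> {1..<k}"
    then show "(\<Sum>x<k ^ N. f (i * k ^ N + x)) = inner u (A i *v ?y)"
      by (simp add: block_f row_def digits_prod_digit[OF k2] dot_lmul_matrix)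
  qed
  also have "\<dots> = total ?y"
  proof -
    have "{..<k} = insert 0 {1..<k}" using k2 by auto
    then have "(\<Sum>j<k. A j) - A 0 = (\<Sum>j\<in>{1..<k}. A j)" by simp
    then show ?thesis by (simp add: total_def matrix_sum_vector_mult inner_sum_right)
  qed
  finally show ?thesis .
qed

abbreviation "sv n \<equiv> scale n *\<^sub>R (matpow M n *v v)"

lemma total_sv: "total (sv n) = scale n * block_sum k f n"
  unfolding block_sum_total by (simp add: linear_cmul[OF bounded_linear.linear[OF total_bounded_linear]])

lemma total_sv_lower:
  obtains \<epsilon> where "\<epsilon> > 0" "\<forall>\<^sub>F n in sequentially. total (sv n) \<ge> \<epsilon>"
proof -
  from asymp_positive obtain \<epsilon> where \<epsilon>: "\<epsilon> > 0" "\<forall>n. total (asymp n) \<ge> \<epsilon>"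
    unfolding total_def by (elim exE conjE)
  have "(\<lambda>n. total (sv n - asymp n)) \<longlonglongrightarrow> total 0"
    by (rule bounded_linear.tendsto[OF total_bounded_linear scaled_power_asymp])
  then have "(\<lambda>n. total (sv n) - total (asymp n)) \<longlonglongrightarrow> 0"
    by (simp only: linear_diff[OF bounded_linear.linear[OF total_bounded_linear]]
        linear_0[OF bounded_linear.linear[OF total_bounded_linear]])
  then have "\<forall>\<^sub>F n in sequentially. total (sv n) - total (asymp n) > - \<epsilon> / 2"
    using \<epsilon>(1) by (intro order_tendstoD) auto
  then have "\<forall>\<^sub>F n in sequentially. total (sv n) \<ge> \<epsilon> / 2"
  proof eventually_elim
    case (elim n)
    then show ?case using \<epsilon>(2)[rule_format, of n] by simp
  qed
  then show thesis using \<epsilon>(1) by (intro that[of "\<epsilon> / 2"]) auto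
qed

lemma eventually_block_sum_pos: "\<forall>\<^sub>F n in sequentially. block_sum k f n > 0"
proof (rule total_sv_lower)
  fix \<epsilon> :: real assume "\<epsilon> > 0" and ev: "\<forall>\<^sub>F n in sequentially. total (sv n) \<ge> \<epsilon>"
  show ?thesis using ev eventually_ge_at_top[of 1]
  proof eventually_elim
    case (elim n)
    then have "scale n * block_sum k f n > 0" using \<open>\<epsilon> > 0\<close> unfolding total_sv by linarith
    then show ?case using scale_pos[of n] elim by (simp add: zero_less_mult_iff)
  qed
qed

text \<open>\<open>total\<close> is a bounded functional that stays away from 0 on the
  profile.\<close>

lemma asymp_lower: obtains c where "c > 0" "\<And>n. norm (asymp n) \<ge> c"
proof -
  from asymp_positive obtain \<epsilon> where \<epsilon>: "\<epsilon> > 0" "\<forall>n. total (asymp n) \<ge> \<epsilon>"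
    unfolding total_def by (elim exE conjE)
  from bounded_linear.pos_bounded[OF total_bounded_linear] obtain Q
    where Q: "Q > 0" "\<forall>x. norm (total x) \<le> norm x * Q" by (elim exE conjE)
  have "norm (asymp n) \<ge> \<epsilon> / Q" for n
  proof -
    have "\<epsilon> \<le> norm (asymp n) * Q" using \<epsilon>(2)[rule_format, of n] Q(2)[rule_format, of "asymp n"] by simp
    then show ?thesis using Q(1) by (simp add: pos_divide_le_eq)
  qed
  then show thesis using \<epsilon>(1) Q(1) by (intro that[of "\<epsilon> / Q"]) auto
qed

lemma S_nonzero: "S \<noteq> {0}"
proof (rule asymp_lower)
  fix c :: real assume "c > 0" and c: "\<And>n. norm (asymp n) \<ge> c"
  show ?thesis
  proof
    assume "S = {0}"
    then have "asymp 0 = 0" using asymp_in_hat_space[of 0] by simp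
    then show False using c[of 0] \<open>c > 0\<close> by simp
  qed
qed

lemma H_sum_eq: "x \<in> S \<Longrightarrow> H_sum *v x = M *v x"
  unfolding tilde_sum_eq matrix_sum_vector_mult
  by (intro sum.cong refl) (simp add: hat_eq_tilde[OF k2])

lemma H_sum_in: "H_sum *v x \<in> S"
  unfolding matrix_sum_vector_mult by (intro subspace_sum subspace_hat_space hat_in)

lemma H_sum_pow: "x \<in> S \<Longrightarrow> matpow M n *v x \<in> S \<and> (((*v) H_sum) ^^ n) x = matpow M n *v x"
proof (induction n)
  case (Suc n)
  then show ?case using H_sum_in[of "matpow M n *v x"] by (simp add: matpow_vector_Suc H_sum_eq)
qed simp

text \<open>\<open>M ^ n\<close> maps \<open>asymp m\<close> to almost \<open>\<rho> ^ n *\<^sub>R asymp (m + n)\<close> for large \<open>m\<close>.\<close>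

lemma growth:
  obtains c where "c > 0" "\<And>n. \<exists>x\<in>S. norm x > 0 \<and> c * \<rho> ^ n * norm x \<le> norm ((((*v) H_sum) ^^ n) x)"
proof (rule asymp_lower)
  fix c0 :: real assume c0: "c0 > 0" and lower: "\<And>n. norm (asymp n) \<ge> c0"
  from asymp_bounded obtain C where C: "\<forall>n. norm (asymp n) \<le> C" ..
  have C0: "C > 0" using C[rule_format, of 0] lower[of 0] c0 by linarith
  \<comment> \<open>Half the ratio of the lower to the upper norm bound of \<open>asymp\<close>; the
    lost factor 2 absorbs the approximation error.\<close>
  define c where "c = c0 / (2 * C)"
  have "\<exists>x\<in>S. norm x > 0 \<and> c * \<rho> ^ n * norm x \<le> norm ((((*v) H_sum) ^^ n) x)" for n
  proof -
    have ratio: "(\<lambda>m. scale m / scale (m + n)) \<longlonglongrightarrow> \<rho> ^ n"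
    proof -
      have "(\<lambda>m. inverse (scale (m + n) / scale m)) \<longlonglongrightarrow> inverse (1 / \<rho> ^ n)"
        using \<rho>_pos by (intro tendsto_inverse scale_ratio) simp
      then show ?thesis by (simp add: inverse_eq_divide)
    qed
    have diff0: "(\<lambda>m. sv (m + n) - asymp (m + n)) \<longlonglongrightarrow> 0"
      using LIMSEQ_ignore_initial_segment[OF scaled_power_asymp, of n] .
    have 1: "(\<lambda>m. matpow M n *v (asymp m - sv m)) \<longlonglongrightarrow> matpow M n *v 0"
    proof (rule bounded_linear.tendsto[OF matrix_vector_mul_bounded_linear])
      show "(\<lambda>m. asymp m - sv m) \<longlonglongrightarrow> 0" using tendsto_minus[OF scaled_power_asymp] by simp
    qed
    have 2: "(\<lambda>m. (scale m / scale (m + n)) *\<^sub>R (sv (m + n) - asymp (m + n))) \<longlonglongrightarrow> \<rho> ^ n *\<^sub>R 0"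
      by (intro tendsto_scaleR ratio diff0)
    have 3: "(\<lambda>m. (scale m / scale (m + n) - \<rho> ^ n) *\<^sub>R asymp (m + n)) \<longlonglongrightarrow> 0"
    proof (rule Lim_null_comparison)
      have "(\<lambda>m. \<bar>scale m / scale (m + n) - \<rho> ^ n\<bar> * C) \<longlonglongrightarrow> 0 * C"
        by (intro tendsto_mult tendsto_const tendsto_rabs_zero LIM_zero ratio)
      then show "(\<lambda>m. \<bar>scale m / scale (m + n) - \<rho> ^ n\<bar> * C) \<longlonglongrightarrow> 0" by simp
      show "\<forall>\<^sub>F m in sequentially. norm ((scale m / scale (m + n) - \<rho> ^ n) *\<^sub>R asymp (m + n)) \<le> \<bar>scale m / scale (m + n) - \<rho> ^ n\<bar> * C"
        using C by (intro always_eventually allI) (simp add: mult_left_mono)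
    qed
    \<comment> \<open>The three errors come from replacing \<open>asymp m\<close> by the normalised
      power, from going back at index m + n, and from the ratio of the two scales.\<close>
    have sum: "matpow M n *v asymp m - \<rho> ^ n *\<^sub>R asymp (m + n) =
        matpow M n *v (asymp m - sv m) + (scale m / scale (m + n)) *\<^sub>R (sv (m + n) - asymp (m + n)) +
        (scale m / scale (m + n) - \<rho> ^ n) *\<^sub>R asymp (m + n)" if m: "m \<ge> 1" for m
    proof -
      have "matpow M n *v sv m = scale m *\<^sub>R (matpow M (n + m) *v v)"
        by (simp only: matrix_vector_mult_scaleR matpow_add matrix_vector_mul_assoc)
      also have "\<dots> = (scale m / scale (m + n)) *\<^sub>R sv (m + n)"
        using scale_pos[of "m + n"] m by (simp add: add.commute)
      finally have "matpow M n *v sv m = (scale m / scale (m + n)) *\<^sub>R sv (m + n)" .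
      then show ?thesis
        by (simp only: matrix_vector_mult_diff_distrib scaleR_diff_right scaleR_diff_left) simp
    qed
    have "(\<lambda>m. matpow M n *v asymp m - \<rho> ^ n *\<^sub>R asymp (m + n)) \<longlonglongrightarrow> 0"
    proof (rule Lim_transform_eventually)
      show "(\<lambda>m. matpow M n *v (asymp m - sv m) + (scale m / scale (m + n)) *\<^sub>R (sv (m + n) - asymp (m + n)) +
        (scale m / scale (m + n) - \<rho> ^ n) *\<^sub>R asymp (m + n)) \<longlonglongrightarrow> 0"
        using tendsto_add[OF tendsto_add[OF 1 2] 3] by simp
      show "\<forall>\<^sub>F m in sequentially. matpow M n *v (asymp m - sv m) + (scale m / scale (m + n)) *\<^sub>R (sv (m + n) - asymp (m + n)) +
        (scale m / scale (m + n) - \<rho> ^ n) *\<^sub>R asymp (m + n) = matpow M n *v asymp m - \<rho> ^ n *\<^sub>R asymp (m + n)"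
        using eventually_ge_at_top[of 1] by eventually_elim (rule sum[symmetric])
    qed
    then have "(\<lambda>m. norm (matpow M n *v asymp m - \<rho> ^ n *\<^sub>R asymp (m + n))) \<longlonglongrightarrow> 0"
      by (rule tendsto_norm_zero)
    then have "\<forall>\<^sub>F m in sequentially. norm (matpow M n *v asymp m - \<rho> ^ n *\<^sub>R asymp (m + n)) < \<rho> ^ n * c0 / 2"
      by (rule order_tendstoD) (use \<rho>_pos c0 in simp)
    then obtain m where m: "norm (matpow M n *v asymp m - \<rho> ^ n *\<^sub>R asymp (m + n)) < \<rho> ^ n * c0 / 2"
      by (auto dest: eventually_happens'[OF sequentially_bot])
    have "\<rho> ^ n * norm (asymp (m + n)) \<le> norm (matpow M n *v asymp m) + norm (matpow M n *v asymp m - \<rho> ^ n *\<^sub>R asymp (m + n))"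
      using norm_triangle_ineq4[of "matpow M n *v asymp m" "matpow M n *v asymp m - \<rho> ^ n *\<^sub>R asymp (m + n)"] \<rho>_pos by simp
    moreover have "\<rho> ^ n * c0 \<le> \<rho> ^ n * norm (asymp (m + n))" using lower \<rho>_pos by (intro mult_left_mono) auto
    ultimately have "\<rho> ^ n * c0 / 2 \<le> norm (matpow M n *v asymp m)" using m by linarith
    moreover have "c * \<rho> ^ n * norm (asymp m) \<le> c * \<rho> ^ n * C"
      using C \<rho>_pos c0 C0 by (intro mult_left_mono) (auto simp: c_def)
    moreover have "c * \<rho> ^ n * C = \<rho> ^ n * c0 / 2" using C0 by (simp add: c_def)
    ultimately have "c * \<rho> ^ n * norm (asymp m) \<le> norm ((((*v) H_sum) ^^ n) (asymp m))"
      using H_sum_pow[OF asymp_in_hat_space] by simp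
    moreover have "norm (asymp m) > 0" using lower[of m] c0 by linarith
    ultimately show ?thesis using asymp_in_hat_space by (intro bexI[of _ "asymp m"] conjI)
  qed
  moreover have "c > 0" using c0 C0 by (simp add: c_def)
  ultimately show thesis by (intro that[of c])
qed

lemma matpow_funpow: "matpow X n *v x = (((*v) X) ^^ n) x"
  by (induction n) (simp_all add: matpow_vector_Suc)

text \<open>Upper bound: an eigenvector for a nonzero eigenvalue lies in the range, hence in the
  complexified reduced space, where the sum agrees with M. Lower bound: a smaller spectral radius
  would contradict \<open>growth\<close>.\<close>

lemma spec_rad_hat_sum: "spec_rad H_sum = \<rho>"
proof (rule order_antisym)
  from spec_rad_attained[of H_sum] obtain z where z: "z \<in> spectrum (to_complex_mat H_sum)" "cmod z = spec_rad H_sum" ..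
  show "spec_rad H_sum \<le> \<rho>"
  proof (cases "z = 0")
    case True
    then show ?thesis using z \<rho>_pos by simp
  next
    case False
    from z(1) obtain x where x: "x \<noteq> 0" "cmat H_sum *v x = z *s x" unfolding spectrum_iff by (elim exE conjE)
    have "cmat H_sum *v x \<in> complexified S" by (rule complexified_cmat) (rule H_sum_in)
    then have "inverse z *s (z *s x) \<in> complexified S"
      unfolding x(2) by (rule complexified_smult[OF subspace_hat_space])
    then have xS: "x \<in> complexified S" using False by (simp add: vector_smult_assoc)
    then have re: "H_sum *v (\<chi> i. Re (x $ i)) = M *v (\<chi> i. Re (x $ i))"
      and im: "H_sum *v (\<chi> i. Im (x $ i)) = M *v (\<chi> i. Im (x $ i))"
      by (simp_all add: complexified_def H_sum_eq)
    have "cmat M *v x = cmat H_sum *v x"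
    proof (subst complex_vector_decomp[of "cmat M *v x"], subst complex_vector_decomp[of "cmat H_sum *v x"])
      show "cvec (\<chi> i. Re ((cmat M *v x) $ i)) + \<i> *s cvec (\<chi> i. Im ((cmat M *v x) $ i)) =
        cvec (\<chi> i. Re ((cmat H_sum *v x) $ i)) + \<i> *s cvec (\<chi> i. Im ((cmat H_sum *v x) $ i))"
        by (simp only: Re_cmat_mult Im_cmat_mult re im)
    qed
    then have "z \<in> spectrum (to_complex_mat M)" unfolding spectrum_iff using x by (intro exI[of _ x]) simp
    from cmod_le_spec_rad[OF this] show ?thesis using z(2) by simp
  qed
next
  show "\<rho> \<le> spec_rad H_sum"
  proof (rule ccontr, rule growth)
    assume less: "\<not> \<rho> \<le> spec_rad H_sum"
    fix c :: real assume c: "c > 0" and growth: "\<And>n. \<exists>x\<in>S. norm x > 0 \<and> c * \<rho> ^ n * norm x \<le> norm ((((*v) H_sum) ^^ n) x)"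
    let ?d = "real CARD('d)"
    \<comment> \<open>Chosen so that an entrywise bound e gives the operator bound c / 2, half of
      what \<open>growth\<close> demands.\<close>
    define e where "e = c / (2 * (?d * ?d))"
    have e: "e > 0" using c by (simp add: e_def)
    have "\<forall>\<^sub>F n in sequentially. \<forall>i\<in>UNIV. \<forall>j\<in>UNIV. \<bar>((1 / \<rho> ^ n) *\<^sub>R matpow H_sum n) $ i $ j\<bar> \<le> e"
    proof (intro eventually_ball_finite ballI finite)
      fix i j :: 'd
      have "(\<lambda>n. (1 / \<rho> ^ n) *\<^sub>R (matpow H_sum n *v axis j 1)) \<longlonglongrightarrow> 0"
        by (rule matpow_decay) (use less in simp)
      then have "(\<lambda>n. \<bar>((1 / \<rho> ^ n) *\<^sub>R (matpow H_sum n *v axis j 1)) $ i\<bar>) \<longlonglongrightarrow> \<bar>0 $ i\<bar>"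
        by (intro tendsto_rabs tendsto_vec_nth)
      moreover have eq: "((1 / \<rho> ^ n) *\<^sub>R (matpow H_sum n *v axis j 1)) $ i = ((1 / \<rho> ^ n) *\<^sub>R matpow H_sum n) $ i $ j" for n
        by (simp add: matrix_vector_mult_def axis_def if_distrib[where f = "\<lambda>x. y * x" for y] cong: if_cong)
      ultimately have "(\<lambda>n. \<bar>((1 / \<rho> ^ n) *\<^sub>R matpow H_sum n) $ i $ j\<bar>) \<longlonglongrightarrow> 0"
        by (simp only: eq zero_index abs_zero)
      then have "\<forall>\<^sub>F n in sequentially. \<bar>((1 / \<rho> ^ n) *\<^sub>R matpow H_sum n) $ i $ j\<bar> < e" using e by (rule order_tendstoD)
      then show "\<forall>\<^sub>F n in sequentially. \<bar>((1 / \<rho> ^ n) *\<^sub>R matpow H_sum n) $ i $ j\<bar> \<le> e"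
        by (rule eventually_mono) simp
    qed
    from eventually_happens'[OF sequentially_bot this] obtain n
      where n: "\<forall>i\<in>UNIV. \<forall>j\<in>UNIV. \<bar>((1 / \<rho> ^ n) *\<^sub>R matpow H_sum n) $ i $ j\<bar> \<le> e" ..
    from growth[of n] obtain x where x: "norm x > 0" "c * \<rho> ^ n * norm x \<le> norm ((((*v) H_sum) ^^ n) x)"
      by (elim bexE conjE)
    have "norm (((1 / \<rho> ^ n) *\<^sub>R matpow H_sum n) *v x) \<le> ?d * ?d * e * norm x"
      by (rule norm_matrix_vector_le) (use n in blast)
    also have "((1 / \<rho> ^ n) *\<^sub>R matpow H_sum n) *v x = (1 / \<rho> ^ n) *\<^sub>R (matpow H_sum n *v x)"
      by (rule scaleR_matrix_vector_assoc[symmetric])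
    also have "norm \<dots> = norm ((((*v) H_sum) ^^ n) x) / \<rho> ^ n" using \<rho>_pos by (simp add: matpow_funpow)
    finally have "norm ((((*v) H_sum) ^^ n) x) \<le> ?d * ?d * e * norm x * \<rho> ^ n"
      using \<rho>_pos by (simp add: pos_divide_le_eq)
    also have "?d * ?d * e = c / 2" by (simp add: e_def)
    finally have "c * \<rho> ^ n * norm x \<le> c / 2 * norm x * \<rho> ^ n" using x(2) by linarith
    moreover have "c * \<rho> ^ n * norm x > 0" using c x(1) \<rho>_pos by simp
    ultimately show False by (simp add: mult_ac)
  qed
qed

lemma jsr_lower: "\<rho> / real k \<le> joint_spectral_radius k H"
proof (rule growth)
  fix c :: real assume c: "c > 0" and growth: "\<And>n. \<exists>x\<in>S. norm x > 0 \<and> c * \<rho> ^ n * norm x \<le> norm ((((*v) H_sum) ^^ n) x)"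
  show ?thesis
    by (rule joint_spectral_radius_ge[OF _ _ c]) (use k2 \<rho>_pos growth in \<open>auto intro: less_imp_le\<close>)
qed

lemma H_sum_nonzero: "\<exists>x\<in>S. H_sum *v x \<noteq> 0"
proof (rule growth)
  fix c :: real assume c: "c > 0" and gr: "\<And>n. \<exists>x\<in>S. norm x > 0 \<and> c * \<rho> ^ n * norm x \<le> norm ((((*v) H_sum) ^^ n) x)"
  from gr[of 1] obtain x where x: "x \<in> S" "norm x > 0" "c * \<rho> ^ 1 * norm x \<le> norm ((((*v) H_sum) ^^ 1) x)"
    by (elim bexE conjE)
  have "c * \<rho> ^ 1 * norm x > 0" using c x(2) \<rho>_pos by simp
  from less_le_trans[OF this x(3)] have "norm (H_sum *v x) > 0" by simp
  then show ?thesis using x(1) by (intro bexI[of _ x]) auto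
qed

end

section \<open>Ghost measures\<close>

text \<open>
  \<open>cyl_row k T e m\<close> is \<open>e\<close> times the product of the matrices of all digits of \<open>m\<close> but the leading
  one. The guard \<open>k < 2\<close> only serves termination.
\<close>

function cyl_row :: "nat \<Rightarrow> (nat \<Rightarrow> real^'d^'d) \<Rightarrow> real^'d \<Rightarrow> nat \<Rightarrow> real^'d" where
  "cyl_row k T e m = (if m < k \<or> k < 2 then e else cyl_row k T e (m div k) v* T (m mod k))"
  by auto
termination by (relation "Wellfounded.measure (\<lambda>(k, T, e, m). m)") auto

declare cyl_row.simps [simp del]

lemma cyl_row_less: "m < k \<Longrightarrow> cyl_row k T e m = e"
  by (simp add: cyl_row.simps)

lemma cyl_row_step: "k \<ge> 2 \<Longrightarrow> m \<ge> 1 \<Longrightarrow> i < k \<Longrightarrow> cyl_row k T e (k * m + i) = cyl_row k T e m v* T i"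
proof -
  assume k: "k \<ge> 2" and m: "m \<ge> 1" and i: "i < k"
  have "k \<le> k * m" using m by simp
  then have "k \<le> k * m + i" by (rule trans_le_add1)
  then have "\<not> (k * m + i < k \<or> k < 2)" using k by linarith
  moreover have "(k * m + i) div k = m" "(k * m + i) mod k = i" using i by auto
  ultimately show ?thesis by (subst cyl_row.simps) (simp only: if_False)
qed

lemma digit_induct [consumes 1, case_names digit step]:
  fixes k m :: nat
  assumes k: "k \<ge> 2" and digit: "\<And>m. m < k \<Longrightarrow> P m"
    and step: "\<And>m i. m \<ge> 1 \<Longrightarrow> i < k \<Longrightarrow> P m \<Longrightarrow> P (k * m + i)"
  shows "P m"
proof (induction m rule: less_induct)
  case (less m)
  show ?case
  proof (cases "m < k")
    case True
    then show ?thesis by (rule digit)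
  next
    case False
    then have 1: "m div k \<ge> 1" using k by (simp add: Suc_le_eq div_greater_zero_iff)
    have "m div k < m" using False k by (intro div_less_dividend) auto
    then have "P (k * (m div k) + m mod k)" using k by (intro step 1 less) auto
    then show ?thesis by simp
  qed
qed

text \<open>A number with L + 1 digits leaves a word of length L after its leading digit, so norm
  bounds on products of length L apply.\<close>

lemma cyl_row_word:
  assumes "k \<ge> 2" "k ^ L \<le> m" "m < k ^ Suc L"
  shows "\<exists>w\<in>words k L. cyl_row k T e m = e v* word_prod T w"
  using assms(2,3)
proof (induction L arbitrary: m)
  case 0
  then show ?case by (intro bexI[of _ "[]"]) (auto simp: cyl_row_less words_def)
next
  case (Suc L)
  have k0: "k > 0" using assms(1) by simp
  have "k ^ L \<le> m div k" using Suc.prems(1) k0 by (simp add: less_eq_div_iff_mult_less_eq mult.commute)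
  moreover have "m div k < k ^ Suc L" using Suc.prems(2) k0 by (simp add: div_less_iff_less_mult mult.commute)
  ultimately obtain w where w: "w \<in> words k L" "cyl_row k T e (m div k) = e v* word_prod T w"
    using Suc.IH by blast
  have "1 \<le> k ^ L" using k0 by simp
  then have "m div k \<ge> 1" using \<open>k ^ L \<le> m div k\<close> by linarith
  then have "cyl_row k T e (k * (m div k) + m mod k) = cyl_row k T e (m div k) v* T (m mod k)"
    by (intro cyl_row_step assms(1)) (use k0 in auto)
  then have "cyl_row k T e m = e v* word_prod T (w @ [m mod k])"
    by (simp add: w(2) word_prod_append word_prod_Cons vector_matrix_mul_assoc)
  moreover have "w @ [m mod k] \<in> words k (Suc L)" using w(1) k0 by (auto simp: words_def)
  ultimately show ?case by blast
qed

lemma prob_space_block_measure: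
  assumes pos: "block_sum k f N > 0" and f: "\<And>n. f n \<ge> 0" and k: "k \<ge> 2"
  shows "prob_space (block_measure k f N)"
    and "\<phi> \<in> borel_measurable torus_borel \<Longrightarrow> integral\<^sup>L (block_measure k f N) \<phi> =
      (\<Sum>x<k ^ N * (k - 1). f (k ^ N + x) / block_sum k f N * \<phi> (real x / real (k ^ N * (k - 1))))"
proof -
  have K: "k ^ (N + 1) - k ^ N = k ^ N * (k - 1)" by (simp add: algebra_simps)
  define K where "K = k ^ N * (k - 1)"
  let ?p = "\<lambda>m. f (k ^ N + m) / block_sum k f N"
  let ?X = "{..<K}" and ?g = "\<lambda>m. real m / real K"
  have p: "?p m \<ge> 0" for m using pos f by (simp add: less_imp_le)
  have meas: "?g \<in> measurable (point_measure ?X (\<lambda>m. ennreal (?p m))) torus_borel"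
  proof (rule measurableI)
    fix x assume "x \<in> space (point_measure ?X (\<lambda>m. ennreal (?p m)))"
    then have "x < K" by (simp add: space_point_measure)
    then show "?g x \<in> space torus_borel" unfolding space_torus_borel by (simp add: divide_less_eq)
  qed (auto simp: sets_point_measure space_point_measure)
  have sum1: "(\<Sum>m\<in>?X. ?p m) = 1"
    unfolding sum_divide_distrib[symmetric]
  proof -
    have "(\<Sum>m\<in>?X. f (k ^ N + m)) = block_sum k f N"
      unfolding block_sum_def K_def K[symmetric] by (subst sum.atLeastLessThan_shift_0) (simp add: atLeast0LessThan)
    then show "(\<Sum>m\<in>?X. f (k ^ N + m)) / block_sum k f N = 1" using pos by simp
  qed
  have "prob_space (point_measure ?X (\<lambda>m. ennreal (?p m)))"
  proof (rule prob_spaceI)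
    have "emeasure (point_measure ?X (\<lambda>m. ennreal (?p m))) ?X = (\<Sum>m\<in>?X. ennreal (?p m))"
      by (rule emeasure_point_measure_finite) auto
    also have "\<dots> = 1" by (subst sum_ennreal) (use p sum1 in auto)
    finally show "emeasure (point_measure ?X (\<lambda>m. ennreal (?p m))) (space (point_measure ?X (\<lambda>m. ennreal (?p m)))) = 1"
      by (simp add: space_point_measure)
  qed
  then show "prob_space (block_measure k f N)"
    unfolding block_measure_def K K_def[symmetric] by (rule prob_space.prob_space_distr[OF _ meas])
  assume \<phi>: "\<phi> \<in> borel_measurable torus_borel"
  show "integral\<^sup>L (block_measure k f N) \<phi> =
      (\<Sum>x<k ^ N * (k - 1). f (k ^ N + x) / block_sum k f N * \<phi> (real x / real (k ^ N * (k - 1))))"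
    unfolding block_measure_def K K_def[symmetric]
    by (subst integral_distr[OF meas \<phi>], subst lebesgue_integral_point_measure_finite) (use p in auto)
qed

section \<open>Bounds on cylinder masses\<close>

locale positive_ghost_rep =
  ghost_rep k u A Z Pr v f + positive_family k "hat k u A v" "hat_space k u A v" B d
  for k and u :: "real^'d" and A Z Pr v f B d +
  fixes y :: "real^'d" and c :: real
  assumes y_S: "y \<in> hat_space k u A v" and Hy: "(\<Sum>i<k. hat k u A v i) *v y = c *\<^sub>R y"
    and y_pos: "\<And>b. b \<in> B \<Longrightarrow> inner (d b) y > 0"
    and jsr_less: "joint_spectral_radius k (hat k u A v) < spec_rad (tilde_sum k u A)"
begin

abbreviation "zrow \<equiv> cyl_row k H coord_sum"
abbreviation "K L \<equiv> k ^ L * (k - 1)"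

lemma K_pos: "K L > 0"
  using k2 by simp

lemma K_at_top: "filterlim K at_top sequentially"
proof -
  have "L \<le> K L" for L
  proof -
    have "L < 2 ^ L" by (rule less_exp)
    also have "\<dots> \<le> k ^ L" using k2 by (rule power_mono) simp
    also have "\<dots> \<le> K L" using k2 by simp
    finally show ?thesis by simp
  qed
  then show ?thesis by (intro filterlim_at_top_mono[OF filterlim_ident always_eventually] allI)
qed

lemma y_nonzero: "y \<noteq> 0"
  using B_nonempty y_pos by fastforce

lemma c_le_\<rho>: "c \<le> \<rho>"
proof -
  have "cmat H_sum *v cvec y = complex_of_real c *s cvec y"
    by (simp add: cmat_cvec Hy) (simp add: vec_eq_iff)
  moreover have "cvec y \<noteq> 0" using y_nonzero by (auto simp: vec_eq_iff)
  ultimately have "complex_of_real c \<in> spectrum (to_complex_mat H_sum)"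
    unfolding spectrum_iff by (intro exI conjI)
  from cmod_le_spec_rad[OF this] show ?thesis unfolding spec_rad_hat_sum by simp
qed

lemma zrow_dual_cone: "zrow m \<in> dual_cone"
  using k2
proof (induction m rule: digit_induct)
  case (digit m)
  then show ?case by (simp add: cyl_row_less coord_sum_dual_cone)
next
  case (step m i)
  then show ?case using k2 by (simp add: cyl_row_step transpose_T_dual_cone)
qed

text \<open>One constant handles all one-digit rows on the cone; each further digit preserves the
  inequality, because H i maps the cone into itself and acts identically on both rows.\<close>

lemma row_le_zrow:
  obtains C where "C \<ge> 0" "\<And>m x. m \<ge> 1 \<Longrightarrow> x \<in> pos_cone \<Longrightarrow> \<bar>inner (row m) x\<bar> \<le> C * inner (zrow m) x"
proof -
  define C where "C = (\<Sum>m<k. \<Sum>b\<in>B. \<bar>inner (row m) b\<bar>)"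
  have C: "\<bar>inner (row m) b\<bar> \<le> C" if "m < k" "b \<in> B" for m b
  proof -
    have "\<bar>inner (row m) b\<bar> \<le> (\<Sum>b\<in>B. \<bar>inner (row m) b\<bar>)"
      using that(2) fin_B by (intro member_le_sum) auto
    also have "\<dots> \<le> C"
      unfolding C_def using that(1) by (intro member_le_sum[where f = "\<lambda>m. \<Sum>b\<in>B. \<bar>inner (row m) b\<bar>"]) (auto intro: sum_nonneg)
    finally show ?thesis .
  qed
  have "m \<ge> 1 \<Longrightarrow> \<forall>x\<in>pos_cone. \<bar>inner (row m) x\<bar> \<le> C * inner (zrow m) x" for m
    using k2
  proof (induction m rule: digit_induct)
    case (digit m)
    show ?case
    proof
      fix x assume x: "x \<in> pos_cone"
      then have xS: "x \<in> S" and x0: "\<And>b. b \<in> B \<Longrightarrow> inner (d b) x \<ge> 0" by (auto simp: pos_cone_def)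
      have "\<bar>inner (row m) x\<bar> \<le> (\<Sum>b\<in>B. \<bar>inner (d b) x * inner (row m) b\<bar>)"
        unfolding inner_expand[OF xS, of "row m"] by (rule sum_abs)
      also have "\<dots> \<le> (\<Sum>b\<in>B. inner (d b) x * C)"
        using C[OF digit(1)] x0 by (intro sum_mono) (simp add: abs_mult mult_left_mono)
      also have "\<dots> = C * inner (zrow m) x"
        using digit(1) by (simp add: cyl_row_less inner_coord_sum sum_distrib_left mult.commute)
      finally show "\<bar>inner (row m) x\<bar> \<le> C * inner (zrow m) x" .
    qed
  next
    case (step m i)
    show ?case
    proof
      fix x assume x: "x \<in> pos_cone"
      then have "\<bar>inner (row (k * m + i)) x\<bar> = \<bar>inner (row m) (H i *v x)\<bar>"
        using step by (subst row_hat) (auto simp: pos_cone_def)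
      also have "\<dots> \<le> C * inner (zrow m) (H i *v x)"
        using step T_pos_cone[OF step(2) x] by blast
      also have "inner (zrow m) (H i *v x) = inner (zrow (k * m + i)) x"
        using step k2 by (simp add: cyl_row_step dot_lmul_matrix)
      finally show "\<bar>inner (row (k * m + i)) x\<bar> \<le> C * inner (zrow (k * m + i)) x" .
    qed
  qed
  moreover have "C \<ge> 0" by (auto simp: C_def intro!: sum_nonneg)
  ultimately show thesis by (intro that[of C]) blast+
qed

text \<open>\<open>asymp n\<close> may leave the cone, but its coordinates are bounded by D times
  those of y, and \<open>zrow m\<close> is nonnegative on the basis.\<close>

lemma row_asymp_le:
  obtains C where "C \<ge> 0" "\<And>m n. m \<ge> 1 \<Longrightarrow> \<bar>inner (row m) (asymp n)\<bar> \<le> C * inner (zrow m) y"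
proof (rule row_le_zrow)
  fix C assume C: "C \<ge> 0" "\<And>m x. m \<ge> 1 \<Longrightarrow> x \<in> pos_cone \<Longrightarrow> \<bar>inner (row m) x\<bar> \<le> C * inner (zrow m) x"
  from asymp_bounded obtain C1 where C1: "\<forall>n. norm (asymp n) \<le> C1" ..
  have C1_0: "C1 \<ge> 0" using C1[rule_format, of 0] norm_ge_zero[of "asymp 0"] by linarith
  define D where "D = (\<Sum>b\<in>B. norm (d b) * C1 / inner (d b) y)"
  have D: "\<bar>inner (d b) (asymp n)\<bar> \<le> D * inner (d b) y" if b: "b \<in> B" for b n
  proof -
    have "norm (d b) * C1 / inner (d b) y \<le> D"
      unfolding D_def using b fin_B y_pos C1_0
      by (intro member_le_sum[where f = "\<lambda>b. norm (d b) * C1 / inner (d b) y"]) (auto intro: divide_nonneg_pos)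
    then have "norm (d b) * C1 \<le> D * inner (d b) y" using y_pos[OF b] by (simp add: pos_divide_le_eq)
    moreover have "\<bar>inner (d b) (asymp n)\<bar> \<le> norm (d b) * norm (asymp n)" by (rule Cauchy_Schwarz_ineq2)
    moreover have "norm (d b) * norm (asymp n) \<le> norm (d b) * C1" using C1 by (intro mult_left_mono) auto
    ultimately show ?thesis by linarith
  qed
  have D0: "D \<ge> 0" unfolding D_def using y_pos C1_0 by (intro sum_nonneg) (auto intro: divide_nonneg_pos)
  have "\<bar>inner (row m) (asymp n)\<bar> \<le> (C * D) * inner (zrow m) y" if m: "m \<ge> 1" for m n
  proof -
    have "\<bar>inner (row m) (asymp n)\<bar> \<le> (\<Sum>b\<in>B. \<bar>inner (d b) (asymp n) * inner (row m) b\<bar>)"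
      unfolding inner_expand[OF asymp_in_hat_space, of "row m"] by (rule sum_abs)
    also have "\<dots> \<le> (\<Sum>b\<in>B. D * inner (d b) y * (C * inner (zrow m) b))"
    proof (rule sum_mono)
      fix b assume b: "b \<in> B"
      show "\<bar>inner (d b) (asymp n) * inner (row m) b\<bar> \<le> D * inner (d b) y * (C * inner (zrow m) b)"
        unfolding abs_mult using D[OF b] C(2)[OF m B_pos_cone[OF b]] y_pos[OF b] D0
        by (intro mult_mono) auto
    qed
    also have "\<dots> = (C * D) * inner (zrow m) y"
      by (simp add: inner_expand[OF y_S, of "zrow m"] sum_distrib_left mult_ac)
    finally show ?thesis .
  qed
  then show thesis using C(1) D0 by (intro that[of "C * D"]) auto
qed

lemma zrow_y_nonneg: "inner (zrow m) y \<ge> 0"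
  by (rule dual_y_nonneg[OF y_S Hy y_pos \<rho>_pos c_le_\<rho> zrow_dual_cone])

text \<open>The mass is a quotient of \<open>inner (row m)\<close> and \<open>total\<close> at
  normalised powers with indices differing by L; the ratio of scales contributes \<rho>^-L. The
  limit inequality holds eventually along all N, hence along every subsequence.\<close>

lemma cylinder_mass:
  obtains C where "C \<ge> 0" "\<And>L m \<epsilon>. m \<ge> 1 \<Longrightarrow> \<epsilon> > 0 \<Longrightarrow> \<forall>\<^sub>F N in sequentially.
    (\<Sum>x<k ^ (N - L). f (m * k ^ (N - L) + x)) / block_sum k f N \<le> C * inner (zrow m) y / \<rho> ^ L + \<epsilon>"
proof (rule row_asymp_le, rule total_sv_lower)
  fix C \<delta> :: real
  assume C: "C \<ge> 0" "\<And>m n. m \<ge> 1 \<Longrightarrow> \<bar>inner (row m) (asymp n)\<bar> \<le> C * inner (zrow m) y"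
    and \<delta>: "\<delta> > 0" "\<forall>\<^sub>F n in sequentially. total (sv n) \<ge> \<delta>"
  have "\<forall>\<^sub>F N in sequentially. (\<Sum>x<k ^ (N - L). f (m * k ^ (N - L) + x)) / block_sum k f N \<le>
      (2 * C / \<delta>) * inner (zrow m) y / \<rho> ^ L + \<epsilon>" if m: "m \<ge> 1" and \<epsilon>: "\<epsilon> > 0" for L m \<epsilon>
  proof -
    \<comment> \<open>Scaled so that after multiplication by (2 / \<rho>^L) /
      \<open>\<delta>\<close> exactly \<epsilon> remains.\<close>
    define \<eta> where "\<eta> = \<epsilon> * \<delta> * \<rho> ^ L / 2"
    have \<eta>: "\<eta> > 0" using \<epsilon> \<delta>(1) \<rho>_pos by (simp add: \<eta>_def)
    have "(\<lambda>n. inner (row m) (sv n - asymp n)) \<longlonglongrightarrow> inner (row m) 0"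
      by (intro tendsto_inner tendsto_const scaled_power_asymp)
    then have "\<forall>\<^sub>F n in sequentially. inner (row m) (sv n - asymp n) < \<eta>"
      using \<eta> by (intro order_tendstoD) auto
    then have sv_le: "\<forall>\<^sub>F n in sequentially. inner (row m) (sv n) \<le> C * inner (zrow m) y + \<eta>"
    proof (rule eventually_mono)
      fix n assume "inner (row m) (sv n - asymp n) < \<eta>"
      then show "inner (row m) (sv n) \<le> C * inner (zrow m) y + \<eta>"
        using C(2)[OF m, of n] by (simp add: inner_diff_right)
    qed
    \<comment> \<open>The ratio tends to 1 / \<rho>^L; the factor 2 gives an eventual strict bound
      and reappears in the constant 2 C / \<open>\<delta>\<close>.\<close>
    have "\<forall>\<^sub>F n in sequentially. scale (n + L) / scale n < 2 / \<rho> ^ L"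
      by (rule order_tendstoD(2)[OF scale_ratio]) (use \<rho>_pos in \<open>simp add: divide_strict_right_mono\<close>)
    moreover have "\<forall>\<^sub>F n in sequentially. total (sv (n + L)) \<ge> \<delta>"
      using \<delta>(2) sequentially_offset[of "\<lambda>n. total (sv n) \<ge> \<delta>" L] by blast
    ultimately have "\<forall>\<^sub>F n in sequentially. (\<Sum>x<k ^ n. f (m * k ^ n + x)) / block_sum k f (n + L) \<le>
      (2 * C / \<delta>) * inner (zrow m) y / \<rho> ^ L + \<epsilon>"
      using sv_le eventually_ge_at_top[of 1]
    proof eventually_elim
      case (elim n)
      have s: "scale n > 0" "scale (n + L) > 0" using scale_pos elim by auto
      let ?F = "inner (row m) (sv n)" and ?X = "C * inner (zrow m) y + \<eta>"
      have F: "(\<Sum>x<k ^ n. f (m * k ^ n + x)) = ?F / scale n"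
        using s by (simp add: block_f[OF m])
      have Bs: "block_sum k f (n + L) = total (sv (n + L)) / scale (n + L)"
        using s by (simp add: total_sv)
      have X0: "?X \<ge> 0" using C(1) zrow_y_nonneg \<eta> by simp
      have "(\<Sum>x<k ^ n. f (m * k ^ n + x)) / block_sum k f (n + L) =
        ?F * (scale (n + L) / scale n) / total (sv (n + L))"
        unfolding F Bs by simp
      also have "\<dots> \<le> ?X * (2 / \<rho> ^ L) / \<delta>"
      proof (rule frac_le)
        have "?F * (scale (n + L) / scale n) \<le> ?X * (scale (n + L) / scale n)"
          using elim(3) s by (intro mult_right_mono) auto
        also have "\<dots> \<le> ?X * (2 / \<rho> ^ L)" using elim(1) X0 by (intro mult_left_mono) auto
        finally show "?F * (scale (n + L) / scale n) \<le> ?X * (2 / \<rho> ^ L)" .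
      qed (use X0 \<rho>_pos \<delta>(1) elim(2) in auto)
      also have "\<dots> = (2 * C / \<delta>) * inner (zrow m) y / \<rho> ^ L + \<epsilon>"
        using \<delta>(1) \<rho>_pos by (simp add: \<eta>_def field_simps)
      finally show ?case .
    qed
    then obtain N0 where N0: "\<forall>n\<ge>N0. (\<Sum>x<k ^ n. f (m * k ^ n + x)) / block_sum k f (n + L) \<le>
      (2 * C / \<delta>) * inner (zrow m) y / \<rho> ^ L + \<epsilon>" unfolding eventually_sequentially ..
    have "(\<Sum>x<k ^ (N - L). f (m * k ^ (N - L) + x)) / block_sum k f N \<le>
      (2 * C / \<delta>) * inner (zrow m) y / \<rho> ^ L + \<epsilon>" if "N \<ge> N0 + L" for N
      using N0[rule_format, of "N - L"] that by simp
    then show ?thesis unfolding eventually_sequentially by (intro exI[of _ "N0 + L"]) simp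
  qed
  then show thesis using C(1) \<delta>(1) by (intro that[of "2 * C / \<delta>"]) auto
qed

end

lemma not_singular_and_absolutely_continuous:
  assumes "ghost_measure k f \<nu>" "singular_continuous \<nu>"
  shows "\<not> absolutely_continuous torus_lebesgue \<nu>"
proof
  assume ac: "absolutely_continuous torus_lebesgue \<nu>"
  interpret prob_space \<nu> using assms(1) by (simp add: ghost_measure_def)
  from assms(2) obtain X where X: "X \<in> null_sets torus_lebesgue" "space \<nu> - X \<in> null_sets \<nu>"
    unfolding singular_continuous_def by blast
  have "X \<in> null_sets \<nu>" using ac X(1) unfolding absolutely_continuous_def by blast
  then have "X \<union> (space \<nu> - X) \<in> null_sets \<nu>" using X(2) by (rule null_sets.Un)
  moreover have "X \<subseteq> space \<nu>" using \<open>X \<in> null_sets \<nu>\<close> by (auto dest: sets.sets_into_space)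
  ultimately have "space \<nu> \<in> null_sets \<nu>" by (simp add: Un_absorb1)
  then show False using emeasure_space_1 by (simp add: null_sets_def)
qed

section \<open>Type of the ghost measures\<close>

context positive_ghost_rep
begin

lemma zrow_le_norm:
  assumes "j < K L" "\<And>w. w \<in> words k L \<Longrightarrow> norm (word_prod H w *v y) \<le> E"
  shows "inner (zrow (k ^ L + j)) y \<le> norm coord_sum * E"
proof -
  have "k ^ L + k ^ L * (k - 1) = k ^ Suc L" using k2 by (cases k) auto
  then have "k ^ L + j < k ^ Suc L" using assms(1) by linarith
  then obtain w where w: "w \<in> words k L" "zrow (k ^ L + j) = coord_sum v* word_prod H w"
    using cyl_row_word[OF k2 le_add1] by blast
  have "inner (zrow (k ^ L + j)) y = inner coord_sum (word_prod H w *v y)"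
    unfolding w(2) by (rule dot_lmul_matrix)
  also have "\<dots> \<le> norm coord_sum * norm (word_prod H w *v y)" by (rule norm_cauchy_schwarz)
  also have "\<dots> \<le> norm coord_sum * E" by (intro mult_left_mono assms(2) w(1)) simp
  finally show ?thesis .
qed

text \<open>This is where the joint spectral radius being below \<rho> enters: with t strictly
  between, the masses are of order (t / \<rho>)^L, uniformly in j.\<close>

lemma eventually_zrow_small:
  assumes "C \<ge> 0" "\<epsilon> > 0"
  shows "\<exists>L. \<forall>j<K L. C * inner (zrow (k ^ L + j)) y / \<rho> ^ L \<le> \<epsilon>"
proof -
  obtain t where t: "joint_spectral_radius k H < t" "t < \<rho>" using dense[OF jsr_less] by (elim exE conjE)
  have k0: "k > 0" using k2 by simp
  have t0: "t \<ge> 0" using joint_spectral_radius_nonneg[OF k0, of H] t(1) by linarith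
  let ?D = "C * norm coord_sum * norm y"
  have "(\<lambda>L. ?D * (t / \<rho>) ^ L) \<longlonglongrightarrow> ?D * 0"
    by (intro tendsto_mult tendsto_const LIMSEQ_realpow_zero) (use t t0 \<rho>_pos in auto)
  then have "\<forall>\<^sub>F L in sequentially. ?D * (t / \<rho>) ^ L < \<epsilon>" using assms(2) by (intro order_tendstoD) auto
  moreover have "\<forall>\<^sub>F L in sequentially. max_norm k H L < t ^ L" by (rule eventually_max_norm_less[OF k0 t(1)])
  ultimately have "\<forall>\<^sub>F L in sequentially. ?D * (t / \<rho>) ^ L < \<epsilon> \<and> max_norm k H L < t ^ L"
    by (rule eventually_conj)
  from eventually_happens'[OF sequentially_bot this] obtain L
    where L: "?D * (t / \<rho>) ^ L < \<epsilon>" "max_norm k H L < t ^ L" by (elim exE conjE)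
  have "C * inner (zrow (k ^ L + j)) y / \<rho> ^ L \<le> \<epsilon>" if j: "j < K L" for j
  proof -
    have "inner (zrow (k ^ L + j)) y \<le> norm coord_sum * (t ^ L * norm y)"
    proof (rule zrow_le_norm[OF j])
      fix w assume "w \<in> words k L"
      then have "norm (word_prod H w *v y) \<le> max_norm k H L * norm y" by (rule norm_word_prod_le)
      also have "\<dots> \<le> t ^ L * norm y" using L(2) by (intro mult_right_mono) auto
      finally show "norm (word_prod H w *v y) \<le> t ^ L * norm y" .
    qed
    then have "C * inner (zrow (k ^ L + j)) y / \<rho> ^ L \<le> C * (norm coord_sum * (t ^ L * norm y)) / \<rho> ^ L"
      using assms(1) \<rho>_pos by (intro divide_right_mono mult_left_mono) auto
    also have "\<dots> = ?D * (t / \<rho>) ^ L" by (simp add: power_divide)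
    finally show ?thesis using L(1) by linarith
  qed
  then show ?thesis by blast
qed

lemma integral_block_measure_le:
  assumes pos: "block_sum k f N > 0" and LN: "L \<le> N" and J: "J \<subseteq> {..<K L}"
    and cont: "continuous_on UNIV \<phi>" and range: "\<And>t. 0 \<le> \<phi> t \<and> \<phi> t \<le> (1::real)"
    and supp: "\<And>t. t \<in> {0..<1} \<Longrightarrow> \<phi> t > 0 \<Longrightarrow> t \<in> (\<Union>j\<in>J. cyl (K L) j)"
  shows "integral\<^sup>L (block_measure k f N) \<phi> \<le>
    (\<Sum>j\<in>J. (\<Sum>x<k ^ (N - L). f ((k ^ L + j) * k ^ (N - L) + x)) / block_sum k f N)"
proof -
  define D where "D = k ^ (N - L)"
  have D: "D > 0" using k2 by (simp add: D_def)
  have kN: "k ^ N = k ^ L * D" using LN by (simp add: D_def power_add[symmetric])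
  have KN: "K N = D * K L" by (simp add: kN)
  let ?p = "\<lambda>x. f (k ^ N + x) / block_sum k f N"
  have p: "?p x \<ge> 0" for x using pos f_nonneg by (simp add: less_imp_le)
  let ?X = "\<Union>j\<in>J. {j * D..<j * D + D}"
  have fin_J: "finite J" using J by (rule finite_subset) simp
  \<comment> \<open>Atoms of the block measure at level N inside \<open>cyl (K L) j\<close> are
    exactly those with index in an interval of length D = k^(N-L), since K N = D K L.\<close>
  have \<phi>0: "\<phi> (real x / real (K N)) = 0" if x: "x < K N" "x \<notin> ?X" for x
  proof (rule ccontr)
    assume "\<phi> (real x / real (K N)) \<noteq> 0"
    then have "\<phi> (real x / real (K N)) > 0" using range[of "real x / real (K N)"] by simp
    moreover have "real x / real (K N) \<in> {0..<1}" using x(1) K_pos[of N] by (simp add: divide_less_eq del: of_nat_mult)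
    ultimately obtain j where j: "j \<in> J" "real x / real (K N) \<in> cyl (K L) j" using supp by blast
    have "real (K N) = real D * real (K L)" by (simp only: KN of_nat_mult)
    then have quot: "real x / real (K N) = real x / real D / real (K L)"
      by (simp only: divide_divide_eq_left)
    have KL: "real (K L) > 0" using K_pos[of L] by (simp only: of_nat_0_less_iff)
    from j(2) have "real j / real (K L) \<le> real x / real D / real (K L)"
      "real x / real D / real (K L) < real (Suc j) / real (K L)"
      unfolding cyl_def quot by (simp_all only: atLeastLessThan_iff)
    then have "real j \<le> real x / real D" "real x / real D < real (Suc j)"
      using KL unfolding divide_le_cancel divide_less_cancel by blast+
    then have "real j * real D \<le> real x" "real x < real (Suc j) * real D"
      using D by (simp_all add: pos_le_divide_eq pos_divide_less_eq del: of_nat_Suc)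
    then have "j * D \<le> x" "x < Suc j * D"
      by (simp_all only: of_nat_mult[symmetric] of_nat_le_iff of_nat_less_iff)
    then have "x \<in> ?X" using j(1) by (intro UN_I[of j]) auto
    then show False using x(2) by blast
  qed
  have meas: "\<phi> \<in> borel_measurable torus_borel" by (rule continuous_torus_measurable[OF refl cont])
  have "integral\<^sup>L (block_measure k f N) \<phi> = (\<Sum>x<K N. ?p x * \<phi> (real x / real (K N)))"
    by (rule prob_space_block_measure(2)[OF pos f_nonneg k2 meas])
  also have "\<dots> = (\<Sum>x\<in>{..<K N} \<inter> ?X. ?p x * \<phi> (real x / real (K N)))"
  proof (rule sum.mono_neutral_right)
    show "\<forall>x\<in>{..<K N} - {..<K N} \<inter> ?X. ?p x * \<phi> (real x / real (K N)) = 0"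
    proof
      fix x assume "x \<in> {..<K N} - {..<K N} \<inter> ?X"
      then have "x < K N" "x \<notin> ?X" by blast+
      from \<phi>0[OF this] show "?p x * \<phi> (real x / real (K N)) = 0" by (simp only: mult_zero_right)
    qed
  qed auto
  also have "\<dots> \<le> (\<Sum>x\<in>{..<K N} \<inter> ?X. ?p x * 1)"
    using p range by (intro sum_mono mult_left_mono) auto
  also have "\<dots> \<le> (\<Sum>x\<in>?X. ?p x)"
    using p fin_J by (simp only: mult_1_right) (rule sum_mono2, auto)
  also have "\<dots> = (\<Sum>j\<in>J. \<Sum>x\<in>{j * D..<j * D + D}. ?p x)"
  proof (rule sum.UNION_disjoint[OF fin_J])
    show "\<forall>i\<in>J. \<forall>j\<in>J. i \<noteq> j \<longrightarrow> {i * D..<i * D + D} \<inter> {j * D..<j * D + D} = {}"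
    proof (intro ballI impI)
      fix i j :: nat assume "i \<noteq> j"
      then have "Suc i \<le> j \<or> Suc j \<le> i" by linarith
      then have "Suc i * D \<le> j * D \<or> Suc j * D \<le> i * D" by (meson mult_le_mono1)
      then show "{i * D..<i * D + D} \<inter> {j * D..<j * D + D} = {}" by auto
    qed
  qed auto
  also have "\<dots> = (\<Sum>j\<in>J. (\<Sum>x<D. f ((k ^ L + j) * D + x)) / block_sum k f N)"
  proof (rule sum.cong[OF refl])
    fix j
    have "(\<Sum>x\<in>{j * D..<j * D + D}. ?p x) = (\<Sum>x<D. ?p (j * D + x))"
      by (subst sum.atLeastLessThan_shift_0) (simp add: atLeast0LessThan)
    also have "\<dots> = (\<Sum>x<D. f ((k ^ L + j) * D + x)) / block_sum k f N"
      by (simp add: sum_divide_distrib kN algebra_simps)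
    finally show "(\<Sum>x\<in>{j * D..<j * D + D}. ?p x) = (\<Sum>x<D. f ((k ^ L + j) * D + x)) / block_sum k f N" .
  qed
  finally show ?thesis by (simp add: D_def)
qed

text \<open>The constant C is independent of the subsequence and therefore serves all ghost measures
  at once.\<close>

lemma ghost_cylinder_limit:
  obtains C where "C \<ge> 0" "\<And>\<nu>. ghost_measure k f \<nu> \<Longrightarrow>
    \<exists>\<mu>. cylinder_limit \<nu> \<mu> K (\<lambda>L j. C * inner (zrow (k ^ L + j)) y / \<rho> ^ L)"
proof (rule cylinder_mass)
  fix C assume C: "C \<ge> 0" and mass: "\<And>L m \<epsilon>. m \<ge> 1 \<Longrightarrow> \<epsilon> > 0 \<Longrightarrow> \<forall>\<^sub>F N in sequentially.
    (\<Sum>x<k ^ (N - L). f (m * k ^ (N - L) + x)) / block_sum k f N \<le> C * inner (zrow m) y / \<rho> ^ L + \<epsilon>"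
  let ?b = "\<lambda>L j. C * inner (zrow (k ^ L + j)) y / \<rho> ^ L"
  have "\<exists>\<mu>. cylinder_limit \<nu> \<mu> K ?b" if ghost: "ghost_measure k f \<nu>" for \<nu>
  proof -
    from ghost have prob: "prob_space \<nu>" and sets: "sets \<nu> = sets torus_borel"
      unfolding ghost_measure_def by blast+
    from ghost have "\<exists>s::nat \<Rightarrow> nat. strict_mono s \<and> (\<forall>n. block_sum k f (s n) \<noteq> 0) \<and>
        torus_weak_conv (\<lambda>n. block_measure k f (s n)) \<nu>"
      unfolding ghost_measure_def by blast
    then obtain s :: "nat \<Rightarrow> nat" where s: "strict_mono s" "\<forall>n. block_sum k f (s n) \<noteq> 0"
      "torus_weak_conv (\<lambda>n. block_measure k f (s n)) \<nu>" by (elim exE conjE)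
    have "cylinder_limit \<nu> (\<lambda>n. block_measure k f (s n)) K ?b"
    proof (rule cylinder_limit.intro)
      show "prob_space \<nu>" "sets \<nu> = sets torus_borel" "torus_weak_conv (\<lambda>n. block_measure k f (s n)) \<nu>"
        by (rule prob, rule sets, rule s(3))
      show "0 < K L" for L by (rule K_pos)
    next
      fix L J and \<phi> :: "real \<Rightarrow> real" and \<epsilon> :: real
      assume J: "J \<subseteq> {..<K L}" and \<epsilon>: "\<epsilon> > 0" and cont: "continuous_on UNIV \<phi>"
        and range: "\<And>t. 0 \<le> \<phi> t \<and> \<phi> t \<le> 1"
        and supp: "\<And>t. t \<in> {0..<1} \<Longrightarrow> \<phi> t > 0 \<Longrightarrow> t \<in> (\<Union>j\<in>J. cyl (K L) j)"
      have fin_J: "finite J" using J by (rule finite_subset) simp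
      let ?F = "\<lambda>j N. (\<Sum>x<k ^ (N - L). f ((k ^ L + j) * k ^ (N - L) + x)) / block_sum k f N"
      \<comment> \<open>Distributes \<epsilon> over the cylinders in J; the added 1 allows J to be
        empty.\<close>
      define e where "e = \<epsilon> / (real (card J) + 1)"
      have e: "e > 0" using \<epsilon> by (simp add: e_def)
      have "\<forall>\<^sub>F N in sequentially. \<forall>j\<in>J. ?F j N \<le> ?b L j + e"
      proof (rule eventually_ball_finite[OF fin_J], rule ballI)
        fix j
        have "k ^ L + j \<ge> 1" using k2 by (intro trans_le_add1) simp
        then show "\<forall>\<^sub>F N in sequentially. ?F j N \<le> ?b L j + e" by (rule mass[OF _ e])
      qed
      then have "\<forall>\<^sub>F N in sequentially. integral\<^sup>L (block_measure k f N) \<phi> \<le> (\<Sum>j\<in>J. ?b L j) + \<epsilon>"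
        using eventually_block_sum_pos eventually_ge_at_top[of L]
      proof eventually_elim
        case (elim N)
        have "integral\<^sup>L (block_measure k f N) \<phi> \<le> (\<Sum>j\<in>J. ?F j N)"
          by (rule integral_block_measure_le[OF elim(2,3) J cont range supp])
        also have "\<dots> \<le> (\<Sum>j\<in>J. ?b L j + e)" using elim(1) by (intro sum_mono) blast
        also have "\<dots> = (\<Sum>j\<in>J. ?b L j) + real (card J) * e" by (simp only: sum.distrib sum_constant)
        also have "real (card J) * e \<le> \<epsilon>" using \<epsilon> by (simp add: e_def divide_le_eq algebra_simps)
        finally show ?case by simp
      qed
      then show "\<forall>\<^sub>F n in sequentially. integral\<^sup>L (block_measure k f (s n)) \<phi> \<le> (\<Sum>j\<in>J. ?b L j) + \<epsilon>"
        by (rule eventually_compose_filterlim[OF _ filterlim_subseq[OF s(1)]])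
    next
      fix \<epsilon> :: real assume "\<epsilon> > 0"
      then show "\<exists>L. \<forall>j<K L. ?b L j \<le> \<epsilon>" by (rule eventually_zrow_small[OF C])
    qed
    then show ?thesis by (rule exI[of _ "\<lambda>n. block_measure k f (s n)"])
  qed
  then show thesis using C by (intro that[of C])
qed

lemma ghost_measure_exists: "\<exists>\<nu>. ghost_measure k f \<nu>"
proof -
  from eventually_block_sum_pos obtain N0 where N0: "\<forall>n\<ge>N0. block_sum k f n > 0"
    unfolding eventually_sequentially ..
  let ?\<mu> = "\<lambda>n. block_measure k f (N0 + n)"
  have pos: "block_sum k f (N0 + n) > 0" for n using N0 by simp
  have "\<exists>r \<nu>. strict_mono r \<and> prob_space \<nu> \<and> sets \<nu> = sets torus_borel \<and> torus_weak_conv (\<lambda>n. ?\<mu> (r n)) \<nu>"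
    by (rule periodic_weak_limit_exists) (rule prob_space_block_measure(1)[OF pos f_nonneg k2], simp add: block_measure_def)
  then obtain r \<nu> where r: "strict_mono r" "prob_space \<nu>" "sets \<nu> = sets torus_borel"
    "torus_weak_conv (\<lambda>n. ?\<mu> (r n)) \<nu>" by (elim exE conjE)
  have "strict_mono (\<lambda>n. N0 + r n)" using r(1) by (simp add: strict_mono_def)
  moreover have "block_sum k f (N0 + r n) \<noteq> 0" for n using pos[of "r n"] by simp
  ultimately have "ghost_measure k f \<nu>" unfolding ghost_measure_def using r(2-4)
    by (intro conjI exI[of _ "\<lambda>n. N0 + r n"] allI)
  then show ?thesis by (rule exI)
qed

lemma ghost_absolutely_continuous:
  assumes eq: "\<rho> / real k = joint_spectral_radius k H" and ghost: "ghost_measure k f \<nu>"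
  shows "absolutely_continuous torus_lebesgue \<nu>"
proof (rule ghost_cylinder_limit)
  fix C assume C: "C \<ge> 0" and lim: "\<And>\<nu>. ghost_measure k f \<nu> \<Longrightarrow>
    \<exists>\<mu>. cylinder_limit \<nu> \<mu> K (\<lambda>L j. C * inner (zrow (k ^ L + j)) y / \<rho> ^ L)"
  from lim[OF ghost] obtain \<mu> where "cylinder_limit \<nu> \<mu> K (\<lambda>L j. C * inner (zrow (k ^ L + j)) y / \<rho> ^ L)" ..
  then interpret cylinder_limit \<nu> \<mu> K "\<lambda>L j. C * inner (zrow (k ^ L + j)) y / \<rho> ^ L" .
  let ?r = "joint_spectral_radius k H"
  have r: "?r > 0" using eq \<rho>_pos k2 by (metis divide_pos_pos of_nat_0_less_iff pos2 less_le_trans)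
  from products_bounded[OF r] obtain D where D: "\<forall>w x. set w \<subseteq> {..<k} \<longrightarrow> x \<in> S \<longrightarrow>
    norm (word_prod H w *v x) \<le> D * ?r ^ length w * norm x" ..
  \<comment> \<open>The factor k - 1 is due to cylinders of level L having length 1 / (k^L (k - 1))
    rather than k^-L.\<close>
  let ?E = "C * norm coord_sum * \<bar>D\<bar> * norm y * real (k - 1)"
  show ?thesis
  proof (rule absolutely_continuous_of_cylinders[OF finite_measure_axioms sets_\<nu> K_at_top, of ?E])
    show "?E \<ge> 0" using C by simp
    fix L j assume j: "j < K L"
    have "inner (zrow (k ^ L + j)) y \<le> norm coord_sum * (\<bar>D\<bar> * ?r ^ L * norm y)"
    proof (rule zrow_le_norm[OF j])
      fix w assume "w \<in> words k L"
      then have w: "set w \<subseteq> {..<k}" "length w = L" by (auto simp: words_def)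
      have "norm (word_prod H w *v y) \<le> D * ?r ^ L * norm y" using D[rule_format, OF w(1) y_S] w(2) by simp
      also have "\<dots> \<le> \<bar>D\<bar> * ?r ^ L * norm y" using r by (intro mult_right_mono) auto
      finally show "norm (word_prod H w *v y) \<le> \<bar>D\<bar> * ?r ^ L * norm y" .
    qed
    then have "C * inner (zrow (k ^ L + j)) y / \<rho> ^ L \<le> C * (norm coord_sum * (\<bar>D\<bar> * ?r ^ L * norm y)) / \<rho> ^ L"
      using C \<rho>_pos by (intro divide_right_mono mult_left_mono) auto
    also have "?r ^ L = \<rho> ^ L / real k ^ L" by (simp add: eq[symmetric] power_divide)
    also have "C * (norm coord_sum * (\<bar>D\<bar> * (\<rho> ^ L / real k ^ L) * norm y)) / \<rho> ^ L =
        C * norm coord_sum * \<bar>D\<bar> * norm y / real k ^ L" using \<rho>_pos by simp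
    also have "\<dots> = ?E / real (K L)" using k2 by simp
    finally show "Sigma_Algebra.measure \<nu> (cyl (K L) j) \<le> ?E / real (K L)"
      by (rule order_trans[OF measure_cyl_le[OF j]])
  qed
qed

text \<open>Unrolls the recursion of \<open>affinity\<close> over the L-digit continuations of m,
  restoring the normalisation sqrt (k \<rho>) once per digit.\<close>

lemma affinity_sum:
  "m \<ge> 1 \<Longrightarrow> (\<Sum>x<k ^ L. sqrt (inner (zrow (m * k ^ L + x)) y)) =
    sqrt (real k * \<rho>) ^ L * affinity k H y \<rho> L (zrow m)"
proof (induction L arbitrary: m)
  case (Suc L)
  have "(\<Sum>x<k ^ Suc L. sqrt (inner (zrow (m * k ^ Suc L + x)) y)) =
    (\<Sum>i<k. \<Sum>x<k ^ L. sqrt (inner (zrow ((k * m + i) * k ^ L + x)) y))"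
    by (rule sum_digit_split)
  also have "\<dots> = (\<Sum>i<k. sqrt (real k * \<rho>) ^ L * affinity k H y \<rho> L (zrow m v* H i))"
  proof (rule sum.cong[OF refl])
    fix i assume "i \<in> {..<k}"
    then have "zrow (k * m + i) = zrow m v* H i" by (intro cyl_row_step k2 Suc.prems) simp
    then show "(\<Sum>x<k ^ L. sqrt (inner (zrow ((k * m + i) * k ^ L + x)) y)) =
      sqrt (real k * \<rho>) ^ L * affinity k H y \<rho> L (zrow m v* H i)"
      using Suc.IH[OF k_times_ge[OF Suc.prems]] by simp
  qed
  also have "\<dots> = sqrt (real k * \<rho>) ^ Suc L * affinity k H y \<rho> (Suc L) (zrow m)"
  proof -
    have "sqrt (real k * \<rho>) \<noteq> 0" using k2 \<rho>_pos by simp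
    moreover have "a = s * (a / s)" if "s \<noteq> 0" for a s :: real using that by simp
    ultimately have "a = sqrt (real k * \<rho>) * (a / sqrt (real k * \<rho>))" for a :: real by blast
    then show ?thesis
      unfolding affinity.simps sum_distrib_left[symmetric] power_Suc mult.assoc mult.left_commute[of "sqrt (real k * \<rho>)"]
      by (rule arg_cong)
  qed
  finally show ?case .
qed simp

lemma ghost_singular_continuous:
  assumes less: "\<rho> / real k < joint_spectral_radius k H" and ghost: "ghost_measure k f \<nu>"
  shows "singular_continuous \<nu>"
proof (rule ghost_cylinder_limit)
  fix C assume C: "C \<ge> 0" and lim: "\<And>\<nu>. ghost_measure k f \<nu> \<Longrightarrow>
    \<exists>\<mu>. cylinder_limit \<nu> \<mu> K (\<lambda>L j. C * inner (zrow (k ^ L + j)) y / \<rho> ^ L)"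
  from lim[OF ghost] obtain \<mu> where "cylinder_limit \<nu> \<mu> K (\<lambda>L j. C * inner (zrow (k ^ L + j)) y / \<rho> ^ L)" ..
  then interpret cylinder_limit \<nu> \<mu> K "\<lambda>L j. C * inner (zrow (k ^ L + j)) y / \<rho> ^ L" .
  let ?s = "\<lambda>L. \<Sum>j<K L. sqrt (Sigma_Algebra.measure \<nu> (cyl (K L) j) / real (K L))"
  \<comment> \<open>Each of the k - 1 leading digits contributes the same affinity, as its row is
    \<open>coord_sum\<close>; the powers of k and \<rho> cancel and sqrt (C / (k - 1)) is
    left.\<close>
  let ?D = "real (k - 1) * sqrt (C / real (k - 1))"
  have bound: "?s L \<le> ?D * affinity k H y \<rho> L coord_sum" for L
  proof -
    let ?q = "sqrt (C / (\<rho> ^ L * real (K L)))"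
    have "?s L \<le> (\<Sum>j<K L. ?q * sqrt (inner (zrow (k ^ L + j)) y))"
    proof (rule sum_mono)
      fix j assume "j \<in> {..<K L}"
      then have "Sigma_Algebra.measure \<nu> (cyl (K L) j) \<le> C * inner (zrow (k ^ L + j)) y / \<rho> ^ L"
        by (intro measure_cyl_le) simp
      then have "Sigma_Algebra.measure \<nu> (cyl (K L) j) / real (K L) \<le> C * inner (zrow (k ^ L + j)) y / \<rho> ^ L / real (K L)"
        by (rule divide_right_mono) simp
      also have "\<dots> = C / (\<rho> ^ L * real (K L)) * inner (zrow (k ^ L + j)) y" by simp
      finally have "sqrt (Sigma_Algebra.measure \<nu> (cyl (K L) j) / real (K L)) \<le> sqrt (C / (\<rho> ^ L * real (K L)) * inner (zrow (k ^ L + j)) y)"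
        by (rule real_sqrt_le_mono)
      then show "sqrt (Sigma_Algebra.measure \<nu> (cyl (K L) j) / real (K L)) \<le> ?q * sqrt (inner (zrow (k ^ L + j)) y)"
        by (simp only: real_sqrt_mult)
    qed
    also have "\<dots> = ?q * (\<Sum>i\<in>{1..<k}. \<Sum>x<k ^ L. sqrt (inner (zrow (i * k ^ L + x)) y))"
      unfolding sum_distrib_left[symmetric] using k2
      by (subst sum_leading_digit_split[of k "\<lambda>m. sqrt (inner (zrow m) y)"]) auto
    also have "(\<Sum>i\<in>{1..<k}. \<Sum>x<k ^ L. sqrt (inner (zrow (i * k ^ L + x)) y)) =
        (\<Sum>i\<in>{1..<k}. sqrt (real k * \<rho>) ^ L * affinity k H y \<rho> L coord_sum)"
      by (intro sum.cong refl) (simp add: affinity_sum cyl_row_less)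
    also have "\<dots> = real (k - 1) * (sqrt (real k * \<rho>) ^ L * affinity k H y \<rho> L coord_sum)" by simp
    also have "?q * (real (k - 1) * (sqrt (real k * \<rho>) ^ L * affinity k H y \<rho> L coord_sum)) =
        real (k - 1) * (?q * sqrt (real k * \<rho>) ^ L) * affinity k H y \<rho> L coord_sum" by (simp only: mult_ac)
    also have "?q * sqrt (real k * \<rho>) ^ L = sqrt (C / real (k - 1))"
    proof -
      have "?q * sqrt (real k * \<rho>) ^ L = sqrt (C / (\<rho> ^ L * real (K L)) * (real k * \<rho>) ^ L)"
        by (simp only: real_sqrt_mult real_sqrt_power)
      also have "C / (\<rho> ^ L * real (K L)) * (real k * \<rho>) ^ L = C / real (k - 1)"
        using \<rho>_pos k2 by (simp add: power_mult_distrib)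
      finally show ?thesis .
    qed
    finally show ?thesis .
  qed
  have "(\<lambda>L. ?D * affinity k H y \<rho> L coord_sum) \<longlonglongrightarrow> ?D * 0"
    by (intro tendsto_mult tendsto_const affinity_tendsto_0[OF y_S Hy y_pos \<rho>_pos c_le_\<rho> less coord_sum_dual_cone])
  then have lim0: "(\<lambda>L. ?D * affinity k H y \<rho> L coord_sum) \<longlonglongrightarrow> 0" by simp
  have "?s \<longlonglongrightarrow> 0"
    by (rule tendsto_sandwich[OF always_eventually always_eventually tendsto_const lim0])
      (use bound in \<open>auto intro!: sum_nonneg simp: measure_nonneg\<close>)
  from singular_of_cylinders[OF finite_measure_axioms sets_\<nu> K_pos this]
  have "\<exists>X\<in>null_sets torus_lebesgue. space \<nu> - X \<in> null_sets \<nu>" .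
  moreover have "\<forall>x\<in>{0..<1}. emeasure \<nu> {x} = 0" using no_atoms by (simp add: emeasure_eq_measure)
  ultimately show ?thesis unfolding singular_continuous_def by (intro conjI)
qed

theorem dichotomy:
  "(\<rho> / real k < joint_spectral_radius k H \<longleftrightarrow> (\<forall>\<nu>. ghost_measure k f \<nu> \<longrightarrow> singular_continuous \<nu>)) \<and>
   (\<rho> / real k = joint_spectral_radius k H \<longleftrightarrow>
      (\<forall>\<nu>. ghost_measure k f \<nu> \<longrightarrow> absolutely_continuous torus_lebesgue \<nu>))"
proof -
  from ghost_measure_exists obtain \<nu>\<^sub>0 where \<nu>\<^sub>0: "ghost_measure k f \<nu>\<^sub>0" ..
  note excl = not_singular_and_absolutely_continuous[OF \<nu>\<^sub>0]
  show ?thesis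
  proof (cases "\<rho> / real k = joint_spectral_radius k H")
    case True
    have ac: "\<forall>\<nu>. ghost_measure k f \<nu> \<longrightarrow> absolutely_continuous torus_lebesgue \<nu>"
      using ghost_absolutely_continuous[OF True] by (intro allI impI)
    then have "\<not> singular_continuous \<nu>\<^sub>0" using excl \<nu>\<^sub>0 by blast
    then show ?thesis using ac True \<nu>\<^sub>0 by auto
  next
    case False
    then have less: "\<rho> / real k < joint_spectral_radius k H" using jsr_lower by simp
    have sing: "\<forall>\<nu>. ghost_measure k f \<nu> \<longrightarrow> singular_continuous \<nu>"
      using ghost_singular_continuous[OF less] by (intro allI impI)
    then have "\<not> absolutely_continuous torus_lebesgue \<nu>\<^sub>0" using excl \<nu>\<^sub>0 by blast
    then show ?thesis using sing less False \<nu>\<^sub>0 by auto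
  qed
qed

end

theorem theorem4:
  fixes k :: nat and f :: "nat \<Rightarrow> real"
    and u v :: "real^'d" and A :: "nat \<Rightarrow> real^'d^'d" and B :: "(real^'d) set"
  defines "\<rho>\<^sub>J \<equiv> joint_spectral_radius k (hat k u A v)"
    and "\<rho> \<equiv> spec_rad (\<Sum>i<k. hat k u A v i)"
  assumes "k \<ge> 2"
    and "\<forall>n. f n \<ge> 0"
    and "k_regular k f"
    and "minimal_representation k f u A v"
    and "nondegenerate_representation k u A v"
    and "Real_Vector_Spaces.independent B"
    and "Real_Vector_Spaces.span B = hat_space k u A v"
    and "\<forall>i<k. nonneg_in_basis B (hat k u A v i)"
    and "no_common_invariant_subspace k (hat_space k u A v) (hat k u A v)"
    and "\<rho>\<^sub>J < \<rho>"
  shows "(\<rho> / real k < \<rho>\<^sub>J \<longleftrightarrow> (\<forall>\<nu>. ghost_measure k f \<nu> \<longrightarrow> singular_continuous \<nu>)) \<and>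
         (\<rho> / real k = \<rho>\<^sub>J \<longleftrightarrow> (\<forall>\<nu>. ghost_measure k f \<nu> \<longrightarrow> absolutely_continuous torus_lebesgue \<nu>))"
proof -
  from spectral_projections_exist[of "tilde_sum k u A"] obtain Z Pr
    where sp: "spectral_projections (tilde_sum k u A) Z Pr" by (elim exE)
  have lin: "linear_representation k f u A v"
    using assms(6) unfolding minimal_representation_def by (rule conjunct1)
  have nonneg_f: "f n \<ge> 0" for n using assms(4) by simp
  have gr: "ghost_rep k u A Z Pr v f"
    by (rule ghost_rep.intro[OF nondegenerate_rep.intro[OF sp nondegenerate_rep_axioms.intro[OF assms(7)]]
          ghost_rep_axioms.intro[OF assms(3) nonneg_f lin]])
  interpret ghost_rep k u A Z Pr v f by (rule gr)
  obtain d :: "real^'d \<Rightarrow> real^'d" where d: "\<And>b. d b \<in> Real_Vector_Spaces.span B"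
    "\<And>b c. b \<in> B \<Longrightarrow> c \<in> B \<Longrightarrow> inner (d c) b = (if b = c then 1 else 0)"
    "\<And>x b. x \<in> Real_Vector_Spaces.span B \<Longrightarrow> b \<in> B \<Longrightarrow> inner (d b) x = Real_Vector_Spaces.representation B x b"
    "\<And>x. x \<in> Real_Vector_Spaces.span B \<Longrightarrow> (\<Sum>b\<in>B. inner (d b) x *\<^sub>R b) = x"
    by (rule coordinate_functionals[OF assms(8)]) (rule that)
  note d = d[unfolded assms(9)]
  have irr: "irreducible_family k (hat k u A v) (hat_space k u A v)"
    by (rule irreducible_family.intro)
      (use k2 in simp, rule subspace_hat_space, rule S_nonzero, rule hat_in, rule hat_proj, rule assms(11))
  have pf: "positive_family k (hat k u A v) (hat_space k u A v) B d"
  proof (rule positive_family.intro[OF irr], rule positive_family_axioms.intro)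
    show "finite B" using assms(8) by (rule independent_imp_finite)
    show "B \<subseteq> hat_space k u A v" unfolding assms(9)[symmetric] by (rule span_superset)
    show "inner (d c) (hat k u A v i *v b) \<ge> 0" if "i < k" "b \<in> B" "c \<in> B" for i b c
      using assms(10) that unfolding nonneg_in_basis_def by (simp only: d(3)[OF hat_in])
  qed (rule d(1), rule d(2), assumption+, rule d(4))
  interpret positive_family k "hat k u A v" "hat_space k u A v" B d by (rule pf)
  obtain y c where y: "y \<in> hat_space k u A v" "c > 0"
    "(\<Sum>i<k. hat k u A v i) *v y = c *\<^sub>R y" "\<And>b. b \<in> B \<Longrightarrow> inner (d b) y > 0"
    by (rule perron_vector[OF H_sum_nonzero]) (rule that)
  have \<rho>: "\<rho> = spec_rad (tilde_sum k u A)" unfolding \<rho>_def by (rule spec_rad_hat_sum)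
  have less: "joint_spectral_radius k (hat k u A v) < spec_rad (tilde_sum k u A)"
    using assms(12) unfolding \<rho> \<rho>\<^sub>J_def .
  interpret positive_ghost_rep k u A Z Pr v f B d y c
    by (rule positive_ghost_rep.intro[OF gr pf positive_ghost_rep_axioms.intro[OF y(1,3,4) less]])
  show ?thesis unfolding \<rho> \<rho>\<^sub>J_def by (rule dichotomy)
qed

end
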